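(* Suppose Assumption 1 holds. Let $\mathcal M_G=\{\{1,\dots,k_m\}:m=1,\dots,M_n\}$ be a nested candidate set with $1\le k_1<\dots<k_{M_n}=p_n$, $k_0=0$, and $\max_{1\le j\le M_n-1}\frac{k_{j+1}-k_j}{k_j-k_{j-1}}\le1+\zeta_n$ for some $\zeta_n\ge0$. If $\zeta_n=o(1)$, $k_1\vee\psi(\mathcal M_G)=o[nR_n(\mathbf w^*|\mathcal M_A,\mathbf f)]$, and $p_n\mathbb E(\hat\sigma^2-\sigma^2)^2=o[nR_n(\mathbf w^*|\mathcal M_A,\mathbf f)]$, then $$Q_n(\hat{\mathbf w}|\mathcal M_G,\mathbf f)\le[1+o(1)]R_n(\mathbf w^*|\mathcal M_A,\mathbf f).$$
   Context: Setup. For each sample size $n$ we observe $\mathbf y=\mathbf f+\boldsymbol\epsilon\in\mathbb R^n$ with $\mathbf f=\mathbf X\boldsymbol\beta$, where $\mathbf X\in\mathbb R^{n\times p_n}$ is nonstochastic with full column rank, $p_n\le n$, and $\epsilon_1,\dots,\epsilon_n$ are i.i.d. sub-Gaussian with mean $0$ and variance $\sigma^2>0$. Let $\mathbf P_j$ be the orthogonal projection onto the span of the first $j$ columns of $\mathbf X$ ($\mathbf P_0=\mathbf 0$); then $\mathbf P_j-\mathbf P_{j-1}=\boldsymbol\phi_j\boldsymbol\phi_j^\top$ for unit vectors $\boldsymbol\phi_1,\dots,\boldsymbol\phi_{p_n}$ forming an orthonormal basis of the column space of $\mathbf X$. The transformed coefficients are $\theta_j=\boldsymbol\phi_j^\top\mathbf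 f/\sqrt n$. A nested candidate set is $\mathcal M=\{\{1,\dots,k_m\}:m=1,\dots,M_n\}$ with $1\le k_1<\dots<k_{M_n}\le p_n$; model $m$ gives $\hat{\mathbf f}_m=\mathbf P_{k_m}\mathbf y$. $\mathcal M_A=\{\{1,\dots,j\}:1\le j\le p_n\}$. For $\mathbf w\in\mathcal W_{M_n}=\{\mathbf w\in[0,1]^{M_n}:\sum_m w_m=1\}$, the MA estimator is $\hat{\mathbf f}_{\mathbf w|\mathcal M}=\sum_m w_m\hat{\mathbf f}_m=\mathbf P_{\mathbf w|\mathcal M}\mathbf y$; for deterministic $\mathbf w$, $R_n(\mathbf w|\mathcal M,\mathbf f)=n^{-1}\mathbb E\|\hat{\mathbf f}_{\mathbf w|\mathcal M}-\mathbf f\|^2$; $\mathbf w^*|\mathcal M$ minimizes it over $\mathcal W_{M_n}$. MMA: with $\hat\sigma^2$ an estimator of $\sigma^2$, $C_n(\mathbf w|\mathcal M,\mathbf y)=n^{-1}\|\mathbf y-\hat{\mathbf f}_{\mathbf w|\mathcal M}\|^2+2\hat\sigma^2n^{-1}\sum_mk_mw_m$; $\hat{\mathbf w}|\mathcal M$ minimizes $C_n$ over $\mathcal W_{M_n}$. $Q_n(\hat{\mathbf w}|\mathcal M,\mathbf f)$ denotes either $n^{-1}\mathbb E\|\hat{\mathbf f}_{\hat{\mathbf w}|\mathcal M}-\mathbf f\|^2$ or $\mathbb E R_n(\hat{\mathbf w}|\mathcal M,\mathbf f)=n^{-1}\mathbb E\|\mathbf f-\mathbf P_{\hat{\mathbf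 w}|\mathcal M}\mathbf f\|^2+\sigma^2n^{-1}\mathbb E\operatorname{tr}(\mathbf P_{\hat{\mathbf w}|\mathcal M}^\top\mathbf P_{\hat{\mathbf w}|\mathcal M})$. $\psi(\mathcal M)$: let $k_0=0$, $S_j=\sum_{l=k_j+1}^{k_{M_n}}\theta_l^2$ ($0\le j\le M_n-1$), $S_{M_n}=0$, $M_n'=\min\{1\le j\le M_n:S_j=0\}$, and $\psi(\mathcal M)=\big[M_n\wedge\big(1+\sum_{j=1}^{M_n-1}\frac{k_{j+1}-k_j}{4k_j}+\sum_{j=1}^{M_n'-1}\frac{S_{j-1}-S_j}{4S_j}\big)\big](1+\log M_n)^2$. Assumption 1: $\limsup_n n^{-1}\|\mathbf f\|^2<\infty$. *)

theory Defs
  imports "HOL-Probability.Probability" "HOL-Library.Landau_Symbols"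
begin

text \<open>Vectors of R^n are represented as functions nat => real; only the
  coordinates i < n are meaningful (the others are kept at 0).  An n x p matrix
  is a function nat => nat => real (row index, column index), columns are
  indexed 0..p-1, so "the first j columns" are the columns l < j.\<close>

definition ip :: "nat \<Rightarrow> (nat \<Rightarrow> real) \<Rightarrow> (nat \<Rightarrow> real) \<Rightarrow> real" where
  "ip n u v = (\<Sum>i<n. u i * v i)"

definition sq :: "nat \<Rightarrow> (nat \<Rightarrow> real) \<Rightarrow> real" where
  "sq n v = (\<Sum>i<n. (v i)^2)"

definition colspan :: "nat \<Rightarrow> (nat \<Rightarrow> nat \<Rightarrow> real) \<Rightarrow> nat \<Rightarrow> (nat \<Rightarrow> real) set" where
  "colspan n X j = {v. \<exists>c. \<forall>i. v i = (if i < n then (\<Sum>l<j. c l * X i l) else 0)}"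

definition proj :: "nat \<Rightarrow> (nat \<Rightarrow> real) set \<Rightarrow> (nat \<Rightarrow> real) \<Rightarrow> (nat \<Rightarrow> real)" where
  "proj n V y = (THE v. v \<in> V \<and> (\<forall>u\<in>V. ip n (\<lambda>i. y i - v i) u = 0))"

definition projmat :: "nat \<Rightarrow> (nat \<Rightarrow> nat \<Rightarrow> real) \<Rightarrow> nat \<Rightarrow> nat \<Rightarrow> nat \<Rightarrow> real" where
  "projmat n X j a b = proj n (colspan n X j) (\<lambda>i. if i = b then 1 else 0) a"

definition phi :: "nat \<Rightarrow> (nat \<Rightarrow> nat \<Rightarrow> real) \<Rightarrow> nat \<Rightarrow> (nat \<Rightarrow> real)" where
  "phi n X j = (SOME \<phi>. (\<forall>i. n \<le> i \<longrightarrow> \<phi> i = 0) \<and>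
      (\<forall>a<n. \<forall>b<n. projmat n X j a b - projmat n X (j - 1) a b = \<phi> a * \<phi> b))"

definition theta :: "nat \<Rightarrow> (nat \<Rightarrow> nat \<Rightarrow> real) \<Rightarrow> (nat \<Rightarrow> real) \<Rightarrow> nat \<Rightarrow> real" where
  "theta n X f j = ip n (phi n X j) f / sqrt (real n)"

text \<open>Candidate sets are given by k :: nat => nat with k 0 = 0 and models m = 1..M.\<close>
definition Ssum :: "nat \<Rightarrow> (nat \<Rightarrow> nat \<Rightarrow> real) \<Rightarrow> (nat \<Rightarrow> real) \<Rightarrow> (nat \<Rightarrow> nat) \<Rightarrow> nat \<Rightarrow> nat \<Rightarrow> real" where
  "Ssum n X f k M j = (\<Sum>l\<in>{k j + 1 .. k M}. (theta n X f l)^2)"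

definition Mprime :: "nat \<Rightarrow> (nat \<Rightarrow> nat \<Rightarrow> real) \<Rightarrow> (nat \<Rightarrow> real) \<Rightarrow> (nat \<Rightarrow> nat) \<Rightarrow> nat \<Rightarrow> nat" where
  "Mprime n X f k M = (LEAST j. 1 \<le> j \<and> j \<le> M \<and> Ssum n X f k M j = 0)"

definition psi :: "nat \<Rightarrow> (nat \<Rightarrow> nat \<Rightarrow> real) \<Rightarrow> (nat \<Rightarrow> real) \<Rightarrow> (nat \<Rightarrow> nat) \<Rightarrow> nat \<Rightarrow> real" where
  "psi n X f k M =
     min (real M)
       (1 + (\<Sum>j=1..M-1. (real (k (j+1)) - real (k j)) / (4 * real (k j)))
          + (\<Sum>j=1..Mprime n X f k M - 1.
               (Ssum n X f k M (j-1) - Ssum n X f k M j) / (4 * Ssum n X f k M j)))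
     * (1 + ln (real M))^2"

definition wsimplex :: "nat \<Rightarrow> (nat \<Rightarrow> real) set" where
  "wsimplex M = {w. (\<forall>m\<in>{1..M}. 0 \<le> w m \<and> w m \<le> 1) \<and> (\<Sum>m=1..M. w m) = 1}"

definition maest :: "nat \<Rightarrow> (nat \<Rightarrow> nat \<Rightarrow> real) \<Rightarrow> (nat \<Rightarrow> nat) \<Rightarrow> nat \<Rightarrow> (nat \<Rightarrow> real)
    \<Rightarrow> (nat \<Rightarrow> real) \<Rightarrow> (nat \<Rightarrow> real)" where
  "maest n X k M w y = (\<lambda>i. \<Sum>m=1..M. w m * proj n (colspan n X (k m)) y i)"

definition mamat :: "nat \<Rightarrow> (nat \<Rightarrow> nat \<Rightarrow> real) \<Rightarrow> (nat \<Rightarrow> nat) \<Rightarrow> nat \<Rightarrow> (nat \<Rightarrow> real)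
    \<Rightarrow> nat \<Rightarrow> nat \<Rightarrow> real" where
  "mamat n X k M w a b = (\<Sum>m=1..M. w m * projmat n X (k m) a b)"

definition fvec :: "nat \<Rightarrow> (nat \<Rightarrow> nat \<Rightarrow> real) \<Rightarrow> (nat \<Rightarrow> real) \<Rightarrow> nat \<Rightarrow> (nat \<Rightarrow> real)" where
  "fvec n X \<beta> p = (\<lambda>i. if i < n then (\<Sum>l<p. X i l * \<beta> l) else 0)"

definition yvec :: "nat \<Rightarrow> (nat \<Rightarrow> real) \<Rightarrow> (nat \<Rightarrow> 'a \<Rightarrow> real) \<Rightarrow> 'a \<Rightarrow> (nat \<Rightarrow> real)" where
  "yvec n f eps \<omega> = (\<lambda>i. if i < n then f i + eps i \<omega> else 0)"

definition riskMA :: "'a measure \<Rightarrow> (nat \<Rightarrow> 'a \<Rightarrow> real) \<Rightarrow> nat \<Rightarrow> (nat \<Rightarrow> nat \<Rightarrow> real)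
    \<Rightarrow> (nat \<Rightarrow> real) \<Rightarrow> (nat \<Rightarrow> nat) \<Rightarrow> nat \<Rightarrow> (nat \<Rightarrow> real) \<Rightarrow> real" where
  "riskMA P eps n X f k M w =
     (1 / real n) * (\<integral>\<omega>. sq n (\<lambda>i. maest n X k M w (yvec n f eps \<omega>) i - f i) \<partial>P)"

text \<open>R_n(w^*|M_A,f): the minimal risk over the wsimplex for M_A (k_j = j, j = 1..p).\<close>
definition Rstar :: "'a measure \<Rightarrow> (nat \<Rightarrow> 'a \<Rightarrow> real) \<Rightarrow> nat \<Rightarrow> (nat \<Rightarrow> nat \<Rightarrow> real)
    \<Rightarrow> (nat \<Rightarrow> real) \<Rightarrow> nat \<Rightarrow> real" where
  "Rstar P eps n X f p = (INF w\<in>wsimplex p. riskMA P eps n X f id p w)"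

text \<open>Mallows criterion C_n(w|M,y) with plug-in variance estimate s.\<close>
definition Cn :: "nat \<Rightarrow> (nat \<Rightarrow> nat \<Rightarrow> real) \<Rightarrow> (nat \<Rightarrow> nat) \<Rightarrow> nat \<Rightarrow> real
    \<Rightarrow> (nat \<Rightarrow> real) \<Rightarrow> (nat \<Rightarrow> real) \<Rightarrow> real" where
  "Cn n X k M s w y = (1 / real n) * sq n (\<lambda>i. y i - maest n X k M w y i)
      + 2 * s / real n * (\<Sum>m=1..M. real (k m) * w m)"

end

(*
  In an orthonormal basis adapted to the nested column spaces, loss, risk and Mallows' criterion of
  a weight vector are sums over blocks of columns, in which only the cumulative weights enter, a
  nonincreasing sequence in [0,1].  Up to a constant, criterion and risk differ by linear forms in
  the block sums of the centred squared noise and of the noise times the signal.  Summation by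
  parts and Cauchy-Schwarz bound each form by sqrt (H r), where r is the risk and H the product of
  the first factor of psi and the square of a normalised maximum of partial sums, plus the variance
  estimation error.  Partial sums have sub-exponential tails, so the expected square of the maximum
  is at most a constant times the second factor (1 + log M)^2 of psi.  Hence
  the risk of the selected weights is at most (1 + O(eta)) times the risk of any fixed weights plus
  O(H / eta), and eta is chosen as the square root of the ratio of E H to the optimal risk.
  Finally, weights for all nested models are grouped into weights for M_G at the cost of a factor
  1 + zeta and of sigma^2 k_1.
*)
theory Submission
  imports Defs
begin

section \<open>Exponential moments of linear and quadratic forms in sub-Gaussian noise\<close>

text \<open>The selected weights depend on the noise, so deviations must be controlled uniformly
  over the simplex. Monotone cumulative weights allow this without a covering argument: against a
  nonincreasing sequence a sum is governed by its partial sums, and there are only M of them. A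
  partial sum over the first k_j coordinates fluctuates like sqrt k_j, and the signal-noise term
  over a tail like the root of the signal energy in that tail. Comparison with the increments of
  these roots produces the relative increments and the factor 4 in psi, while the crude bound 1 per
  block produces M.

  In the adapted basis the noise coordinates are uncorrelated but in general dependent. Quadratic
  forms are therefore treated in the original independent errors, split into a diagonal and an
  off-diagonal part.

  The oracle inequality is proved for each outcome separately; only its right-hand side is
  integrated. Since k_1 is at least 1, the rate condition keeps n times the optimal risk away from
  0, so additive errors become vanishing fractions of it.\<close>

locale iid_subgaussian = prob_space P for P :: "'a measure" +
  fixes eps :: "nat \<Rightarrow> 'a \<Rightarrow> real" and s2 c :: real
  assumes eps_meas [measurable]: "\<And>i. eps i \<in> borel_measurable P"
    and eps_indep: "indep_vars (\<lambda>_. borel) eps UNIV"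
    and eps_ident: "\<And>i. distr P borel (eps i) = distr P borel (eps 0)"
    and eps_exp_integrable: "\<And>t. integrable P (\<lambda>\<omega>. exp (t * eps 0 \<omega>))"
    and eps_exp_le: "\<And>t. (\<integral>\<omega>. exp (t * eps 0 \<omega>) \<partial>P) \<le> exp (c * t\<^sup>2 / 2)"
    and eps_mean: "(\<integral>\<omega>. eps 0 \<omega> \<partial>P) = 0"
    and eps_var: "(\<integral>\<omega>. (eps 0 \<omega>)\<^sup>2 \<partial>P) = s2"
    and s2_pos: "s2 > 0"
    and c_pos: "c > 0"
begin

definition law :: "real measure" where "law = distr P borel (eps 0)"

lemma sets_law [measurable_cong]: "sets law = sets borel"
  by (simp add: law_def)

lemma space_law [simp]: "space law = UNIV"
  by (simp add: law_def)

lemma prob_space_law: "prob_space law"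
  unfolding law_def by (rule prob_space_distr) measurable

lemma nn_integral_eps:
  assumes [measurable]: "F \<in> borel_measurable borel"
  shows "(\<integral>\<^sup>+\<omega>. F (eps i \<omega>) \<partial>P) = (\<integral>\<^sup>+t. F t \<partial>law)"
  unfolding law_def eps_ident[of i, symmetric] by (subst nn_integral_distr) auto

lemma nn_integral_eps_joint:
  assumes [measurable]: "G \<in> borel_measurable (PiM {..<n} (\<lambda>_. law))"
  shows "(\<integral>\<^sup>+\<omega>. G (\<lambda>i\<in>{..<n}. eps i \<omega>) \<partial>P) = (\<integral>\<^sup>+x. G x \<partial>PiM {..<n} (\<lambda>_. law))"
\<comment> \<open>The product form of independence is applied to a nonempty index set, so the empty
  one is treated apart.\<close>
proof (cases "n = 0")
  case True
  then show ?thesis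
    by (simp add: PiM_empty nn_integral_count_space_finite emeasure_space_1 restrict_def)
next
  case False
  have "indep_vars (\<lambda>_. borel) eps {..<n}"
    by (rule indep_vars_subset[OF eps_indep]) simp
  then have "distr P (PiM {..<n} (\<lambda>_. borel)) (\<lambda>\<omega>. \<lambda>i\<in>{..<n}. eps i \<omega>)
      = PiM {..<n} (\<lambda>i. distr P borel (eps i))"
    using indep_vars_iff_distr_eq_PiM[of "{..<n}" eps "\<lambda>_. borel"] False by auto
  also have "\<dots> = PiM {..<n} (\<lambda>_. law)"
    unfolding law_def by (intro PiM_cong eps_ident) auto
  finally have eq: "distr P (PiM {..<n} (\<lambda>_. borel)) (\<lambda>\<omega>. \<lambda>i\<in>{..<n}. eps i \<omega>) = PiM {..<n} (\<lambda>_. law)" .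
  have "G \<in> borel_measurable (PiM {..<n} (\<lambda>_. borel))"
    using assms measurable_cong_sets[OF sets_PiM_cong[OF refl], of "{..<n}" "\<lambda>_. law" "\<lambda>_. borel" borel borel]
    by (auto simp: sets_law)
  then show ?thesis
    unfolding eq[symmetric] by (subst nn_integral_distr) auto
qed

text \<open>A supermartingale bound: given the earlier coordinates each factor has expectation at
  most 1, so integrating out the last coordinate repeatedly leaves at most 1. The past enters
  through a linear form with coefficients \<open>A i j\<close>; zero coefficients give sums of
  independent terms, general ones the off-diagonal part of a quadratic form.\<close>

lemma nn_integral_exp_adapted_le_1:
  fixes A :: "nat \<Rightarrow> nat \<Rightarrow> real" and F :: "nat \<Rightarrow> real \<Rightarrow> real \<Rightarrow> real"
  assumes F [measurable]: "\<And>i. (\<lambda>(a, t). F i a t) \<in> borel_measurable (borel \<Otimes>\<^sub>M borel)"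
    and le1: "\<And>i a. (\<integral>\<^sup>+t. ennreal (exp (F i a t)) \<partial>law) \<le> 1"
  shows "(\<integral>\<^sup>+\<omega>. ennreal (exp (\<Sum>i<n. F i (\<Sum>j<i. A i j * eps j \<omega>) (eps i \<omega>))) \<partial>P) \<le> 1"
proof -
  interpret law: prob_space law by (rule prob_space_law)
  interpret product_sigma_finite "\<lambda>_::nat. law" ..
  define E where "E n x = exp (\<Sum>i<n. F i (\<Sum>j<i. A i j * x j) (x i))" for n and x :: "nat \<Rightarrow> real"
  have Em [measurable]: "E n \<in> borel_measurable (PiM {..<n} (\<lambda>_. law))" for n
    unfolding E_def
  proof (intro measurable_compose[OF _ borel_measurable_exp] borel_measurable_sum)
    fix i assume i: "i \<in> {..<n}"
    have [measurable]: "(\<lambda>x. x j) \<in> borel_measurable (PiM {..<n} (\<lambda>_. law))" if "j \<le> i" for j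
    proof -
      have "(\<lambda>x. x j) \<in> measurable (PiM {..<n} (\<lambda>_. law)) law"
        using that i by (intro measurable_component_singleton) auto
      then show ?thesis using measurable_cong_sets[OF refl sets_law] by blast
    qed
    have "(\<lambda>x. ((\<Sum>j<i. A i j * x j), x i)) \<in> measurable (PiM {..<n} (\<lambda>_. law)) (borel \<Otimes>\<^sub>M borel)"
      by (intro measurable_Pair borel_measurable_sum borel_measurable_times) auto
    from measurable_compose[OF this F[of i]]
    show "(\<lambda>x. F i (\<Sum>j<i. A i j * x j) (x i)) \<in> borel_measurable (PiM {..<n} (\<lambda>_. law))" by simp
  qed
  have [measurable]: "F i a \<in> borel_measurable borel" for i a
    using measurable_compose[OF measurable_Pair1' F[of i], of a] by simp
  have prod_le: "(\<integral>\<^sup>+x. ennreal (E n x) \<partial>PiM {..<n} (\<lambda>_. law)) \<le> 1" for n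
  proof (induction n)
    case 0
    then show ?case by (simp add: E_def PiM_empty nn_integral_count_space_finite)
  next
    case (Suc n)
    have "(\<integral>\<^sup>+x. ennreal (E (Suc n) x) \<partial>PiM {..<Suc n} (\<lambda>_. law))
        = (\<integral>\<^sup>+x. (\<integral>\<^sup>+t. ennreal (E (Suc n) (x(n := t))) \<partial>law) \<partial>PiM {..<n} (\<lambda>_. law))"
      unfolding lessThan_Suc by (intro product_nn_integral_insert) (use Em[of "Suc n"] in \<open>auto simp: lessThan_Suc\<close>)
    also have "\<dots> = (\<integral>\<^sup>+x. ennreal (E n x) * (\<integral>\<^sup>+t. ennreal (exp (F n (\<Sum>j<n. A n j * x j) t)) \<partial>law) \<partial>PiM {..<n} (\<lambda>_. law))"
    proof (intro nn_integral_cong)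
      fix x
      have "E (Suc n) (x(n := t)) = E n x * exp (F n (\<Sum>j<n. A n j * x j) t)" for t
        by (simp add: E_def exp_add)
      then have "(\<integral>\<^sup>+t. ennreal (E (Suc n) (x(n := t))) \<partial>law)
          = (\<integral>\<^sup>+t. ennreal (E n x) * ennreal (exp (F n (\<Sum>j<n. A n j * x j) t)) \<partial>law)"
        by (simp add: ennreal_mult E_def)
      also have "\<dots> = ennreal (E n x) * (\<integral>\<^sup>+t. ennreal (exp (F n (\<Sum>j<n. A n j * x j) t)) \<partial>law)"
        by (intro nn_integral_cmult) measurable
      finally show "(\<integral>\<^sup>+t. ennreal (E (Suc n) (x(n := t))) \<partial>law) = \<dots>" .
    qed
    also have "\<dots> \<le> (\<integral>\<^sup>+x. ennreal (E n x) * 1 \<partial>PiM {..<n} (\<lambda>_. law))"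
      by (intro nn_integral_mono mult_left_mono le1) simp
    also have "\<dots> \<le> 1" using Suc by simp
    finally show ?case .
  qed
  have "(\<integral>\<^sup>+\<omega>. ennreal (E n (\<lambda>i\<in>{..<n}. eps i \<omega>)) \<partial>P) \<le> 1"
    using nn_integral_eps_joint[of "\<lambda>x. ennreal (E n x)" n] prod_le[of n] by simp
  moreover have "E n (\<lambda>i\<in>{..<n}. eps i \<omega>) = exp (\<Sum>i<n. F i (\<Sum>j<i. A i j * eps j \<omega>) (eps i \<omega>))" for \<omega>
    unfolding E_def by (intro arg_cong[where f=exp] sum.cong refl arg_cong2[where f="F _"]) auto
  ultimately show ?thesis by simp
qed

lemma nn_integral_law_exp_le: "(\<integral>\<^sup>+t. ennreal (exp (a * t)) \<partial>law) \<le> ennreal (exp (c * a\<^sup>2 / 2))"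
proof -
  have "(\<integral>\<^sup>+t. ennreal (exp (a * t)) \<partial>law) = (\<integral>\<^sup>+\<omega>. ennreal (exp (a * eps 0 \<omega>)) \<partial>P)"
    by (rule nn_integral_eps[symmetric]) measurable
  also have "\<dots> = ennreal (\<integral>\<omega>. exp (a * eps 0 \<omega>) \<partial>P)"
    by (rule nn_integral_eq_integral[OF eps_exp_integrable]) auto
  finally show ?thesis using eps_exp_le[of a] by (simp add: ennreal_leI)
qed

end

section \<open>Exponential inequalities and the Gaussian linearisation of squares\<close>

lemma exp_le_quadratic: "exp (y::real) \<le> 1 + y + y\<^sup>2 / 2 * exp \<bar>y\<bar>"
proof -
  obtain t where t: "\<bar>t\<bar> \<le> \<bar>y\<bar>" "exp y = (\<Sum>m<2. y ^ m / fact m) + exp t / fact 2 * y ^ 2"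
    using Maclaurin_exp_le[of y 2] by blast
  have "exp t / 2 * y\<^sup>2 \<le> exp \<bar>y\<bar> / 2 * y\<^sup>2"
    using t(1) by (intro mult_right_mono divide_right_mono) auto
  moreover have "exp y = 1 + y + exp t / 2 * y\<^sup>2"
    using t(2) by (simp add: numeral_2_eq_2)
  ultimately show ?thesis by (simp add: mult.commute)
qed

lemma square_le_exp: "0 \<le> y \<Longrightarrow> y\<^sup>2 / 2 \<le> exp (y::real)"
  using exp_lower_Taylor_quadratic[of y] by simp

lemma exp_midpoint_le: "exp ((a + b) / 2) \<le> (exp a + exp (b::real)) / 2"
proof -
  have "exp a = (exp (a / 2))\<^sup>2" "exp b = (exp (b / 2))\<^sup>2" "exp ((a + b) / 2) = exp (a / 2) * exp (b / 2)"
    by (simp_all add: power2_eq_square exp_add[symmetric] add_divide_distrib)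
  then show ?thesis using sum_squares_bound[of "exp (a / 2)" "exp (b / 2)"] by simp
qed

lemma exp_abs_le: "exp \<bar>x\<bar> \<le> exp x + exp (- x :: real)"
  by (cases "x \<ge> 0") auto

lemma nn_integral_exp_diff_le_1D:
  assumes [measurable]: "S \<in> borel_measurable M"
    and "(\<integral>\<^sup>+\<omega>. ennreal (exp (S \<omega> - K)) \<partial>M) \<le> 1"
  shows "(\<integral>\<^sup>+\<omega>. ennreal (exp (S \<omega>)) \<partial>M) \<le> ennreal (exp K)"
proof -
  have "(\<integral>\<^sup>+\<omega>. ennreal (exp (S \<omega>)) \<partial>M) = (\<integral>\<^sup>+\<omega>. ennreal (exp K) * ennreal (exp (S \<omega> - K)) \<partial>M)"
    by (simp add: ennreal_mult[symmetric] exp_add[symmetric])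
  also have "\<dots> = ennreal (exp K) * (\<integral>\<^sup>+\<omega>. ennreal (exp (S \<omega> - K)) \<partial>M)"
    by (intro nn_integral_cmult) measurable
  also have "\<dots> \<le> ennreal (exp K) * 1"
    by (intro mult_left_mono assms) simp
  finally show ?thesis by simp
qed

text \<open>Completing the square: tilting a centred Gaussian by \<open>exp (t * x)\<close> shifts
  its mean and leaves its moment generating function at \<open>x\<close> as a factor.\<close>

lemma exp_mult_normal_density:
  assumes "\<sigma> > 0"
  shows "exp (t * x) * normal_density 0 \<sigma> t = exp (\<sigma>\<^sup>2 * x\<^sup>2 / 2) * normal_density (\<sigma>\<^sup>2 * x) \<sigma> t"
proof -
  have "t * x + - (t - 0)\<^sup>2 / (2 * \<sigma>\<^sup>2) = \<sigma>\<^sup>2 * x\<^sup>2 / 2 + - (t - \<sigma>\<^sup>2 * x)\<^sup>2 / (2 * \<sigma>\<^sup>2)"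
    using assms by (simp add: field_simps power2_eq_square)
  then show ?thesis
    unfolding normal_density_def by (simp add: exp_add[symmetric] mult.left_commute)
qed

lemma nn_integral_normal_density: "\<sigma> > 0 \<Longrightarrow> (\<integral>\<^sup>+t. ennreal (normal_density \<mu> \<sigma> t) \<partial>lborel) = 1"
  using prob_space.emeasure_space_1[OF prob_space_normal_density, of \<sigma> \<mu>]
  by (simp add: emeasure_density)

text \<open>The square is linearised by an independent Gaussian: \<open>exp (x\<^sup>2 / (4 b))\<close> is the moment
  generating function at \<open>x\<close> of a centred Gaussian of variance \<open>1 / (2 b)\<close>.\<close>

lemma nn_integral_exp_square_le:
  fixes X :: "'a \<Rightarrow> real"
  assumes "sigma_finite_measure M" and X [measurable]: "X \<in> borel_measurable M" and b: "b > 0"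
    and mgf: "\<And>t. (\<integral>\<^sup>+\<omega>. ennreal (exp (t * X \<omega>)) \<partial>M) \<le> ennreal (exp (b * t\<^sup>2 / 2))"
  shows "(\<integral>\<^sup>+\<omega>. ennreal (exp ((X \<omega>)\<^sup>2 / (4 * b))) \<partial>M) \<le> ennreal (sqrt 2)"
proof -
  interpret pair_sigma_finite M lborel
    using assms(1) by (intro pair_sigma_finite.intro) (auto intro: lborel.sigma_finite_measure_axioms)
  define s where "s = 1 / sqrt (2 * b)"
  have s: "s > 0" "s\<^sup>2 = 1 / (2 * b)" using b by (auto simp: s_def power_divide)
  \<comment> \<open>The bound on the moment generating function cancels half of the exponent
    \<open>- b * t\<^sup>2\<close> of the density with deviation \<open>s\<close>. What remains is a
    Gaussian of variance 1 / b, and the ratio of the normalising constants is sqrt 2.\<close>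
  define s' where "s' = 1 / sqrt b"
  have s': "s' > 0" "s'\<^sup>2 = 1 / b" using b by (auto simp: s'_def power_divide)
  have "ennreal (exp (x\<^sup>2 / (4 * b))) = (\<integral>\<^sup>+t. ennreal (exp (t * x) * normal_density 0 s t) \<partial>lborel)" for x
  proof -
    have "(\<integral>\<^sup>+t. ennreal (exp (t * x) * normal_density 0 s t) \<partial>lborel)
      = (\<integral>\<^sup>+t. ennreal (exp (x\<^sup>2 / (4 * b))) * ennreal (normal_density (s\<^sup>2 * x) s t) \<partial>lborel)"
      unfolding exp_mult_normal_density[OF s(1)] s(2)
      by (simp add: ennreal_mult[symmetric])
    also have "\<dots> = ennreal (exp (x\<^sup>2 / (4 * b)))"
      by (subst nn_integral_cmult) (auto simp: nn_integral_normal_density[OF s(1)])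
    finally show ?thesis by simp
  qed
  then have "(\<integral>\<^sup>+\<omega>. ennreal (exp ((X \<omega>)\<^sup>2 / (4 * b))) \<partial>M)
      = (\<integral>\<^sup>+\<omega>. (\<integral>\<^sup>+t. ennreal (exp (t * X \<omega>) * normal_density 0 s t) \<partial>lborel) \<partial>M)" by simp
  also have "\<dots> = (\<integral>\<^sup>+t. (\<integral>\<^sup>+\<omega>. ennreal (exp (t * X \<omega>) * normal_density 0 s t) \<partial>M) \<partial>lborel)"
    by (intro Fubini'[symmetric]) measurable
  also have "\<dots> = (\<integral>\<^sup>+t. ennreal (normal_density 0 s t) * (\<integral>\<^sup>+\<omega>. ennreal (exp (t * X \<omega>)) \<partial>M) \<partial>lborel)"
    by (subst nn_integral_cmult[symmetric]) (auto simp: ennreal_mult[symmetric] mult.commute)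
  also have "\<dots> \<le> (\<integral>\<^sup>+t. ennreal (normal_density 0 s t) * ennreal (exp (b * t\<^sup>2 / 2)) \<partial>lborel)"
    by (intro nn_integral_mono mult_left_mono mgf) simp
  also have "\<dots> = (\<integral>\<^sup>+t. ennreal (sqrt 2) * ennreal (normal_density 0 s' t) \<partial>lborel)"
  proof (intro nn_integral_cong)
    fix t :: real
    have "normal_density 0 s t * exp (b * t\<^sup>2 / 2) = sqrt (b / pi) * (exp (- (b * t\<^sup>2)) * exp (b * t\<^sup>2 / 2))"
      using b by (simp add: normal_density_def s(2) real_sqrt_divide)
    also have "\<dots> = sqrt (b / pi) * exp (- (b * t\<^sup>2 / 2))"
      by (simp add: exp_add[symmetric])
    also have "\<dots> = sqrt 2 * normal_density 0 s' t"
      using b by (simp add: normal_density_def s'(2) real_sqrt_divide real_sqrt_mult)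
    finally show "ennreal (normal_density 0 s t) * ennreal (exp (b * t\<^sup>2 / 2)) = ennreal (sqrt 2) * ennreal (normal_density 0 s' t)"
      by (simp add: ennreal_mult[symmetric])
  qed
  also have "\<dots> = ennreal (sqrt 2)"
    by (subst nn_integral_cmult) (auto simp: nn_integral_normal_density[OF s'(1)])
  finally show ?thesis .
qed

section \<open>Exponential moments of linear forms and of centred squares\<close>

context iid_subgaussian
begin

lemma nn_integral_exp_linear_le:
  "(\<integral>\<^sup>+\<omega>. ennreal (exp (\<Sum>i<n. v i * eps i \<omega>)) \<partial>P) \<le> ennreal (exp (c * (\<Sum>i<n. (v i)\<^sup>2) / 2))"
proof (rule nn_integral_exp_diff_le_1D)
  \<comment> \<open>Zero coefficients: the increments ignore the past, which is the independent case
    of the supermartingale bound.\<close>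
  have "(\<integral>\<^sup>+\<omega>. ennreal (exp (\<Sum>i<n. (\<lambda>i a t. v i * t - c * (v i)\<^sup>2 / 2) i (\<Sum>j<i. 0 * eps j \<omega>) (eps i \<omega>))) \<partial>P) \<le> 1"
  proof (rule nn_integral_exp_adapted_le_1)
    fix i and a :: real
    have "(\<integral>\<^sup>+t. ennreal (exp (v i * t - c * (v i)\<^sup>2 / 2)) \<partial>law)
        = (\<integral>\<^sup>+t. ennreal (exp (- (c * (v i)\<^sup>2 / 2))) * ennreal (exp (v i * t)) \<partial>law)"
      by (simp add: ennreal_mult[symmetric] exp_add[symmetric])
    also have "\<dots> = ennreal (exp (- (c * (v i)\<^sup>2 / 2))) * (\<integral>\<^sup>+t. ennreal (exp (v i * t)) \<partial>law)"
      by (intro nn_integral_cmult) measurable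
    also have "\<dots> \<le> ennreal (exp (- (c * (v i)\<^sup>2 / 2))) * ennreal (exp (c * (v i)\<^sup>2 / 2))"
      by (intro mult_left_mono nn_integral_law_exp_le) simp
    also have "\<dots> = 1" by (simp add: ennreal_mult[symmetric] exp_add[symmetric])
    finally show "(\<integral>\<^sup>+t. ennreal (exp (v i * t - c * (v i)\<^sup>2 / 2)) \<partial>law) \<le> 1" .
  qed measurable
  then show "(\<integral>\<^sup>+\<omega>. ennreal (exp ((\<Sum>i<n. v i * eps i \<omega>) - c * (\<Sum>i<n. (v i)\<^sup>2) / 2)) \<partial>P) \<le> 1"
    by (simp add: sum_subtractf sum_distrib_left sum_divide_distrib)
qed measurable

lemma nn_integral_exp_linear_square_le:
  assumes "(\<Sum>i<n. (v i)\<^sup>2) \<le> T" "T > 0"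
  shows "(\<integral>\<^sup>+\<omega>. ennreal (exp ((\<Sum>i<n. v i * eps i \<omega>)\<^sup>2 / (4 * (c * T)))) \<partial>P) \<le> ennreal (sqrt 2)"
proof (rule nn_integral_exp_square_le)
  show "sigma_finite_measure P" ..
  fix t
  have "(\<integral>\<^sup>+\<omega>. ennreal (exp (t * (\<Sum>i<n. v i * eps i \<omega>))) \<partial>P)
      = (\<integral>\<^sup>+\<omega>. ennreal (exp (\<Sum>i<n. (t * v i) * eps i \<omega>)) \<partial>P)"
    by (simp add: sum_distrib_left mult.assoc)
  also have "\<dots> \<le> ennreal (exp (c * (\<Sum>i<n. (t * v i)\<^sup>2) / 2))"
    by (rule nn_integral_exp_linear_le)
  also have "(\<Sum>i<n. (t * v i)\<^sup>2) = t\<^sup>2 * (\<Sum>i<n. (v i)\<^sup>2)"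
    by (simp add: power_mult_distrib sum_distrib_left)
  also have "ennreal (exp (c * (t\<^sup>2 * (\<Sum>i<n. (v i)\<^sup>2)) / 2)) \<le> ennreal (exp (c * T * t\<^sup>2 / 2))"
  proof -
    have "c * (t\<^sup>2 * (\<Sum>i<n. (v i)\<^sup>2)) \<le> c * (t\<^sup>2 * T)"
      using assms c_pos by (intro mult_left_mono) auto
    then show ?thesis by (intro ennreal_leI) (simp add: mult_ac)
  qed
  finally show "(\<integral>\<^sup>+\<omega>. ennreal (exp (t * (\<Sum>i<n. v i * eps i \<omega>))) \<partial>P) \<le> ennreal (exp (c * T * t\<^sup>2 / 2))" .
qed (use assms c_pos in auto)

text \<open>Bounds the integral of \<open>exp ((t\<^sup>2 + s2) / (4 * c))\<close> under the error
  law, which dominates the same exponential of the centred square in absolute value.\<close>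

definition diag_const :: real where "diag_const = sqrt 2 * exp (s2 / (4 * c))"

lemma nn_integral_law_exp_square_le: "(\<integral>\<^sup>+t. ennreal (exp (t\<^sup>2 / (4 * c))) \<partial>law) \<le> ennreal (sqrt 2)"
  using prob_space_law
  by (intro nn_integral_exp_square_le nn_integral_law_exp_le c_pos)
     (auto intro: prob_space_imp_sigma_finite)

lemma integrable_law_exp_square: "integrable law (\<lambda>t. exp (t\<^sup>2 / (4 * c)))"
proof (rule integrableI_nonneg)
  show "(\<integral>\<^sup>+t. ennreal (exp (t\<^sup>2 / (4 * c))) \<partial>law) < \<infinity>"
    by (rule le_less_trans[OF nn_integral_law_exp_square_le]) simp
qed auto

lemma integral_law_exp_square_le: "(\<integral>t. exp (t\<^sup>2 / (4 * c)) \<partial>law) \<le> sqrt 2"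
  using nn_integral_law_exp_square_le nn_integral_eq_integral[OF integrable_law_exp_square]
  by (simp add: ennreal_le_iff)

lemma integrable_law_square: "integrable law (\<lambda>t. t\<^sup>2)"
proof (rule Bochner_Integration.integrable_bound)
  show "integrable law (\<lambda>t. 4 * c * exp (t\<^sup>2 / (4 * c)))"
    using integrable_law_exp_square by simp
  have "t\<^sup>2 \<le> 4 * c * exp (t\<^sup>2 / (4 * c))" for t
    using exp_ge_add_one_self[of "t\<^sup>2 / (4 * c)"] c_pos by (simp add: field_simps)
  then show "AE t in law. norm (t\<^sup>2) \<le> norm (4 * c * exp (t\<^sup>2 / (4 * c)))"
    using c_pos by (auto simp: abs_mult)
qed auto

lemma integral_law_square: "(\<integral>t. t\<^sup>2 \<partial>law) = s2"
  unfolding law_def using eps_var by (subst integral_distr) auto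

text \<open>The Taylor bound \<open>exp_le_quadratic\<close> keeps the linear term exact, and
  centring makes it vanish in the integral. Of the available exponential moment, at rate 1 / (4 c),
  one half pays for the exponential in the Taylor remainder and one half for the squared variable in
  front of it. Hence the range 1 / (8 c) for \<open>x\<close> and the factor 64 = 8 * 8.\<close>

lemma nn_integral_law_exp_centered_square_le:
  assumes x: "\<bar>x\<bar> \<le> 1 / (8 * c)"
  shows "(\<integral>\<^sup>+t. ennreal (exp (x * (t\<^sup>2 - s2))) \<partial>law) \<le> ennreal (exp (64 * c\<^sup>2 * diag_const * x\<^sup>2))"
proof -
  interpret law: prob_space law by (rule prob_space_law)
  define B where "B t = 64 * c\<^sup>2 * (exp (s2 / (4 * c)) * exp (t\<^sup>2 / (4 * c)))" for t
  define G where "G t = 1 + x * (t\<^sup>2 - s2) + x\<^sup>2 * B t" for t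
  have le: "exp (x * (t\<^sup>2 - s2)) \<le> G t" for t
  proof -
    let ?Y = "t\<^sup>2 - s2"
    have 1: "\<bar>x * ?Y\<bar> \<le> \<bar>?Y\<bar> / (8 * c)"
      using mult_right_mono[OF x, of "\<bar>?Y\<bar>"] by (simp add: abs_mult)
    have 2: "?Y\<^sup>2 / 2 \<le> 64 * c\<^sup>2 * exp (\<bar>?Y\<bar> / (8 * c))"
      using square_le_exp[of "\<bar>?Y\<bar> / (8 * c)"] c_pos by (simp add: power_divide field_simps)
    have 3: "\<bar>?Y\<bar> \<le> t\<^sup>2 + s2" using s2_pos by (auto simp: abs_if)
    have "(x * ?Y)\<^sup>2 / 2 * exp \<bar>x * ?Y\<bar> = x\<^sup>2 * (?Y\<^sup>2 / 2 * exp \<bar>x * ?Y\<bar>)"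
      by (simp add: power_mult_distrib)
    also have "\<dots> \<le> x\<^sup>2 * (64 * c\<^sup>2 * exp (\<bar>?Y\<bar> / (8 * c)) * exp (\<bar>?Y\<bar> / (8 * c)))"
      using 1 2 by (intro mult_left_mono mult_mono) auto
    also have "64 * c\<^sup>2 * exp (\<bar>?Y\<bar> / (8 * c)) * exp (\<bar>?Y\<bar> / (8 * c)) = 64 * c\<^sup>2 * exp (\<bar>?Y\<bar> / (4 * c))"
      using c_pos by (simp add: mult.assoc exp_add[symmetric])
    also have "\<dots> \<le> 64 * c\<^sup>2 * exp ((t\<^sup>2 + s2) / (4 * c))"
      using 3 c_pos by (intro mult_left_mono) (auto intro: divide_right_mono)
    also have "\<dots> = B t" by (simp add: B_def exp_add[symmetric] add_divide_distrib add.commute)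
    finally have "(x * ?Y)\<^sup>2 / 2 * exp \<bar>x * ?Y\<bar> \<le> x\<^sup>2 * B t" by (simp add: mult_left_mono)
    then show ?thesis using exp_le_quadratic[of "x * ?Y"] by (simp add: G_def)
  qed
  have intB: "integrable law B"
    unfolding B_def using integrable_law_exp_square by simp
  have intG: "integrable law G"
    unfolding G_def using intB integrable_law_square by (auto intro!: Bochner_Integration.integrable_add)
  have "(\<integral>t. B t \<partial>law) = 64 * c\<^sup>2 * exp (s2 / (4 * c)) * (\<integral>t. exp (t\<^sup>2 / (4 * c)) \<partial>law)"
    by (simp add: B_def)
  also have "\<dots> \<le> 64 * c\<^sup>2 * exp (s2 / (4 * c)) * sqrt 2"
    by (intro mult_left_mono integral_law_exp_square_le) auto
  finally have B: "(\<integral>t. B t \<partial>law) \<le> 64 * c\<^sup>2 * diag_const" by (simp add: diag_const_def mult_ac)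
  have "(\<integral>\<^sup>+t. ennreal (exp (x * (t\<^sup>2 - s2))) \<partial>law) \<le> (\<integral>\<^sup>+t. ennreal (G t) \<partial>law)"
    by (intro nn_integral_mono ennreal_leI le)
  also have "\<dots> = ennreal (\<integral>t. G t \<partial>law)"
    using le by (intro nn_integral_eq_integral intG) (auto intro!: order_trans[OF _ le])
  also have "(\<integral>t. G t \<partial>law) = 1 + x\<^sup>2 * (\<integral>t. B t \<partial>law)"
    unfolding G_def using intB integrable_law_square integral_law_square law.prob_space
    by (subst Bochner_Integration.integral_add) (auto intro!: Bochner_Integration.integrable_add)
  also have "\<dots> \<le> 1 + x\<^sup>2 * (64 * c\<^sup>2 * diag_const)"
    using B by (intro add_left_mono mult_left_mono) auto
  also have "\<dots> \<le> exp (64 * c\<^sup>2 * diag_const * x\<^sup>2)"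
    using exp_ge_add_one_self[of "64 * c\<^sup>2 * diag_const * x\<^sup>2"] by (simp add: mult_ac)
  finally show ?thesis by (simp add: ennreal_leI)
qed

end

text \<open>Made for the maximum of m variables with bounded exponential moments: with
  \<open>b\<close> of order m only the excess over \<open>ln b\<close> is charged to the
  exponential, and the division by \<open>b\<close> lets that term survive a sum over all m
  variables.\<close>

lemma square_le_ln_square_plus_exp:
  assumes "b \<ge> 1" "x \<ge> (0::real)"
  shows "x\<^sup>2 \<le> 2 * (ln b)\<^sup>2 + 4 * exp x / b"
proof (cases "x \<le> ln b")
  case True
  then have "x\<^sup>2 \<le> (ln b)\<^sup>2" using assms by (intro power_mono) auto
  moreover have "(ln b)\<^sup>2 \<le> 2 * (ln b)\<^sup>2" by simp
  moreover have "0 \<le> 4 * exp x / b" using assms by simp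
  ultimately show ?thesis by linarith
next
  case False
  have "x\<^sup>2 \<le> 2 * (ln b)\<^sup>2 + 2 * (x - ln b)\<^sup>2"
    using zero_le_power2[of "2 * ln b - x"] by (simp add: power2_eq_square algebra_simps)
  also have "2 * (x - ln b)\<^sup>2 \<le> 4 * exp (x - ln b)"
    using square_le_exp[of "x - ln b"] False by simp
  also have "exp (x - ln b) = exp x / b" using assms by (simp add: exp_diff)
  finally show ?thesis by simp
qed

context iid_subgaussian
begin

text \<open>AM-GM splits the exponential into that of a compensated martingale, of expectation at most 1,
  and that of the compensator, a weighted sum of squared linear forms; convexity of the exponential
  reduces the latter to a single squared linear form.\<close>

lemma nn_integral_exp_offdiag_le:
  assumes rows: "\<And>i. i < n \<Longrightarrow> (\<Sum>j<i. (A i j)\<^sup>2) \<le> r i" and r: "(\<Sum>i<n. r i) = \<kappa>" "\<kappa> > 0"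
    and lam: "8 * c\<^sup>2 * \<mu>\<^sup>2 * \<kappa> \<le> 1"
  shows "(\<integral>\<^sup>+\<omega>. ennreal (exp (\<mu> * (\<Sum>i<n. eps i \<omega> * (\<Sum>j<i. A i j * eps j \<omega>)))) \<partial>P) \<le> 2"
proof -
  define a where "a i \<omega> = (\<Sum>j<i. A i j * eps j \<omega>)" for i \<omega>
  have [measurable]: "a i \<in> borel_measurable P" for i unfolding a_def by measurable
  have r0: "r i \<ge> 0" if "i < n" for i
    using order_trans[OF sum_nonneg rows[OF that]] by simp
  have a0: "a i \<omega> = 0" if "i < n" "r i = 0" for i \<omega>
  proof -
    have "(\<Sum>j<i. (A i j)\<^sup>2) = 0"
      using rows[OF that(1)] that(2) sum_nonneg[of "{..<i}" "\<lambda>j. (A i j)\<^sup>2"] by simp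
    then have "\<forall>j<i. A i j = 0" by (subst (asm) sum_nonneg_eq_0_iff) auto
    then show ?thesis by (simp add: a_def)
  qed
  \<comment> \<open>The exponent is doubled because the AM-GM split halves it; a coefficient
    \<open>2 * \<mu> * a\<close> of a new error costs
    \<open>c * (2 * \<mu> * a)\<^sup>2 / 2\<close>, which is the compensator subtracted
    here.\<close>
  define T where "T \<omega> = (\<Sum>i<n. 2 * \<mu> * a i \<omega> * eps i \<omega> - 2 * c * \<mu>\<^sup>2 * (a i \<omega>)\<^sup>2)" for \<omega>
  \<comment> \<open>Each squared form is scaled by its own row bound, so that its exponential moment
    is at most sqrt 2; the row bounds divided by \<kappa> then serve as convex weights. If
    \<open>r i = 0\<close>, the row vanishes and \<open>q i\<close> is 0 by division by
    zero.\<close>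
  define q where "q i \<omega> = (a i \<omega>)\<^sup>2 / (4 * (c * r i))" for i \<omega>
  have [measurable]: "q i \<in> borel_measurable P" "T \<in> borel_measurable P" for i
    unfolding q_def T_def by measurable
  have T1: "(\<integral>\<^sup>+\<omega>. ennreal (exp (T \<omega>)) \<partial>P) \<le> 1"
    unfolding T_def a_def
  proof (rule nn_integral_exp_adapted_le_1[where F="\<lambda>i a t. 2 * \<mu> * a * t - 2 * c * \<mu>\<^sup>2 * a\<^sup>2"])
    fix i and b :: real
    have "(\<integral>\<^sup>+t. ennreal (exp (2 * \<mu> * b * t - 2 * c * \<mu>\<^sup>2 * b\<^sup>2)) \<partial>law)
        = (\<integral>\<^sup>+t. ennreal (exp (- (2 * c * \<mu>\<^sup>2 * b\<^sup>2))) * ennreal (exp ((2 * \<mu> * b) * t)) \<partial>law)"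
      by (simp add: ennreal_mult[symmetric] exp_add[symmetric])
    also have "\<dots> = ennreal (exp (- (2 * c * \<mu>\<^sup>2 * b\<^sup>2))) * (\<integral>\<^sup>+t. ennreal (exp ((2 * \<mu> * b) * t)) \<partial>law)"
      by (intro nn_integral_cmult) measurable
    also have "\<dots> \<le> ennreal (exp (- (2 * c * \<mu>\<^sup>2 * b\<^sup>2))) * ennreal (exp (c * (2 * \<mu> * b)\<^sup>2 / 2))"
      by (intro mult_left_mono nn_integral_law_exp_le) simp
    also have "\<dots> = 1" by (simp add: ennreal_mult[symmetric] exp_add[symmetric] power_mult_distrib)
    finally show "(\<integral>\<^sup>+t. ennreal (exp (2 * \<mu> * b * t - 2 * c * \<mu>\<^sup>2 * b\<^sup>2)) \<partial>law) \<le> 1" .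
  qed measurable
  have q: "(\<integral>\<^sup>+\<omega>. ennreal (exp (q i \<omega>)) \<partial>P) \<le> ennreal (sqrt 2)" if "i < n" for i
  proof (cases "r i = 0")
    case True
    then show ?thesis by (simp add: q_def emeasure_space_1 ennreal_leI)
  next
    case False
    then show ?thesis
      unfolding q_def a_def
    proof -
      assume ne: "r i \<noteq> 0"
      define v where "v j = A i j" for j
      show "(\<integral>\<^sup>+\<omega>. ennreal (exp ((\<Sum>j<i. A i j * eps j \<omega>)\<^sup>2 / (4 * (c * r i)))) \<partial>P) \<le> ennreal (sqrt 2)"
        using rows[OF that] r0[OF that] ne by (intro nn_integral_exp_linear_square_le) auto
    qed
  qed
  have n0: "{..<n} \<noteq> {}" using r by auto
  have bound: "exp (\<mu> * (\<Sum>i<n. eps i \<omega> * a i \<omega>)) \<le> exp (T \<omega>) / 2 + (\<Sum>i<n. r i / (2 * \<kappa>) * exp (q i \<omega>))" for \<omega>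
  proof -
    let ?Q = "\<Sum>i<n. 2 * c * \<mu>\<^sup>2 * (a i \<omega>)\<^sup>2"
    have "\<mu> * (\<Sum>i<n. eps i \<omega> * a i \<omega>) = (T \<omega> + ?Q) / 2"
      unfolding T_def sum.distrib[symmetric] by (simp add: sum_distrib_left sum_divide_distrib mult_ac)
    then have 1: "exp (\<mu> * (\<Sum>i<n. eps i \<omega> * a i \<omega>)) \<le> (exp (T \<omega>) + exp ?Q) / 2"
      by (simp only: exp_midpoint_le)
    have 2: "?Q \<le> (\<Sum>i<n. (r i / \<kappa>) * q i \<omega>)"
    proof (rule sum_mono)
      fix i assume "i \<in> {..<n}"
      then have i: "i < n" by simp
      show "2 * c * \<mu>\<^sup>2 * (a i \<omega>)\<^sup>2 \<le> (r i / \<kappa>) * q i \<omega>"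
      proof (cases "r i = 0")
        case False
        \<comment> \<open>The hypothesis on \<mu> in the form that compares the compensator with the
          convex combination of the \<open>q i\<close>.\<close>
        have "2 * c * \<mu>\<^sup>2 \<le> 1 / (4 * c * \<kappa>)"
          using lam r c_pos by (simp add: field_simps power2_eq_square)
        then have "2 * c * \<mu>\<^sup>2 * (a i \<omega>)\<^sup>2 \<le> 1 / (4 * c * \<kappa>) * (a i \<omega>)\<^sup>2"
          by (rule mult_right_mono) simp
        also have "\<dots> = (r i / \<kappa>) * q i \<omega>" using False c_pos r by (simp add: q_def)
        finally show ?thesis .
      qed (simp add: a0[OF i])
    qed
    have 3: "exp (\<Sum>i<n. (r i / \<kappa>) * q i \<omega>) \<le> (\<Sum>i<n. (r i / \<kappa>) * exp (q i \<omega>))"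
    proof -
      have "exp (\<Sum>i\<in>{..<n}. (r i / \<kappa>) *\<^sub>R q i \<omega>) \<le> (\<Sum>i\<in>{..<n}. (r i / \<kappa>) * exp (q i \<omega>))"
        using r r0 n0 by (intro convex_on_sum[OF _ _ exp_convex]) (auto simp: sum_divide_distrib[symmetric])
      then show ?thesis by simp
    qed
    have 4: "(\<Sum>i<n. (r i / \<kappa>) * exp (q i \<omega>)) / 2 = (\<Sum>i<n. r i / (2 * \<kappa>) * exp (q i \<omega>))"
      by (simp add: sum_divide_distrib mult.commute)
    have "exp ?Q \<le> (\<Sum>i<n. (r i / \<kappa>) * exp (q i \<omega>))"
      using 2 3 by (meson exp_le_cancel_iff order_trans)
    then have "(exp (T \<omega>) + exp ?Q) / 2 \<le> exp (T \<omega>) / 2 + (\<Sum>i<n. (r i / \<kappa>) * exp (q i \<omega>)) / 2"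
      by (simp add: add_divide_distrib[symmetric])
    with 1 show ?thesis unfolding 4 by (rule order_trans)
  qed
  have "(\<integral>\<^sup>+\<omega>. ennreal (exp (\<mu> * (\<Sum>i<n. eps i \<omega> * a i \<omega>))) \<partial>P)
      \<le> (\<integral>\<^sup>+\<omega>. (ennreal (1/2) * ennreal (exp (T \<omega>)) + (\<Sum>i<n. ennreal (r i / (2 * \<kappa>)) * ennreal (exp (q i \<omega>)))) \<partial>P)"
  proof (intro nn_integral_mono)
    fix \<omega>
    have "(\<Sum>i<n. ennreal (r i / (2 * \<kappa>)) * ennreal (exp (q i \<omega>))) = ennreal (\<Sum>i<n. r i / (2 * \<kappa>) * exp (q i \<omega>))"
    proof -
      have "(\<Sum>i<n. ennreal (r i / (2 * \<kappa>)) * ennreal (exp (q i \<omega>))) = (\<Sum>i<n. ennreal (r i / (2 * \<kappa>) * exp (q i \<omega>)))"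
        using r0 r by (intro sum.cong refl ennreal_mult[symmetric]) auto
      also have "\<dots> = ennreal (\<Sum>i<n. r i / (2 * \<kappa>) * exp (q i \<omega>))"
        using r0 r by (intro sum_ennreal) auto
      finally show ?thesis .
    qed
    moreover have "ennreal (1/2) * ennreal (exp (T \<omega>)) = ennreal (exp (T \<omega>) / 2)"
      by (simp add: ennreal_mult[symmetric] del: ennreal_half)
    ultimately show "ennreal (exp (\<mu> * (\<Sum>i<n. eps i \<omega> * a i \<omega>))) \<le>
        ennreal (1/2) * ennreal (exp (T \<omega>)) + (\<Sum>i<n. ennreal (r i / (2 * \<kappa>)) * ennreal (exp (q i \<omega>)))"
    proof -
      have "0 \<le> (\<Sum>i<n. r i / (2 * \<kappa>) * exp (q i \<omega>))"
        using r0 r by (intro sum_nonneg mult_nonneg_nonneg divide_nonneg_pos) auto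
      then have "ennreal (exp (T \<omega>) / 2) + ennreal (\<Sum>i<n. r i / (2 * \<kappa>) * exp (q i \<omega>))
          = ennreal (exp (T \<omega>) / 2 + (\<Sum>i<n. r i / (2 * \<kappa>) * exp (q i \<omega>)))"
        by (intro ennreal_plus[symmetric]) auto
      moreover note \<open>(\<Sum>i<n. ennreal (r i / (2 * \<kappa>)) * ennreal (exp (q i \<omega>))) = _\<close>
        \<open>ennreal (1/2) * ennreal (exp (T \<omega>)) = _\<close>
      ultimately show ?thesis using bound[of \<omega>] by (simp only: ennreal_leI)
    qed
  qed
  also have "\<dots> = ennreal (1/2) * (\<integral>\<^sup>+\<omega>. ennreal (exp (T \<omega>)) \<partial>P)
      + (\<Sum>i<n. ennreal (r i / (2 * \<kappa>)) * (\<integral>\<^sup>+\<omega>. ennreal (exp (q i \<omega>)) \<partial>P))"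
    by (subst nn_integral_add) (auto simp: nn_integral_sum nn_integral_cmult)
  also have "\<dots> \<le> ennreal (1/2) * 1 + (\<Sum>i<n. ennreal (r i / (2 * \<kappa>)) * ennreal (sqrt 2))"
    by (intro add_mono mult_left_mono T1 sum_mono q) auto
  also have "\<dots> = ennreal (1/2 + (\<Sum>i<n. r i / (2 * \<kappa>) * sqrt 2))"
  proof -
    have "(\<Sum>i<n. ennreal (r i / (2 * \<kappa>)) * ennreal (sqrt 2)) = ennreal (\<Sum>i<n. r i / (2 * \<kappa>) * sqrt 2)"
    proof -
      have "(\<Sum>i<n. ennreal (r i / (2 * \<kappa>)) * ennreal (sqrt 2)) = (\<Sum>i<n. ennreal (r i / (2 * \<kappa>) * sqrt 2))"
        using r0 r by (intro sum.cong refl ennreal_mult[symmetric]) auto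
      also have "\<dots> = ennreal (\<Sum>i<n. r i / (2 * \<kappa>) * sqrt 2)"
        using r0 r by (intro sum_ennreal) auto
      finally show ?thesis .
    qed
    then show ?thesis
      using r0 r by (subst ennreal_plus) (auto intro!: sum_nonneg simp del: ennreal_half)
  qed
  also have "(\<Sum>i<n. r i / (2 * \<kappa>) * sqrt 2) = sqrt 2 / 2"
    using r by (simp add: sum_distrib_right[symmetric] sum_divide_distrib[symmetric])
  also have "ennreal (1/2 + sqrt 2 / 2) \<le> ennreal 2"
    using sqrt2_less_2 by (intro ennreal_leI) simp
  finally show ?thesis by (simp add: a_def)
qed

lemma nn_integral_exp_diag_le:
  assumes x: "\<And>i. i < n \<Longrightarrow> \<bar>x i\<bar> \<le> 1 / (8 * c)"
  shows "(\<integral>\<^sup>+\<omega>. ennreal (exp (\<Sum>i<n. x i * ((eps i \<omega>)\<^sup>2 - s2))) \<partial>P)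
      \<le> ennreal (exp (64 * c\<^sup>2 * diag_const * (\<Sum>i<n. (x i)\<^sup>2)))"
proof (rule nn_integral_exp_diff_le_1D)
  \<comment> \<open>The supermartingale bound asks for its condition at every index, whereas
    \<open>x\<close> is controlled below n only.\<close>
  define x' where "x' i = (if i < n then x i else 0)" for i
  let ?K = "64 * c\<^sup>2 * diag_const"
  have "(\<integral>\<^sup>+\<omega>. ennreal (exp (\<Sum>i<n. (\<lambda>i a t. x' i * (t\<^sup>2 - s2) - ?K * (x' i)\<^sup>2) i (\<Sum>j<i. 0 * eps j \<omega>) (eps i \<omega>))) \<partial>P) \<le> 1"
  proof (rule nn_integral_exp_adapted_le_1)
    fix i and a :: real
    have "(\<integral>\<^sup>+t. ennreal (exp (x' i * (t\<^sup>2 - s2) - ?K * (x' i)\<^sup>2)) \<partial>law)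
        = (\<integral>\<^sup>+t. ennreal (exp (- (?K * (x' i)\<^sup>2))) * ennreal (exp (x' i * (t\<^sup>2 - s2))) \<partial>law)"
      by (simp add: ennreal_mult[symmetric] exp_add[symmetric])
    also have "\<dots> = ennreal (exp (- (?K * (x' i)\<^sup>2))) * (\<integral>\<^sup>+t. ennreal (exp (x' i * (t\<^sup>2 - s2))) \<partial>law)"
      by (intro nn_integral_cmult) measurable
    also have "\<dots> \<le> ennreal (exp (- (?K * (x' i)\<^sup>2))) * ennreal (exp (?K * (x' i)\<^sup>2))"
      using x c_pos by (intro mult_left_mono nn_integral_law_exp_centered_square_le) (auto simp: x'_def)
    also have "\<dots> = 1" by (simp add: ennreal_mult[symmetric] exp_add[symmetric])
    finally show "(\<integral>\<^sup>+t. ennreal (exp (x' i * (t\<^sup>2 - s2) - ?K * (x' i)\<^sup>2)) \<partial>law) \<le> 1" .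
  qed measurable
  then show "(\<integral>\<^sup>+\<omega>. ennreal (exp ((\<Sum>i<n. x i * ((eps i \<omega>)\<^sup>2 - s2)) - ?K * (\<Sum>i<n. (x i)\<^sup>2))) \<partial>P) \<le> 1"
    by (simp add: x'_def sum_subtractf sum_distrib_left)
qed measurable

text \<open>One bound for linear and quadratic forms: \<open>exp diag_const\<close> comes from the
  diagonal part of a quadratic form, 2 from its off-diagonal part.\<close>

definition exp_const :: real where "exp_const = exp diag_const + 2"

lemma exp_const_ge: "exp_const \<ge> 4"
proof -
  have "1 * 1 \<le> sqrt 2 * exp (s2 / (4 * c))"
    using s2_pos c_pos by (intro mult_mono) auto
  then show ?thesis
    using exp_ge_add_one_self[of diag_const] unfolding exp_const_def diag_const_def by linarith
qed

lemma nn_integral_exp_abs_linear_le: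
  assumes T: "(\<Sum>i<n. (v i)\<^sup>2) \<le> T" "T > 0"
  shows "(\<integral>\<^sup>+\<omega>. ennreal (exp \<bar>(\<Sum>i<n. v i * eps i \<omega>) / sqrt (c * T)\<bar>) \<partial>P) \<le> ennreal exp_const"
proof -
  let ?s = "sqrt (c * T)"
  have s: "?s > 0" "?s\<^sup>2 = c * T" using T c_pos by auto
  have le: "(\<integral>\<^sup>+\<omega>. ennreal (exp (e * ((\<Sum>i<n. v i * eps i \<omega>) / ?s))) \<partial>P) \<le> ennreal (exp (1/2))" if "e\<^sup>2 = 1" for e
  proof -
    have "(\<integral>\<^sup>+\<omega>. ennreal (exp (e * ((\<Sum>i<n. v i * eps i \<omega>) / ?s))) \<partial>P)
        = (\<integral>\<^sup>+\<omega>. ennreal (exp (\<Sum>i<n. (e * v i / ?s) * eps i \<omega>)) \<partial>P)"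
      by (simp add: sum_distrib_left sum_divide_distrib mult.assoc)
    also have "\<dots> \<le> ennreal (exp (c * (\<Sum>i<n. (e * v i / ?s)\<^sup>2) / 2))" by (rule nn_integral_exp_linear_le)
    also have "(\<Sum>i<n. (e * v i / ?s)\<^sup>2) = (\<Sum>i<n. (v i)\<^sup>2) / (c * T)"
      using that s by (simp add: power_mult_distrib power_divide sum_divide_distrib)
    also have "ennreal (exp (c * ((\<Sum>i<n. (v i)\<^sup>2) / (c * T)) / 2)) \<le> ennreal (exp (1/2))"
      using T c_pos by (intro ennreal_leI) (simp add: field_simps)
    finally show ?thesis .
  qed
  have "(\<integral>\<^sup>+\<omega>. ennreal (exp \<bar>(\<Sum>i<n. v i * eps i \<omega>) / ?s\<bar>) \<partial>P)
      \<le> (\<integral>\<^sup>+\<omega>. ennreal (exp (1 * ((\<Sum>i<n. v i * eps i \<omega>) / ?s))) + ennreal (exp ((-1) * ((\<Sum>i<n. v i * eps i \<omega>) / ?s))) \<partial>P)"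
  proof (intro nn_integral_mono)
    fix \<omega>
    have sum2: "ennreal (exp a) + ennreal (exp b) = ennreal (exp a + exp b)" for a b
      by (simp add: ennreal_plus[symmetric] del: ennreal_plus)
    show "ennreal (exp \<bar>(\<Sum>i<n. v i * eps i \<omega>) / ?s\<bar>)
      \<le> ennreal (exp (1 * ((\<Sum>i<n. v i * eps i \<omega>) / ?s))) + ennreal (exp ((-1) * ((\<Sum>i<n. v i * eps i \<omega>) / ?s)))"
      unfolding sum2 using exp_abs_le[of "(\<Sum>i<n. v i * eps i \<omega>) / ?s"]
      by (intro ennreal_leI) (simp only: mult_1 mult_minus1)
  qed
  also have "\<dots> = (\<integral>\<^sup>+\<omega>. ennreal (exp (1 * ((\<Sum>i<n. v i * eps i \<omega>) / ?s))) \<partial>P)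
       + (\<integral>\<^sup>+\<omega>. ennreal (exp ((-1) * ((\<Sum>i<n. v i * eps i \<omega>) / ?s))) \<partial>P)"
    by (intro nn_integral_add) measurable
  also have "\<dots> \<le> ennreal (exp (1/2)) + ennreal (exp (1/2))"
    by (intro add_mono le) auto
  also have "\<dots> = ennreal (2 * exp (1/2))" by (simp add: ennreal_plus[symmetric] del: ennreal_plus)
  also have "2 * exp (1/2) \<le> exp_const"
  proof -
    have "exp (1/2 :: real) \<le> 2"
      using exp_bound_half[of "1/2::real"] by simp
    then show ?thesis using exp_const_ge by linarith
  qed
  finally show ?thesis by (simp add: ennreal_leI)
qed

text \<open>The hypotheses are those properties of the matrix of an orthogonal projection of rank
  \<kappa> that enter: symmetry, idempotence on the diagonal, and the trace. They put the diagonal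
  entries into [0,1] and bound both the sum of their squares and the off-diagonal row sums by the
  trace, so that sqrt \<kappa> is the right scale.\<close>

lemma nn_integral_exp_abs_quadratic_le:
  assumes sym: "\<And>i j. Q i j = Q j i"
    and row: "\<And>i. i < n \<Longrightarrow> (\<Sum>j<n. (Q i j)\<^sup>2) = Q i i"
    and tr: "(\<Sum>i<n. Q i i) = \<kappa>" and \<kappa>: "\<kappa> \<ge> 1"
  shows "(\<integral>\<^sup>+\<omega>. ennreal (exp \<bar>((\<Sum>i<n. \<Sum>j<n. Q i j * eps i \<omega> * eps j \<omega>) - s2 * \<kappa>) / (16 * c * sqrt \<kappa>)\<bar>) \<partial>P)
      \<le> ennreal exp_const"
proof -
  define D where "D \<omega> = (\<Sum>i<n. Q i i * ((eps i \<omega>)\<^sup>2 - s2))" for \<omega>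
  define S where "S \<omega> = (\<Sum>i<n. eps i \<omega> * (\<Sum>j<i. 2 * Q i j * eps j \<omega>))" for \<omega>
  have [measurable]: "D \<in> borel_measurable P" "S \<in> borel_measurable P"
    unfolding D_def S_def by measurable
  have Q: "0 \<le> Q i i" "Q i i \<le> 1" "(\<Sum>j<i. (Q i j)\<^sup>2) \<le> Q i i" if "i < n" for i
  proof -
    show 0: "0 \<le> Q i i" unfolding row[OF that, symmetric] by (simp add: sum_nonneg)
    have "(Q i i)\<^sup>2 \<le> (\<Sum>j<n. (Q i j)\<^sup>2)"
      using that by (intro member_le_sum) auto
    then have "Q i i * Q i i \<le> Q i i * 1" unfolding row[OF that] by (simp add: power2_eq_square)
    then show "Q i i \<le> 1" using 0 by (cases "Q i i = 0") auto
    have "(\<Sum>j<i. (Q i j)\<^sup>2) \<le> (\<Sum>j<n. (Q i j)\<^sup>2)"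
      using that by (intro sum_mono2) auto
    then show "(\<Sum>j<i. (Q i j)\<^sup>2) \<le> Q i i" unfolding row[OF that] .
  qed
  have split: "(\<Sum>i<n. \<Sum>j<n. Q i j * eps i \<omega> * eps j \<omega>) - s2 * \<kappa> = D \<omega> + S \<omega>" for \<omega>
  proof -
    have "(\<Sum>i<m. \<Sum>j<m. Q i j * eps i \<omega> * eps j \<omega>)
        = (\<Sum>i<m. Q i i * (eps i \<omega>)\<^sup>2) + (\<Sum>i<m. eps i \<omega> * (\<Sum>j<i. 2 * Q i j * eps j \<omega>))" for m
    proof (induction m)
      case (Suc m)
      have "(\<Sum>i<m. Q i m * eps i \<omega> * eps m \<omega>) = (\<Sum>j<m. Q m j * eps m \<omega> * eps j \<omega>)"
        using sym by (intro sum.cong refl) (simp add: mult_ac)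
      then show ?case using Suc
        by (simp add: sum.distrib power2_eq_square sum_distrib_left mult_ac)
    qed simp
    then show ?thesis unfolding D_def S_def tr[symmetric]
      by (simp add: algebra_simps sum_subtractf sum_distrib_left)
  qed
  \<comment> \<open>The largest rate allowed for the diagonal part, where it must stay below 1 / (8
    c) on each entry; it also satisfies the off-diagonal condition with total row bound 4 \<kappa>.
    Joining the two parts by convexity halves the rate, which turns 8 into 16.\<close>
  define l where "l = 1 / (8 * c * sqrt \<kappa>)"
  have sk: "sqrt \<kappa> \<ge> 1" using \<kappa> by simp
  have l2: "64 * c\<^sup>2 * (l\<^sup>2 * \<kappa>) = 1" using c_pos \<kappa> by (simp add: l_def power_mult_distrib power_divide)
  have dpos: "diag_const \<ge> 0" by (simp add: diag_const_def)
  have D1: "(\<integral>\<^sup>+\<omega>. ennreal (exp (e * l * D \<omega>)) \<partial>P) \<le> ennreal (exp diag_const)" if e: "\<bar>e\<bar> = 1" for e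
  proof -
    have e2: "e\<^sup>2 = 1" using e by (metis one_power2 power2_abs)
    have "(\<integral>\<^sup>+\<omega>. ennreal (exp (e * l * D \<omega>)) \<partial>P)
        = (\<integral>\<^sup>+\<omega>. ennreal (exp (\<Sum>i<n. (e * l * Q i i) * ((eps i \<omega>)\<^sup>2 - s2))) \<partial>P)"
      by (simp add: D_def sum_distrib_left mult.assoc)
    also have "\<dots> \<le> ennreal (exp (64 * c\<^sup>2 * diag_const * (\<Sum>i<n. (e * l * Q i i)\<^sup>2)))"
    proof (rule nn_integral_exp_diag_le)
      fix i assume i: "i < n"
      have l: "0 < l" "l \<le> 1 / (8 * c)"
        using sk c_pos unfolding l_def by (auto intro!: divide_left_mono)
      have "\<bar>e * l * Q i i\<bar> = l * Q i i" using e l Q[OF i] by (simp add: abs_mult)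
      also have "\<dots> \<le> 1 / (8 * c) * 1" using l Q[OF i] c_pos by (intro mult_mono) auto
      finally show "\<bar>e * l * Q i i\<bar> \<le> 1 / (8 * c)" by simp
    qed
    also have "\<dots> \<le> ennreal (exp diag_const)"
    proof -
      have "(\<Sum>i<n. (Q i i)\<^sup>2) \<le> (\<Sum>i<n. Q i i)"
        using Q by (intro sum_mono) (auto simp: power2_eq_square intro: mult_left_le)
      then have "(\<Sum>i<n. (e * l * Q i i)\<^sup>2) \<le> l\<^sup>2 * \<kappa>"
        unfolding tr by (simp add: power_mult_distrib e2 sum_distrib_left[symmetric] mult_left_mono)
      then have "64 * c\<^sup>2 * diag_const * (\<Sum>i<n. (e * l * Q i i)\<^sup>2) \<le> 64 * c\<^sup>2 * diag_const * (l\<^sup>2 * \<kappa>)"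
        using dpos by (intro mult_left_mono) auto
      also have "\<dots> = diag_const * (64 * c\<^sup>2 * (l\<^sup>2 * \<kappa>))" by simp
      also have "\<dots> = diag_const" unfolding l2 by simp
      finally show ?thesis by (simp add: ennreal_leI)
    qed
    finally show ?thesis .
  qed
  have S1: "(\<integral>\<^sup>+\<omega>. ennreal (exp (e * l * S \<omega>)) \<partial>P) \<le> ennreal 2" if e: "\<bar>e\<bar> = 1" for e
  proof -
    have e2: "e\<^sup>2 = 1" using e by (metis one_power2 power2_abs)
    have "(\<integral>\<^sup>+\<omega>. ennreal (exp ((e * l) * (\<Sum>i<n. eps i \<omega> * (\<Sum>j<i. (2 * Q i j) * eps j \<omega>)))) \<partial>P) \<le> 2"
    proof (rule nn_integral_exp_offdiag_le[where \<kappa>="4 * \<kappa>" and r="\<lambda>i. 4 * Q i i"])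
      show "(\<Sum>j<i. (2 * Q i j)\<^sup>2) \<le> 4 * Q i i" if "i < n" for i
        using Q(3)[OF that] by (simp add: power_mult_distrib sum_distrib_left[symmetric])
      show "(\<Sum>i<n. 4 * Q i i) = 4 * \<kappa>" using tr by (simp add: sum_distrib_left[symmetric])
      show "8 * c\<^sup>2 * (e * l)\<^sup>2 * (4 * \<kappa>) \<le> 1"
        using l2 by (simp add: power_mult_distrib e2)
    qed (use \<kappa> in auto)
    then show ?thesis by (simp add: S_def)
  qed
  have bound: "exp \<bar>(D \<omega> + S \<omega>) / (16 * c * sqrt \<kappa>)\<bar>
      \<le> 1/2 * ((exp (1 * l * D \<omega>) + exp ((-1) * l * D \<omega>)) + (exp (1 * l * S \<omega>) + exp ((-1) * l * S \<omega>)))" for \<omega>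
  proof -
    have "(D \<omega> + S \<omega>) / (16 * c * sqrt \<kappa>) = (l * D \<omega> + l * S \<omega>) / 2"
      by (simp add: l_def add_divide_distrib)
    then have "\<bar>(D \<omega> + S \<omega>) / (16 * c * sqrt \<kappa>)\<bar> \<le> (\<bar>l * D \<omega>\<bar> + \<bar>l * S \<omega>\<bar>) / 2"
      using abs_triangle_ineq[of "l * D \<omega>" "l * S \<omega>"] by (simp only: abs_divide) simp
    then have "exp \<bar>(D \<omega> + S \<omega>) / (16 * c * sqrt \<kappa>)\<bar> \<le> (exp \<bar>l * D \<omega>\<bar> + exp \<bar>l * S \<omega>\<bar>) / 2"
      by (meson exp_le_cancel_iff exp_midpoint_le order_trans)
    then show ?thesis using exp_abs_le[of "l * D \<omega>"] exp_abs_le[of "l * S \<omega>"] by simp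
  qed
  have "(\<integral>\<^sup>+\<omega>. ennreal (exp \<bar>(D \<omega> + S \<omega>) / (16 * c * sqrt \<kappa>)\<bar>) \<partial>P)
      \<le> (\<integral>\<^sup>+\<omega>. ennreal (1/2) * ((ennreal (exp (1 * l * D \<omega>)) + ennreal (exp ((-1) * l * D \<omega>)))
          + (ennreal (exp (1 * l * S \<omega>)) + ennreal (exp ((-1) * l * S \<omega>)))) \<partial>P)"
  proof (intro nn_integral_mono)
    fix \<omega>
    have sum2: "ennreal (exp a) + ennreal (exp b) = ennreal (exp a + exp b)" for a b
      by (simp add: ennreal_plus[symmetric] del: ennreal_plus)
    show "ennreal (exp \<bar>(D \<omega> + S \<omega>) / (16 * c * sqrt \<kappa>)\<bar>)
       \<le> ennreal (1/2) * ((ennreal (exp (1 * l * D \<omega>)) + ennreal (exp ((-1) * l * D \<omega>)))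
          + (ennreal (exp (1 * l * S \<omega>)) + ennreal (exp ((-1) * l * S \<omega>))))"
      unfolding sum2
      by (subst ennreal_plus[symmetric], simp, simp, subst ennreal_mult[symmetric], simp, simp,
          rule ennreal_leI, rule bound)
  qed
  also have "\<dots> = ennreal (1/2) * (((\<integral>\<^sup>+\<omega>. ennreal (exp (1 * l * D \<omega>)) \<partial>P) + (\<integral>\<^sup>+\<omega>. ennreal (exp ((-1) * l * D \<omega>)) \<partial>P))
      + ((\<integral>\<^sup>+\<omega>. ennreal (exp (1 * l * S \<omega>)) \<partial>P) + (\<integral>\<^sup>+\<omega>. ennreal (exp ((-1) * l * S \<omega>)) \<partial>P)))"
    by (simp add: nn_integral_cmult nn_integral_add del: mult_minus_left)
  also have "\<dots> \<le> ennreal (1/2) * ((ennreal (exp diag_const) + ennreal (exp diag_const)) + (ennreal 2 + ennreal 2))"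
    by (intro mult_left_mono add_mono D1 S1) auto
  also have "\<dots> = ennreal exp_const"
    by (simp add: ennreal_plus[symmetric] ennreal_mult[symmetric] exp_const_def del: ennreal_plus ennreal_half ennreal_numeral)
  finally show ?thesis unfolding split .
qed

section \<open>First and second moments of the errors\<close>

lemma integrable_eps_square: "integrable P (\<lambda>\<omega>. (eps i \<omega>)\<^sup>2)"
  using integrable_law_square integrable_distr_eq[of "eps i" P borel "\<lambda>t. t\<^sup>2"]
  unfolding law_def eps_ident[of i, symmetric] by simp

lemma integrable_eps: "integrable P (eps i)"
  using square_integrable_imp_integrable[OF eps_meas integrable_eps_square] by simp

lemma expectation_eps: "expectation (eps i) = 0"
proof -
  have "expectation (eps i) = (\<integral>t. t \<partial>distr P borel (eps i))" by (subst integral_distr) auto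
  also have "\<dots> = expectation (eps 0)" unfolding eps_ident[of i] by (subst integral_distr) auto
  finally show ?thesis using eps_mean by simp
qed

lemma integrable_eps_mult: "integrable P (\<lambda>\<omega>. eps i \<omega> * eps j \<omega>)"
proof (rule Bochner_Integration.integrable_bound)
  show "integrable P (\<lambda>\<omega>. (eps i \<omega>)\<^sup>2 + (eps j \<omega>)\<^sup>2)" by (intro Bochner_Integration.integrable_add integrable_eps_square)
  have "\<bar>x * y\<bar> \<le> x\<^sup>2 + y\<^sup>2" for x y :: real
  proof -
    have "2 * (\<bar>x\<bar> * \<bar>y\<bar>) \<le> x\<^sup>2 + y\<^sup>2" using sum_squares_bound[of "\<bar>x\<bar>" "\<bar>y\<bar>"] by simp
    moreover have "0 \<le> \<bar>x\<bar> * \<bar>y\<bar>" by simp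
    ultimately show ?thesis unfolding abs_mult by linarith
  qed
  then show "AE \<omega> in P. norm (eps i \<omega> * eps j \<omega>) \<le> norm ((eps i \<omega>)\<^sup>2 + (eps j \<omega>)\<^sup>2)" by simp
qed measurable

lemma expectation_eps_mult: "expectation (\<lambda>\<omega>. eps i \<omega> * eps j \<omega>) = (if i = j then s2 else 0)"
proof (cases "i = j")
  case True
  have "expectation (\<lambda>\<omega>. (eps i \<omega>)\<^sup>2) = (\<integral>t. t\<^sup>2 \<partial>distr P borel (eps i))"
    by (rule integral_distr[symmetric]) measurable
  also have "\<dots> = s2" unfolding eps_ident[of i] law_def[symmetric] by (rule integral_law_square)
  finally show ?thesis using True by (simp only: power2_eq_square if_True simp_thms)
next
  case False
  have "indep_vars (\<lambda>_. borel) eps {i, j}" by (rule indep_vars_subset[OF eps_indep]) simp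
  from indep_vars_lebesgue_integral[OF _ this integrable_eps]
  have "expectation (\<lambda>\<omega>. \<Prod>l\<in>{i, j}. eps l \<omega>) = (\<Prod>l\<in>{i, j}. expectation (eps l))"
    by simp
  then show ?thesis using False by (simp add: expectation_eps)
qed

end

section \<open>Summation by parts over nested blocks\<close>

text \<open>Summation by parts as an induction: \<open>h i\<close> times the partial sum up to i
  stays below the weighted sum, because lowering \<open>h\<close> lowers its product with a
  nonnegative partial sum.\<close>

lemma sum_antimono_mult_ge:
  fixes h D :: "nat \<Rightarrow> real"
  assumes h: "\<And>i. Suc i < n \<Longrightarrow> h (Suc i) \<le> h i" "\<And>i. i < n \<Longrightarrow> 0 \<le> h i"
    and D: "\<And>j. j \<le> n \<Longrightarrow> 0 \<le> (\<Sum>i<j. D i)"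
  shows "0 \<le> (\<Sum>i<n. h i * D i)"
proof (cases n)
  case (Suc m)
  have "h i * (\<Sum>j<Suc i. D j) \<le> (\<Sum>j<Suc i. h j * D j)" if "i < n" for i
    using that
  proof (induction i)
    case (Suc i)
    have "h (Suc i) * (\<Sum>j<Suc i. D j) \<le> h i * (\<Sum>j<Suc i. D j)"
      using h(1)[of i] D[of "Suc i"] Suc.prems by (intro mult_right_mono) auto
    then show ?case using Suc by (simp add: algebra_simps)
  qed simp
  from this[of m] show ?thesis
    using Suc h(2)[of m] D[of n] mult_nonneg_nonneg[of "h m" "\<Sum>j<Suc m. D j"]
    by (metis lessI order_refl order_trans)
qed simp

text \<open>A summand of the first Cauchy-Schwarz factor in \<open>abel_cauchy_schwarz\<close>;
  where \<open>A\<close> is constant the value is 0, by division by zero.\<close>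

definition sqrt_increment_ratio :: "(nat \<Rightarrow> real) \<Rightarrow> nat \<Rightarrow> real" where
  "sqrt_increment_ratio A i = (sqrt (A (Suc i)) - sqrt (A i))\<^sup>2 / (A (Suc i) - A i)"

text \<open>The increments \<open>s i\<close> of sqrt A telescope to the bound on the partial sums
  of \<open>u\<close>. Hence W s - u and W s + u have nonnegative partial sums, and a nonincreasing
  \<open>h\<close> may replace \<open>u\<close> by W s. Cauchy-Schwarz with the increments of
  \<open>A\<close> as weights then separates \<open>h\<close> from the geometry of
  \<open>A\<close>.\<close>

lemma abel_cauchy_schwarz:
  fixes h u A :: "nat \<Rightarrow> real"
  assumes h: "\<And>i. Suc i < M \<Longrightarrow> h (Suc i) \<le> h i" "\<And>i. i < M \<Longrightarrow> 0 \<le> h i"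
    and A: "A 0 = 0" "\<And>i. i < M \<Longrightarrow> A i \<le> A (Suc i)"
    and u: "\<And>j. j \<le> M \<Longrightarrow> \<bar>\<Sum>i<j. u i\<bar> \<le> W * sqrt (A j)" and W: "0 \<le> W"
  shows "\<bar>\<Sum>i<M. h i * u i\<bar> \<le>
    W * sqrt (\<Sum>i<M. sqrt_increment_ratio A i) * sqrt (\<Sum>i<M. (h i)\<^sup>2 * (A (Suc i) - A i))"
proof -
  define s where "s i = sqrt (A (Suc i)) - sqrt (A i)" for i
  have tel: "(\<Sum>i<j. s i) = sqrt (A j)" for j
    using A(1) sum_lessThan_telescope[of "\<lambda>i. sqrt (A i)" j] by (simp add: s_def)
  have ps: "0 \<le> (\<Sum>i<j. W * s i - e * u i)" if "j \<le> M" "\<bar>e\<bar> = 1" for j e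
  proof -
    have "e * (\<Sum>i<j. u i) \<le> \<bar>\<Sum>i<j. u i\<bar>"
      using that(2) abs_ge_self[of "e * (\<Sum>i<j. u i)"] by (simp add: abs_mult)
    then show ?thesis
      using u[OF that(1)] by (simp add: sum_subtractf sum_distrib_left[symmetric] tel)
  qed
  have "0 \<le> (\<Sum>i<M. h i * (W * s i - e * u i))" if "\<bar>e\<bar> = 1" for e
  proof (rule sum_antimono_mult_ge)
    show "0 \<le> (\<Sum>i<j. W * s i - e * u i)" if "j \<le> M" for j
      by (rule ps[OF that \<open>\<bar>e\<bar> = 1\<close>])
  qed (use h in auto)
  from this[of 1] this[of "-1"]
  have "\<bar>\<Sum>i<M. h i * u i\<bar> \<le> (\<Sum>i<M. h i * (W * s i))"
    by (simp add: algebra_simps sum_subtractf sum.distrib abs_le_iff)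
  also have "\<dots> = W * (\<Sum>i<M. h i * s i)" by (simp add: sum_distrib_left mult_ac)
  also have "(\<Sum>i<M. h i * s i) \<le> sqrt ((\<Sum>i<M. sqrt_increment_ratio A i) * (\<Sum>i<M. (h i)\<^sup>2 * (A (Suc i) - A i)))"
  proof (rule real_le_rsqrt)
    have "(\<Sum>i<M. h i * s i) = (\<Sum>i<M. (s i / sqrt (A (Suc i) - A i)) * (h i * sqrt (A (Suc i) - A i)))"
    proof (intro sum.cong refl)
      fix i assume "i \<in> {..<M}"
      then have "A i \<le> A (Suc i)" using A(2) by simp
      then show "h i * s i = (s i / sqrt (A (Suc i) - A i)) * (h i * sqrt (A (Suc i) - A i))"
        by (cases "A i = A (Suc i)") (auto simp: s_def)
    qed
    also have "(\<dots>)\<^sup>2 \<le> (\<Sum>i<M. (s i / sqrt (A (Suc i) - A i))\<^sup>2) * (\<Sum>i<M. (h i * sqrt (A (Suc i) - A i))\<^sup>2)"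
      by (rule Cauchy_Schwarz_ineq_sum)
    also have "(\<Sum>i<M. (s i / sqrt (A (Suc i) - A i))\<^sup>2) = (\<Sum>i<M. sqrt_increment_ratio A i)"
      using A(2) by (intro sum.cong refl) (auto simp: s_def sqrt_increment_ratio_def power_divide)
    also have "(\<Sum>i<M. (h i * sqrt (A (Suc i) - A i))\<^sup>2) = (\<Sum>i<M. (h i)\<^sup>2 * (A (Suc i) - A i))"
      using A(2) by (intro sum.cong refl) (auto simp: power_mult_distrib)
    finally show "(\<Sum>i<M. h i * s i)\<^sup>2 \<le> (\<Sum>i<M. sqrt_increment_ratio A i) * (\<Sum>i<M. (h i)\<^sup>2 * (A (Suc i) - A i))" .
  qed
  finally show ?thesis using W by (simp add: real_sqrt_mult mult_left_mono mult.assoc)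
qed

text \<open>With a and b the roots of the new and the old value, the ratio is (a - b) / (a +
  b).\<close>

lemma sqrt_increment_ratio_le_1:
  assumes "0 \<le> A i" "A i \<le> A (Suc i)"
  shows "sqrt_increment_ratio A i \<le> 1"
proof (cases "A i = A (Suc i)")
  case False
  let ?a = "sqrt (A (Suc i))" and ?b = "sqrt (A i)"
  have ab: "?b \<le> ?a" "0 \<le> ?b" "A (Suc i) = ?a\<^sup>2" "A i = ?b\<^sup>2" using assms by auto
  have "(?a - ?b)\<^sup>2 \<le> (?a - ?b) * (?a + ?b)"
    unfolding power2_eq_square using ab by (intro mult_left_mono) auto
  also have "\<dots> = A (Suc i) - A i"
    using ab(3,4) by (metis power2_eq_square square_diff_square_factored mult.commute)
  finally show ?thesis using False assms by (simp add: sqrt_increment_ratio_def)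
qed (simp add: sqrt_increment_ratio_def)

text \<open>The same ratio is the increment divided by the square of a + b, and a + b is at least 2
  b. This is the origin of the factor 4 in \<open>psi\<close>.\<close>

lemma sqrt_increment_ratio_le_quarter:
  assumes "0 < A i" "A i \<le> A (Suc i)"
  shows "sqrt_increment_ratio A i \<le> (A (Suc i) - A i) / (4 * A i)"
proof (cases "A i = A (Suc i)")
  case False
  let ?a = "sqrt (A (Suc i))" and ?b = "sqrt (A i)"
  have ab: "?b \<le> ?a" "0 < ?b" "A (Suc i) = ?a\<^sup>2" "A i = ?b\<^sup>2" using assms by auto
  have d: "A (Suc i) - A i = (?a - ?b) * (?a + ?b)"
    using ab(3,4) by (metis power2_eq_square square_diff_square_factored mult.commute)
  have "(?a - ?b)\<^sup>2 * (4 * A i) \<le> (?a - ?b)\<^sup>2 * (?a + ?b)\<^sup>2"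
  proof (rule mult_left_mono)
    have "(2 * ?b)\<^sup>2 \<le> (?a + ?b)\<^sup>2" using ab by (intro power_mono) auto
    then show "4 * A i \<le> (?a + ?b)\<^sup>2" using assms by (simp add: power_mult_distrib)
  qed simp
  also have "\<dots> = (A (Suc i) - A i) * (A (Suc i) - A i)"
    unfolding d by (simp add: power2_eq_square mult_ac)
  finally show ?thesis using False assms by (simp add: sqrt_increment_ratio_def field_simps)
qed (simp add: sqrt_increment_ratio_def)

lemma sqrt_increment_ratio_eq_0: "A (Suc i) = A i \<Longrightarrow> sqrt_increment_ratio A i = 0"
  by (simp add: sqrt_increment_ratio_def)

text \<open>The first factor of \<open>psi\<close> for an abstract tail sequence \<open>T\<close>.
  Only zeros and quotients of \<open>T\<close> matter, so squared coefficients may be used with or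
  without the normalisation by n.\<close>

definition complexity :: "(nat \<Rightarrow> nat) \<Rightarrow> (nat \<Rightarrow> real) \<Rightarrow> nat \<Rightarrow> real" where
  "complexity k T M = min (real M)
     (1 + (\<Sum>j=1..M-1. (real (k (j+1)) - real (k j)) / (4 * real (k j)))
        + (\<Sum>j=1..(LEAST j. 1 \<le> j \<and> j \<le> M \<and> T j = 0) - 1. (T (j-1) - T j) / (4 * T j)))"

locale nested_blocks =
  fixes k :: "nat \<Rightarrow> nat" and M :: nat
  assumes M_pos: "1 \<le> M" and k_0: "k 0 = 0" and k_less: "\<And>j. j < M \<Longrightarrow> k j < k (Suc j)"
begin

lemma k_mono: "i \<le> j \<Longrightarrow> j \<le> M \<Longrightarrow> k i \<le> k j"
proof (induction j)
  case (Suc j)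
  then show ?case using k_less[of j] by (cases "i = Suc j") auto
qed simp

lemma k_pos: "1 \<le> j \<Longrightarrow> j \<le> M \<Longrightarrow> 0 < k j"
  using k_mono[of 1 j] k_less[of 0] k_0 M_pos by simp

lemma sum_blocks:
  fixes x :: "nat \<Rightarrow> 'b::comm_monoid_add"
  shows "j \<le> M \<Longrightarrow> (\<Sum>i<j. \<Sum>l\<in>{k i..<k (Suc i)}. x l) = (\<Sum>l<k j. x l)"
proof (induction j)
  case (Suc j)
  then have "{..<k (Suc j)} = {..<k j} \<union> {k j..<k (Suc j)}" using k_less[of j] by auto
  moreover have "{..<k j} \<inter> {k j..<k (Suc j)} = {}" by auto
  ultimately show ?case using Suc by (simp add: sum.union_disjoint)
qed (simp add: k_0)

definition tail :: "(nat \<Rightarrow> real) \<Rightarrow> nat \<Rightarrow> real" where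
  "tail x j = (\<Sum>l\<in>{k j..<k M}. x l)"

lemma tail_Suc: "j < M \<Longrightarrow> tail x j = (\<Sum>l\<in>{k j..<k (Suc j)}. x l) + tail x (Suc j)"
  unfolding tail_def using k_less[of j] k_mono[of "Suc j" M] by (subst sum.atLeastLessThan_concat) auto

lemma tail_M: "tail x M = 0"
  by (simp add: tail_def)

lemma tail_nonneg: "(\<And>l. 0 \<le> x l) \<Longrightarrow> 0 \<le> tail x j"
  by (simp add: tail_def sum_nonneg)

lemma quotient_sum_nonneg:
  assumes "\<And>l. 0 \<le> x l" "m \<le> M"
  shows "0 \<le> (\<Sum>j=1..m. (tail x (j-1) - tail x j) / (4 * tail x j))"
proof (rule sum_nonneg)
  fix j assume "j \<in> {1..m}"
  then have "tail x (j - 1) - tail x j = (\<Sum>l\<in>{k (j-1)..<k j}. x l)"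
    using tail_Suc[of "j - 1" x] assms(2) by auto
  then show "0 \<le> (tail x (j-1) - tail x j) / (4 * tail x j)"
    using assms tail_nonneg[of x j] by (simp add: sum_nonneg)
qed

text \<open>The quarter bound divides by \<open>k j\<close>, which is 0 for the first block; the
  summand 1 of the complexity pays for that block. The alternative \<open>M\<close> charges 1 to
  every block.\<close>

lemma sum_ratio_k_le_complexity:
  assumes "\<And>l. 0 \<le> x l"
  shows "(\<Sum>i<M. sqrt_increment_ratio (\<lambda>j. real (k j)) i) \<le> complexity k (tail x) M"
  unfolding complexity_def
proof (rule min.boundedI)
  have inc: "real (k i) \<le> real (k (Suc i))" if "i < M" for i using k_less[OF that] by simp
  have "(\<Sum>i<M. sqrt_increment_ratio (\<lambda>j. real (k j)) i) \<le> (\<Sum>i<M. 1)"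
    using inc by (intro sum_mono sqrt_increment_ratio_le_1) auto
  then show "(\<Sum>i<M. sqrt_increment_ratio (\<lambda>j. real (k j)) i) \<le> real M" by simp
  have "{..<M} = insert 0 {1..M - 1}" using M_pos by auto
  then have "(\<Sum>i<M. sqrt_increment_ratio (\<lambda>j. real (k j)) i)
      = sqrt_increment_ratio (\<lambda>j. real (k j)) 0 + (\<Sum>i=1..M-1. sqrt_increment_ratio (\<lambda>j. real (k j)) i)"
    by simp
  also have "\<dots> \<le> 1 + (\<Sum>j=1..M-1. (real (k (j+1)) - real (k j)) / (4 * real (k j)))"
  proof (intro add_mono sum_mono)
    show "sqrt_increment_ratio (\<lambda>j. real (k j)) 0 \<le> 1"
      using inc[of 0] M_pos by (intro sqrt_increment_ratio_le_1) auto
    fix i assume i: "i \<in> {1..M-1}"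
    then show "sqrt_increment_ratio (\<lambda>j. real (k j)) i \<le> (real (k (i+1)) - real (k i)) / (4 * real (k i))"
      using sqrt_increment_ratio_le_quarter[of "\<lambda>j. real (k j)" i] inc[of i] k_pos[of i] by auto
  qed
  moreover have "0 \<le> (\<Sum>j=1..(LEAST j. 1 \<le> j \<and> j \<le> M \<and> tail x j = 0) - 1. (tail x (j-1) - tail x j) / (4 * tail x j))"
  proof (rule quotient_sum_nonneg[OF assms])
    have "(LEAST j. 1 \<le> j \<and> j \<le> M \<and> tail x j = 0) \<le> M"
      using M_pos tail_M by (intro Least_le) auto
    then show "(LEAST j. 1 \<le> j \<and> j \<le> M \<and> tail x j = 0) - 1 \<le> M" by simp
  qed
  ultimately show "(\<Sum>i<M. sqrt_increment_ratio (\<lambda>j. real (k j)) i) \<le>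
     1 + (\<Sum>j=1..M-1. (real (k (j+1)) - real (k j)) / (4 * real (k j)))
        + (\<Sum>j=1..(LEAST j. 1 \<le> j \<and> j \<le> M \<and> tail x j = 0) - 1. (tail x (j-1) - tail x j) / (4 * tail x j))"
    by linarith
qed

text \<open>Tails are read from the last block backwards and so increase. The summand 1 now pays for
  block \<open>M'\<close>, where the tail first vanishes and the quarter bound would divide by zero;
  later blocks contribute nothing.\<close>

lemma sum_ratio_tail_le_complexity:
  assumes x: "\<And>l. 0 \<le> x l"
  shows "(\<Sum>i<M. sqrt_increment_ratio (\<lambda>j. tail x (M - j)) i) \<le> complexity k (tail x) M"
  unfolding complexity_def
proof (rule min.boundedI)
  let ?A = "\<lambda>j. tail x (M - j)"
  define M' where "M' = (LEAST j. 1 \<le> j \<and> j \<le> M \<and> tail x j = 0)"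
  have dec: "tail x (Suc j) \<le> tail x j" if "j < M" for j
    unfolding tail_Suc[OF that] using x by (simp add: sum_nonneg)
  have inc: "?A i \<le> ?A (Suc i)" if "i < M" for i
    using dec[of "M - Suc i"] that by (simp add: Suc_diff_Suc)
  have "(\<Sum>i<M. sqrt_increment_ratio ?A i) \<le> (\<Sum>i<M. 1)"
    using inc x by (intro sum_mono sqrt_increment_ratio_le_1) (auto intro: tail_nonneg)
  then show "(\<Sum>i<M. sqrt_increment_ratio ?A i) \<le> real M" by simp
  have M': "1 \<le> M'" "M' \<le> M" "tail x M' = 0"
    using LeastI[of "\<lambda>j. 1 \<le> j \<and> j \<le> M \<and> tail x j = 0" M] M_pos tail_M unfolding M'_def by auto
  have pos: "tail x j > 0" if "1 \<le> j" "j < M'" for j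
    using not_less_Least[of j "\<lambda>j. 1 \<le> j \<and> j \<le> M \<and> tail x j = 0"] that M'(2) tail_nonneg[of x j] x
    unfolding M'_def[symmetric] by (simp add: less_le)
  have zero: "tail x j = 0" if "M' \<le> j" "j \<le> M" for j
    using that
  proof (induction j)
    case (Suc j)
    show ?case
    proof (cases "M' = Suc j")
      case False
      then have "tail x j = 0" "j < M" using Suc by auto
      then show ?thesis using dec[of j] tail_nonneg[of x "Suc j"] x by simp
    qed (use M' in simp)
  qed (use M' in simp)
  \<comment> \<open>Back to block numbers: position M - j belongs to block j, with tail j before the
    step and tail j - 1 after it.\<close>
  have "(\<Sum>i<M. sqrt_increment_ratio ?A i) = (\<Sum>i<M. sqrt_increment_ratio ?A (M - Suc i))"
    by (rule sum.nat_diff_reindex[symmetric])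
  also have "\<dots> = (\<Sum>j=1..M. sqrt_increment_ratio ?A (M - j))"
    by (rule sum.reindex_bij_witness[of _ "\<lambda>j. j - 1" Suc]) auto
  also have "\<dots> = (\<Sum>j=1..M'-1. sqrt_increment_ratio ?A (M - j)) + (\<Sum>j=M'..M. sqrt_increment_ratio ?A (M - j))"
  proof -
    have "{1..M} = {1..M'-1} \<union> {M'..M}" "{1..M'-1} \<inter> {M'..M} = {}" using M' by auto
    then show ?thesis by (simp add: sum.union_disjoint)
  qed
  also have "(\<Sum>j=M'..M. sqrt_increment_ratio ?A (M - j)) = sqrt_increment_ratio ?A (M - M') + (\<Sum>j\<in>{Suc M'..M}. sqrt_increment_ratio ?A (M - j))"
    using M' by (simp add: sum.atLeast_Suc_atMost)
  also have "(\<Sum>j\<in>{Suc M'..M}. sqrt_increment_ratio ?A (M - j)) = 0"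
  proof (intro sum.neutral ballI sqrt_increment_ratio_eq_0)
    fix j assume "j \<in> {Suc M'..M}"
    then show "?A (Suc (M - j)) = ?A (M - j)" using zero[of j] zero[of "j - 1"] by (auto simp: Suc_diff_le[symmetric])
  qed
  also have "sqrt_increment_ratio ?A (M - M') \<le> 1"
    using inc[of "M - M'"] M' x by (intro sqrt_increment_ratio_le_1 tail_nonneg) auto
  also have "(\<Sum>j=1..M'-1. sqrt_increment_ratio ?A (M - j)) \<le> (\<Sum>j=1..M'-1. (tail x (j-1) - tail x j) / (4 * tail x j))"
  proof (intro sum_mono)
    fix j assume j: "j \<in> {1..M'-1}"
    then have "M - (M - j) = j" "M - Suc (M - j) = j - 1" "M - j < M" using M' by auto
    then show "sqrt_increment_ratio ?A (M - j) \<le> (tail x (j-1) - tail x j) / (4 * tail x j)"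
      using sqrt_increment_ratio_le_quarter[of ?A "M - j"] pos[of j] inc[of "M - j"] j by auto
  qed
  finally have "(\<Sum>i<M. sqrt_increment_ratio ?A i) \<le> 1 + (\<Sum>j=1..M'-1. (tail x (j-1) - tail x j) / (4 * tail x j))"
    by simp
  moreover have "0 \<le> (\<Sum>j=1..M-1. (real (k (j+1)) - real (k j)) / (4 * real (k j)))"
  proof (intro sum_nonneg)
    fix j assume "j \<in> {1..M-1}"
    then have "j < M" using M_pos by auto
    then show "0 \<le> (real (k (j+1)) - real (k j)) / (4 * real (k j))" using k_less[of j] by simp
  qed
  ultimately show "(\<Sum>i<M. sqrt_increment_ratio ?A i) \<le>
     1 + (\<Sum>j=1..M-1. (real (k (j+1)) - real (k j)) / (4 * real (k j)))
        + (\<Sum>j=1..(LEAST j. 1 \<le> j \<and> j \<le> M \<and> tail x j = 0) - 1. (tail x (j-1) - tail x j) / (4 * tail x j))"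
    unfolding M'_def by linarith
qed

lemma noise_sum_bound:
  assumes h: "\<And>i. Suc i < M \<Longrightarrow> h (Suc i) \<le> h i" "\<And>i. i < M \<Longrightarrow> 0 \<le> h i"
    and u: "\<And>j. 1 \<le> j \<Longrightarrow> j \<le> M \<Longrightarrow> \<bar>\<Sum>l<k j. u l\<bar> \<le> W * sqrt (real (k j))" and W: "0 \<le> W"
    and \<Psi>: "(\<Sum>i<M. sqrt_increment_ratio (\<lambda>j. real (k j)) i) \<le> \<Psi>"
  shows "\<bar>\<Sum>j<M. h j * (\<Sum>l\<in>{k j..<k (Suc j)}. u l)\<bar>
    \<le> W * sqrt \<Psi> * sqrt (\<Sum>j<M. (h j)\<^sup>2 * (real (k (Suc j)) - real (k j)))"
proof -
  have "\<bar>\<Sum>j<M. h j * (\<Sum>l\<in>{k j..<k (Suc j)}. u l)\<bar>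
    \<le> W * sqrt (\<Sum>i<M. sqrt_increment_ratio (\<lambda>j. real (k j)) i) * sqrt (\<Sum>j<M. (h j)\<^sup>2 * (real (k (Suc j)) - real (k j)))"
  proof (rule abel_cauchy_schwarz)
    show "\<bar>\<Sum>i<j. \<Sum>l\<in>{k i..<k (Suc i)}. u l\<bar> \<le> W * sqrt (real (k j))" if "j \<le> M" for j
      using u[of j] that by (cases "j = 0") (auto simp: sum_blocks k_0)
  qed (use h W k_0 k_less in \<open>auto intro: less_imp_le\<close>)
  also have "\<dots> \<le> W * sqrt \<Psi> * sqrt (\<Sum>j<M. (h j)\<^sup>2 * (real (k (Suc j)) - real (k j)))"
    using W \<Psi> k_less by (intro mult_right_mono mult_left_mono real_sqrt_le_mono) (auto intro!: sum_nonneg simp: less_imp_le)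
  finally show ?thesis .
qed

text \<open>Reversing the order of the blocks makes nondecreasing weights nonincreasing and turns
  tails into partial sums, so that \<open>abel_cauchy_schwarz\<close> applies.\<close>

lemma bias_sum_bound:
  assumes h: "\<And>i. Suc i < M \<Longrightarrow> h i \<le> h (Suc i)" "\<And>i. i < M \<Longrightarrow> 0 \<le> h i"
    and v: "\<And>j. j < M \<Longrightarrow> \<bar>tail v j\<bar> \<le> W * sqrt (tail x j)" and W: "0 \<le> W"
    and x: "\<And>l. 0 \<le> x l"
    and \<Psi>: "(\<Sum>i<M. sqrt_increment_ratio (\<lambda>j. tail x (M - j)) i) \<le> \<Psi>"
  shows "\<bar>\<Sum>j<M. h j * (\<Sum>l\<in>{k j..<k (Suc j)}. v l)\<bar>
    \<le> W * sqrt \<Psi> * sqrt (\<Sum>j<M. (h j)\<^sup>2 * (\<Sum>l\<in>{k j..<k (Suc j)}. x l))"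
proof -
  let ?blk = "\<lambda>y j. (\<Sum>l\<in>{k j..<k (Suc j)}. y l)"
  have part: "(\<Sum>i<j. ?blk y (M - Suc i)) = tail y (M - j)" if "j \<le> M" for j and y :: "nat \<Rightarrow> real"
    using that
  proof (induction j)
    case (Suc j)
    then show ?case using tail_Suc[of "M - Suc j" y] by (simp add: Suc_diff_Suc)
  qed (simp add: tail_M)
  have blkx: "tail x (M - Suc i) - tail x (M - i) = ?blk x (M - Suc i)" if "i < M" for i
    using tail_Suc[of "M - Suc i" x] that by (simp add: Suc_diff_Suc)
  have "\<bar>\<Sum>j<M. h j * ?blk v j\<bar> = \<bar>\<Sum>j<M. h (M - Suc j) * ?blk v (M - Suc j)\<bar>"
    by (subst sum.nat_diff_reindex[symmetric]) simp
  also have "\<dots> \<le> W * sqrt (\<Sum>i<M. sqrt_increment_ratio (\<lambda>j. tail x (M - j)) i)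
      * sqrt (\<Sum>j<M. (h (M - Suc j))\<^sup>2 * (tail x (M - Suc j) - tail x (M - j)))"
  proof (rule abel_cauchy_schwarz)
    show "h (M - Suc (Suc i)) \<le> h (M - Suc i)" if "Suc i < M" for i
      using h(1)[of "M - Suc (Suc i)"] that by (simp add: Suc_diff_Suc)
    show "tail x (M - i) \<le> tail x (M - Suc i)" if "i < M" for i
      using blkx[OF that] x sum_nonneg[of "{k (M - Suc i)..<k (Suc (M - Suc i))}" x] by simp
    show "\<bar>\<Sum>i<j. ?blk v (M - Suc i)\<bar> \<le> W * sqrt (tail x (M - j))" if "j \<le> M" for j
      unfolding part[OF that] using v[of "M - j"] that by (cases "j = 0") (auto simp: tail_M)
  qed (use h W in \<open>auto simp: tail_M\<close>)
  also have "(\<Sum>j<M. (h (M - Suc j))\<^sup>2 * (tail x (M - Suc j) - tail x (M - j)))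
      = (\<Sum>j<M. (h (M - Suc j))\<^sup>2 * ?blk x (M - Suc j))"
    by (intro sum.cong refl) (simp add: blkx)
  also have "\<dots> = (\<Sum>j<M. (h j)\<^sup>2 * ?blk x j)" by (rule sum.nat_diff_reindex)
  also have "W * sqrt (\<Sum>i<M. sqrt_increment_ratio (\<lambda>j. tail x (M - j)) i) * sqrt (\<Sum>j<M. (h j)\<^sup>2 * ?blk x j)
      \<le> W * sqrt \<Psi> * sqrt (\<Sum>j<M. (h j)\<^sup>2 * ?blk x j)"
    using W \<Psi> x by (intro mult_right_mono mult_left_mono real_sqrt_le_mono)
      (auto intro!: sum_nonneg mult_nonneg_nonneg)
  finally show ?thesis .
qed

end

section \<open>The oracle inequality for blockwise weights\<close>

lemma abs_le_sqrt_multI: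
  assumes "\<bar>x\<bar> \<le> V * sqrt s" "0 \<le> V" "V\<^sup>2 * s \<le> y" "0 \<le> s"
  shows "\<bar>x\<bar> \<le> sqrt (y::real)"
proof (rule real_le_rsqrt)
  have "\<bar>x\<bar>\<^sup>2 \<le> (V * sqrt s)\<^sup>2" using assms by (intro power_mono) auto
  then show "\<bar>x\<bar>\<^sup>2 \<le> y" using assms by (simp add: power_mult_distrib)
qed

lemma sqrt_mult_le_weighted:
  assumes "0 \<le> H" "0 \<le> r" "0 < (\<eta>::real)"
  shows "a * sqrt (H * r) \<le> \<eta> * r + a\<^sup>2 * H / (4 * \<eta>)"
proof -
  let ?x = "sqrt (\<eta> * r)" and ?y = "a * sqrt (H / \<eta>) / 2"
  have "sqrt (\<eta> * r) * sqrt (H / \<eta>) = sqrt (H * r)"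
    unfolding real_sqrt_mult[symmetric] using assms by (simp add: mult.commute)
  then have "2 * ?x * ?y = a * sqrt (H * r)" by (simp add: mult.left_commute)
  moreover have "?x\<^sup>2 = \<eta> * r" "?y\<^sup>2 = a\<^sup>2 * H / (4 * \<eta>)"
    using assms by (simp_all add: power_mult_distrib power_divide)
  ultimately show ?thesis using sum_squares_bound[of ?x ?y] by (simp only:)
qed

text \<open>The deterministic core for one outcome. Per block, \<alpha> is the signal energy,
  \<open>c\<close> the product of signal and noise, \<open>u\<close> the centred noise energy and
  \<open>d\<close> the dimension. \<open>H\<close> dominates both the square of \<open>V\<close> and
  that square divided by \<open>s2\<close>, since the noise bound is measured against
  \<open>d\<close>, while the risk contains \<open>s2 * d\<close>.\<close>

locale mallows_blocks =
  fixes M :: nat and \<alpha> c u d :: "nat \<Rightarrow> real" and s2 V H :: real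
  assumes \<alpha>: "\<And>j. j < M \<Longrightarrow> 0 \<le> \<alpha> j" and d: "\<And>j. j < M \<Longrightarrow> 0 \<le> d j" and s2: "0 < s2"
    and V: "0 \<le> V" "V\<^sup>2 \<le> H" "V\<^sup>2 \<le> s2 * H"
    and noise: "\<And>h. (\<And>i. Suc i < M \<Longrightarrow> h (Suc i) \<le> h i) \<Longrightarrow> (\<And>i. i < M \<Longrightarrow> 0 \<le> h i) \<Longrightarrow>
      \<bar>\<Sum>j<M. h j * u j\<bar> \<le> V * sqrt (\<Sum>j<M. (h j)\<^sup>2 * d j)"
    and bias: "\<And>h. (\<And>i. Suc i < M \<Longrightarrow> h i \<le> h (Suc i)) \<Longrightarrow> (\<And>i. i < M \<Longrightarrow> 0 \<le> h i) \<Longrightarrow>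
      \<bar>\<Sum>j<M. h j * c j\<bar> \<le> V * sqrt (\<Sum>j<M. (h j)\<^sup>2 * \<alpha> j)"
begin

definition energy :: "nat \<Rightarrow> real" where "energy j = \<alpha> j + 2 * c j + u j + s2 * d j"

definition risk :: "(nat \<Rightarrow> real) \<Rightarrow> real" where
  "risk g = (\<Sum>j<M. (1 - g j)\<^sup>2 * \<alpha> j + s2 * ((g j)\<^sup>2 * d j))"

definition loss :: "(nat \<Rightarrow> real) \<Rightarrow> real" where
  "loss g = (\<Sum>j<M. (g j)\<^sup>2 * energy j - 2 * g j * (\<alpha> j + c j) + \<alpha> j)"

text \<open>Mallows' criterion times the sample size, without the squared norm of the observation,
  which is the same for all weights.\<close>

definition crit :: "real \<Rightarrow> (nat \<Rightarrow> real) \<Rightarrow> real" where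
  "crit s g = (\<Sum>j<M. ((g j)\<^sup>2 - 2 * g j) * energy j + 2 * s * (g j * d j))"

definition admissible :: "(nat \<Rightarrow> real) \<Rightarrow> bool" where
  "admissible g \<longleftrightarrow> (\<forall>i<M. 0 \<le> g i \<and> g i \<le> 1) \<and> (\<forall>i. Suc i < M \<longrightarrow> g (Suc i) \<le> g i)"

lemma risk_split: "risk g = (\<Sum>j<M. (1 - g j)\<^sup>2 * \<alpha> j) + s2 * (\<Sum>j<M. (g j)\<^sup>2 * d j)"
  by (simp add: risk_def sum.distrib sum_distrib_left)

lemma risk_parts:
  shows risk_nonneg: "0 \<le> risk g"
    and bias_le_risk: "(\<Sum>j<M. (1 - g j)\<^sup>2 * \<alpha> j) \<le> risk g"
    and variance_le_risk: "s2 * (\<Sum>j<M. (g j)\<^sup>2 * d j) \<le> risk g"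
proof -
  have "0 \<le> (\<Sum>j<M. (1 - g j)\<^sup>2 * \<alpha> j)" "0 \<le> s2 * (\<Sum>j<M. (g j)\<^sup>2 * d j)"
    using \<alpha> d s2 by (auto intro!: sum_nonneg mult_nonneg_nonneg)
  then show "0 \<le> risk g" "(\<Sum>j<M. (1 - g j)\<^sup>2 * \<alpha> j) \<le> risk g" "s2 * (\<Sum>j<M. (g j)\<^sup>2 * d j) \<le> risk g"
    unfolding risk_split by auto
qed

lemma H_nonneg: "0 \<le> H"
  using V(2) order_trans zero_le_power2 by blast

lemma square_le_self_01: "0 \<le> x \<Longrightarrow> x \<le> 1 \<Longrightarrow> (x\<^sup>2)\<^sup>2 \<le> (x::real)\<^sup>2"
  using power_decreasing[of 2 4 x] by (simp add: power_mult[symmetric])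

text \<open>Stated for any \<open>h\<close> dominated by \<open>g\<close>, since both the cumulative
  weights and their squares occur; on [0,1] squaring preserves monotonicity and decreases the
  values.\<close>

lemma noise_le:
  assumes "\<And>i. Suc i < M \<Longrightarrow> h (Suc i) \<le> h i" "\<And>i. i < M \<Longrightarrow> 0 \<le> h i"
    and le: "\<And>i. i < M \<Longrightarrow> (h i)\<^sup>2 \<le> (g i)\<^sup>2"
  shows "\<bar>\<Sum>j<M. h j * u j\<bar> \<le> sqrt (H * risk g)"
proof (rule abs_le_sqrt_multI[OF noise[where h=h] V(1)])
  have le': "(\<Sum>j<M. (h j)\<^sup>2 * d j) \<le> (\<Sum>j<M. (g j)\<^sup>2 * d j)"
    using le d by (intro sum_mono mult_right_mono) auto
  show nn: "0 \<le> (\<Sum>j<M. (h j)\<^sup>2 * d j)" using d by (auto intro!: sum_nonneg mult_nonneg_nonneg)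
  have "V\<^sup>2 * (\<Sum>j<M. (h j)\<^sup>2 * d j) \<le> (s2 * H) * (\<Sum>j<M. (g j)\<^sup>2 * d j)"
    using V le' nn by (intro mult_mono) (auto intro: order_trans[OF zero_le_power2])
  also have "\<dots> = H * (s2 * (\<Sum>j<M. (g j)\<^sup>2 * d j))" by simp
  also have "\<dots> \<le> H * risk g" by (intro mult_left_mono variance_le_risk H_nonneg)
  finally show "V\<^sup>2 * (\<Sum>j<M. (h j)\<^sup>2 * d j) \<le> H * risk g" .
qed (use assms in auto)

lemma bias_le:
  assumes "\<And>i. Suc i < M \<Longrightarrow> h i \<le> h (Suc i)" "\<And>i. i < M \<Longrightarrow> 0 \<le> h i"
    and le: "\<And>i. i < M \<Longrightarrow> (h i)\<^sup>2 \<le> (1 - g i)\<^sup>2"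
  shows "\<bar>\<Sum>j<M. h j * c j\<bar> \<le> sqrt (H * risk g)"
proof (rule abs_le_sqrt_multI[OF bias[where h=h] V(1)])
  have le': "(\<Sum>j<M. (h j)\<^sup>2 * \<alpha> j) \<le> (\<Sum>j<M. (1 - g j)\<^sup>2 * \<alpha> j)"
    using le \<alpha> by (intro sum_mono mult_right_mono) auto
  show nn: "0 \<le> (\<Sum>j<M. (h j)\<^sup>2 * \<alpha> j)" using \<alpha> by (auto intro!: sum_nonneg mult_nonneg_nonneg)
  show "V\<^sup>2 * (\<Sum>j<M. (h j)\<^sup>2 * \<alpha> j) \<le> H * risk g"
    using V(2) order_trans[OF le' bias_le_risk] nn H_nonneg by (intro mult_mono) auto
qed (use assms in auto)

lemma admissible_bounds:
  assumes g: "admissible g"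
  shows "\<bar>\<Sum>j<M. g j * u j\<bar> \<le> sqrt (H * risk g)" "\<bar>\<Sum>j<M. (g j)\<^sup>2 * u j\<bar> \<le> sqrt (H * risk g)"
    "\<bar>\<Sum>j<M. (1 - g j) * c j\<bar> \<le> sqrt (H * risk g)" "\<bar>\<Sum>j<M. (1 - g j)\<^sup>2 * c j\<bar> \<le> sqrt (H * risk g)"
proof -
  have 01: "0 \<le> g i" "g i \<le> 1" if "i < M" for i using g that by (auto simp: admissible_def)
  have dec: "g (Suc i) \<le> g i" if "Suc i < M" for i using g that by (auto simp: admissible_def)
  show "\<bar>\<Sum>j<M. g j * u j\<bar> \<le> sqrt (H * risk g)" using 01 dec by (intro noise_le) auto
  show "\<bar>\<Sum>j<M. (g j)\<^sup>2 * u j\<bar> \<le> sqrt (H * risk g)"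
    using 01 dec by (intro noise_le square_le_self_01 power_mono) auto
  show "\<bar>\<Sum>j<M. (1 - g j) * c j\<bar> \<le> sqrt (H * risk g)" using 01 dec by (intro bias_le) auto
  show "\<bar>\<Sum>j<M. (1 - g j)\<^sup>2 * c j\<bar> \<le> sqrt (H * risk g)"
    using 01 dec by (intro bias_le square_le_self_01 power_mono) auto
qed

text \<open>Cauchy-Schwarz with the root of \<open>d\<close> split off: the estimation error meets
  the total dimension, and the remaining factor is the variance part of the risk.\<close>

lemma variance_error_le:
  assumes s: "(s - s2)\<^sup>2 * (\<Sum>j<M. d j) \<le> s2 * H"
  shows "\<bar>(s - s2) * (\<Sum>j<M. g j * d j)\<bar> \<le> sqrt (H * risk g)"
proof (rule real_le_rsqrt)
  have "(\<Sum>j<M. g j * d j) = (\<Sum>j<M. sqrt (d j) * (g j * sqrt (d j)))"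
    using d by (intro sum.cong) auto
  also have "(\<dots>)\<^sup>2 \<le> (\<Sum>j<M. (sqrt (d j))\<^sup>2) * (\<Sum>j<M. (g j * sqrt (d j))\<^sup>2)"
    by (rule Cauchy_Schwarz_ineq_sum)
  also have "(\<Sum>j<M. (sqrt (d j))\<^sup>2) = (\<Sum>j<M. d j)" using d by (intro sum.cong) auto
  also have "(\<Sum>j<M. (g j * sqrt (d j))\<^sup>2) = (\<Sum>j<M. (g j)\<^sup>2 * d j)"
    using d by (intro sum.cong) (auto simp: power_mult_distrib)
  finally have cs: "(\<Sum>j<M. g j * d j)\<^sup>2 \<le> (\<Sum>j<M. d j) * (\<Sum>j<M. (g j)\<^sup>2 * d j)" .
  have "\<bar>(s - s2) * (\<Sum>j<M. g j * d j)\<bar>\<^sup>2 = (s - s2)\<^sup>2 * (\<Sum>j<M. g j * d j)\<^sup>2"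
    by (simp add: power_mult_distrib)
  also have "\<dots> \<le> (s - s2)\<^sup>2 * ((\<Sum>j<M. d j) * (\<Sum>j<M. (g j)\<^sup>2 * d j))"
    using cs by (intro mult_left_mono) auto
  also have "\<dots> = ((s - s2)\<^sup>2 * (\<Sum>j<M. d j)) * (\<Sum>j<M. (g j)\<^sup>2 * d j)" by simp
  also have "\<dots> \<le> (s2 * H) * (\<Sum>j<M. (g j)\<^sup>2 * d j)"
    using s d by (intro mult_right_mono) (auto intro!: sum_nonneg mult_nonneg_nonneg)
  also have "\<dots> = H * (s2 * (\<Sum>j<M. (g j)\<^sup>2 * d j))" by simp
  also have "\<dots> \<le> H * risk g" by (intro mult_left_mono variance_le_risk H_nonneg)
  finally show "\<bar>(s - s2) * (\<Sum>j<M. g j * d j)\<bar>\<^sup>2 \<le> H * risk g" .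
qed

lemma loss_minus_risk:
  "loss g - risk g = (\<Sum>j<M. (g j)\<^sup>2 * u j) - 2 * (\<Sum>j<M. (1 - g j) * c j) + 2 * (\<Sum>j<M. (1 - g j)\<^sup>2 * c j)"
  unfolding loss_def risk_def sum_distrib_left sum_subtractf[symmetric] sum.distrib[symmetric]
  by (intro sum.cong refl) (simp add: energy_def algebra_simps power2_eq_square)

text \<open>The first sum on the right does not involve \<open>g\<close> and cancels when two weight
  vectors are compared; all other terms are controlled linear forms.\<close>

lemma crit_minus_loss:
  "crit s g - loss g = - (\<Sum>j<M. \<alpha> j + 2 * c j) + 2 * (\<Sum>j<M. (1 - g j) * c j)
     - 2 * (\<Sum>j<M. g j * u j) + 2 * ((s - s2) * (\<Sum>j<M. g j * d j))"
  unfolding loss_def crit_def sum_distrib_left sum_subtractf[symmetric] sum.distrib[symmetric] sum_negf[symmetric]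
  by (intro sum.cong refl) (simp add: energy_def algebra_simps power2_eq_square)

lemma oracle_inequality:
  assumes g: "admissible g" and g0: "admissible g0" and le: "crit s g \<le> crit s g0"
    and s: "(s - s2)\<^sup>2 * (\<Sum>j<M. d j) \<le> s2 * H" and \<eta>: "0 < \<eta>" "\<eta> \<le> 1/2"
  shows "risk g \<le> (1 + 7 * \<eta>) * risk g0 + 200 * H / \<eta>" "loss g \<le> (1 + 7 * \<eta>) * risk g0 + 200 * H / \<eta>"
proof -
  let ?K = "- (\<Sum>j<M. \<alpha> j + 2 * c j)"
  \<comment> \<open>11 = 5 + 6: the coefficients in \<open>loss_minus_risk\<close> add up to 5 in
    absolute value, those in \<open>crit_minus_loss\<close>, the constant aside, to 6.\<close>
  have dev: "\<bar>crit s g - risk g - ?K\<bar> \<le> 11 * sqrt (H * risk g)" if g: "admissible g" for g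
    using crit_minus_loss[of s g] loss_minus_risk[of g] admissible_bounds[OF g] variance_error_le[OF s, of g]
    by linarith
  have ld: "\<bar>loss g - risk g\<bar> \<le> 5 * sqrt (H * risk g)"
    using loss_minus_risk[of g] admissible_bounds[OF g] by linarith
  have "risk g \<le> risk g0 + 11 * sqrt (H * risk g0) + 11 * sqrt (H * risk g)"
    using dev[OF g] dev[OF g0] le by linarith
  also have "11 * sqrt (H * risk g0) \<le> \<eta> * risk g0 + 11\<^sup>2 * H / (4 * \<eta>)"
    by (intro sqrt_mult_le_weighted H_nonneg risk_nonneg \<eta>)
  also have "11 * sqrt (H * risk g) \<le> \<eta> * risk g + 11\<^sup>2 * H / (4 * \<eta>)"
    by (intro sqrt_mult_le_weighted H_nonneg risk_nonneg \<eta>)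
  finally have "(1 - \<eta>) * risk g \<le> (1 + \<eta>) * risk g0 + 121/2 * (H / \<eta>)"
    by (simp add: algebra_simps)
  \<comment> \<open>The factor 1 - \<eta> is extracted in order to be cancelled; \<eta> \<le> 1/2
    gives 1 + \<eta> \<le> (1 - \<eta>)(1 + 4 \<eta>) and 1/2 \<le> 1 - \<eta>.\<close>
  also have "\<dots> \<le> (1 - \<eta>) * ((1 + 4 * \<eta>) * risk g0 + 121 * (H / \<eta>))"
  proof -
    have "0 \<le> (2 * \<eta> - 4 * \<eta>\<^sup>2)"
      using \<eta> mult_left_mono[of \<eta> "1/2" \<eta>] by (simp add: power2_eq_square)
    then have "(1 + \<eta>) * risk g0 \<le> ((1 - \<eta>) * (1 + 4 * \<eta>)) * risk g0"
      by (intro mult_right_mono risk_nonneg) (simp add: algebra_simps power2_eq_square)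
    moreover have "121/2 * (H / \<eta>) \<le> (1 - \<eta>) * 121 * (H / \<eta>)"
      using \<eta> H_nonneg by (intro mult_right_mono) auto
    ultimately have "(1 + \<eta>) * risk g0 + 121/2 * (H / \<eta>)
        \<le> ((1 - \<eta>) * (1 + 4 * \<eta>)) * risk g0 + (1 - \<eta>) * 121 * (H / \<eta>)" by (rule add_mono)
    then show ?thesis by (simp only: distrib_left[of "1 - \<eta>" "(1 + 4 * \<eta>) * risk g0"] mult.assoc)
  qed
  finally have r: "risk g \<le> (1 + 4 * \<eta>) * risk g0 + 121 * (H / \<eta>)"
    using \<eta> by (simp add: mult_le_cancel_left_pos)
  have H\<eta>: "0 \<le> H / \<eta>" using \<eta> H_nonneg by simp
  have rg0: "0 \<le> \<eta> * risk g0" using \<eta> risk_nonneg by simp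
  show "risk g \<le> (1 + 7 * \<eta>) * risk g0 + 200 * H / \<eta>"
  proof -
    have "(1 + 4 * \<eta>) * risk g0 \<le> (1 + 7 * \<eta>) * risk g0"
      using \<eta> by (intro mult_right_mono risk_nonneg) auto
    moreover have "121 * (H / \<eta>) \<le> 200 * (H / \<eta>)" using H\<eta> by (intro mult_right_mono) auto
    ultimately have "risk g \<le> (1 + 7 * \<eta>) * risk g0 + 200 * (H / \<eta>)" using r by linarith
    then show ?thesis by simp
  qed
  have "loss g \<le> risk g + 5 * sqrt (H * risk g)" using ld by linarith
  also have "5 * sqrt (H * risk g) \<le> \<eta> * risk g + 5\<^sup>2 * H / (4 * \<eta>)"
    by (intro sqrt_mult_le_weighted H_nonneg risk_nonneg \<eta>)
  finally have "loss g \<le> (1 + \<eta>) * risk g + 25/4 * (H / \<eta>)" by (simp add: algebra_simps)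
  also have "(1 + \<eta>) * risk g \<le> (1 + \<eta>) * ((1 + 4 * \<eta>) * risk g0 + 121 * (H / \<eta>))"
    using r \<eta> by (intro mult_left_mono) auto
  also have "\<dots> = ((1 + \<eta>) * (1 + 4 * \<eta>)) * risk g0 + (1 + \<eta>) * (121 * (H / \<eta>))"
    by (simp add: algebra_simps)
  \<comment> \<open>The product exceeds 1 by 5 \<eta> plus four times the square of \<eta>, hence by
    at most 7 \<eta>. The constant 200 leaves room for 121 * 3/2 + 25/4.\<close>
  also have "((1 + \<eta>) * (1 + 4 * \<eta>)) * risk g0 \<le> (1 + 7 * \<eta>) * risk g0"
    using \<eta> mult_left_mono[of \<eta> "1/2" \<eta>] by (intro mult_right_mono risk_nonneg) (simp add: algebra_simps)
  also have "(1 + \<eta>) * (121 * (H / \<eta>)) \<le> (3/2) * (121 * (H / \<eta>))"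
    using \<eta> H\<eta> by (intro mult_right_mono) auto
  finally show "loss g \<le> (1 + 7 * \<eta>) * risk g0 + 200 * H / \<eta>" using H\<eta> by simp
qed

end

text \<open>Grouping: a block takes the cumulative weight at its first index, so only the variance grows,
  and the variance of a block is compared with that of the preceding, almost equally long, block.\<close>

lemma (in nested_blocks) grouped_risk_le:
  fixes a g :: "nat \<Rightarrow> real"
  assumes g: "\<And>l. Suc l < k M \<Longrightarrow> g (Suc l) \<le> g l" "\<And>l. l < k M \<Longrightarrow> 0 \<le> g l \<and> g l \<le> 1"
    and ratio: "\<And>j. 1 \<le> j \<Longrightarrow> j < M \<Longrightarrow> real (k (Suc j)) - real (k j) \<le> (1 + \<zeta>) * (real (k j) - real (k (j - 1)))"
    and \<zeta>: "0 \<le> \<zeta>" and s2: "0 \<le> s2"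
  shows "(\<Sum>j<M. (1 - g (k j))\<^sup>2 * (\<Sum>l\<in>{k j..<k (Suc j)}. (a l)\<^sup>2) + s2 * ((g (k j))\<^sup>2 * (real (k (Suc j)) - real (k j))))
    \<le> (1 + \<zeta>) * (\<Sum>l<k M. (1 - g l)\<^sup>2 * (a l)\<^sup>2 + s2 * (g l)\<^sup>2) + s2 * real (k 1)"
proof -
  have mono: "g l \<le> g i" if "i \<le> l" "l < k M" for i l
    using that
  proof (induction l)
    case (Suc l)
    then show ?case using g(1)[of l] by (cases "i = Suc l") auto
  qed simp
  have lt: "k j < k M" if "j < M" for j using k_mono[of "Suc j" M] k_less[OF that] that by simp
  have inM: "l < k M" if "j < M" "l < k (Suc j)" for j l using k_mono[of "Suc j" M] that by simp
  have "(\<Sum>j<M. (1 - g (k j))\<^sup>2 * (\<Sum>l\<in>{k j..<k (Suc j)}. (a l)\<^sup>2))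
      \<le> (\<Sum>j<M. \<Sum>l\<in>{k j..<k (Suc j)}. (1 - g l)\<^sup>2 * (a l)\<^sup>2)"
    unfolding sum_distrib_left
  proof (intro sum_mono mult_right_mono power_mono)
    fix j l assume "j \<in> {..<M}" "l \<in> {k j..<k (Suc j)}"
    then show "1 - g (k j) \<le> 1 - g l" "0 \<le> 1 - g (k j)"
      using mono[of "k j" l] g(2)[of "k j"] lt[of j] inM[of j l] by auto
  qed auto
  also have "\<dots> = (\<Sum>l<k M. (1 - g l)\<^sup>2 * (a l)\<^sup>2)" by (rule sum_blocks) simp
  finally have bias: "(\<Sum>j<M. (1 - g (k j))\<^sup>2 * (\<Sum>l\<in>{k j..<k (Suc j)}. (a l)\<^sup>2)) \<le> (\<Sum>l<k M. (1 - g l)\<^sup>2 * (a l)\<^sup>2)" .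
  \<comment> \<open>The first block has no predecessor to be compared with. It is bounded by its
    length \<open>k 1\<close>, the origin of the additive term.\<close>
  have "(\<Sum>j<M. (g (k j))\<^sup>2 * (real (k (Suc j)) - real (k j)))
      = (g 0)\<^sup>2 * real (k 1) + (\<Sum>j<M - 1. (g (k (Suc j)))\<^sup>2 * (real (k (Suc (Suc j))) - real (k (Suc j))))"
    using M_pos sum.lessThan_Suc_shift[of "\<lambda>j. (g (k j))\<^sup>2 * (real (k (Suc j)) - real (k j))" "M - 1"] k_0 by simp
  also have "(g 0)\<^sup>2 * real (k 1) \<le> real (k 1)"
    using g(2)[of 0] lt[of 0] M_pos by (intro mult_left_le_one_le) (auto simp: power_le_one)
  also have "(\<Sum>j<M - 1. (g (k (Suc j)))\<^sup>2 * (real (k (Suc (Suc j))) - real (k (Suc j))))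
      \<le> (\<Sum>j<M - 1. (1 + \<zeta>) * (\<Sum>l\<in>{k j..<k (Suc j)}. (g l)\<^sup>2))"
  proof (rule sum_mono)
    fix j assume "j \<in> {..<M - 1}"
    then have j: "Suc j < M" "j < M" by auto
    have "(g (k (Suc j)))\<^sup>2 * (real (k (Suc (Suc j))) - real (k (Suc j)))
       \<le> (g (k (Suc j)))\<^sup>2 * ((1 + \<zeta>) * (real (k (Suc j)) - real (k j)))"
      using ratio[of "Suc j"] j by (intro mult_left_mono) auto
    also have "\<dots> = (1 + \<zeta>) * (\<Sum>l\<in>{k j..<k (Suc j)}. (g (k (Suc j)))\<^sup>2)"
      using k_less[of j] j by (simp add: of_nat_diff)
    also have "\<dots> \<le> (1 + \<zeta>) * (\<Sum>l\<in>{k j..<k (Suc j)}. (g l)\<^sup>2)"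
      using mono lt[OF j(1)] g(2) \<zeta> by (intro mult_left_mono sum_mono power_mono) auto
    finally show "(g (k (Suc j)))\<^sup>2 * (real (k (Suc (Suc j))) - real (k (Suc j)))
       \<le> (1 + \<zeta>) * (\<Sum>l\<in>{k j..<k (Suc j)}. (g l)\<^sup>2)" .
  qed
  also have "\<dots> = (1 + \<zeta>) * (\<Sum>l<k (M - 1). (g l)\<^sup>2)"
    unfolding sum_distrib_left[symmetric] by (subst sum_blocks) auto
  also have "\<dots> \<le> (1 + \<zeta>) * (\<Sum>l<k M. (g l)\<^sup>2)"
    using k_mono[of "M - 1" M] \<zeta> by (intro mult_left_mono sum_mono2) auto
  finally have var: "(\<Sum>j<M. (g (k j))\<^sup>2 * (real (k (Suc j)) - real (k j)))
      \<le> real (k 1) + (1 + \<zeta>) * (\<Sum>l<k M. (g l)\<^sup>2)" by simp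
  have "0 \<le> \<zeta> * (\<Sum>l<k M. (1 - g l)\<^sup>2 * (a l)\<^sup>2)" using \<zeta> by (auto intro!: sum_nonneg mult_nonneg_nonneg)
  moreover have "s2 * (\<Sum>j<M. (g (k j))\<^sup>2 * (real (k (Suc j)) - real (k j)))
      \<le> s2 * real (k 1) + (1 + \<zeta>) * (s2 * (\<Sum>l<k M. (g l)\<^sup>2))"
    using mult_left_mono[OF var s2] by (simp add: algebra_simps)
  moreover have "(1 + \<zeta>) * (\<Sum>l<k M. (1 - g l)\<^sup>2 * (a l)\<^sup>2)
      = (\<Sum>l<k M. (1 - g l)\<^sup>2 * (a l)\<^sup>2) + \<zeta> * (\<Sum>l<k M. (1 - g l)\<^sup>2 * (a l)\<^sup>2)"
    by (simp only: distrib_right mult_1)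
  ultimately show ?thesis
    using bias unfolding sum.distrib sum_distrib_left[of s2, symmetric] distrib_left by linarith
qed

section \<open>Orthonormal bases of nested column spaces\<close>

text \<open>Truncation at n is moved into the spanning vectors, so that column spaces and spans of
  basis vectors become the same kind of object.\<close>

definition lspan :: "(nat \<Rightarrow> nat \<Rightarrow> real) \<Rightarrow> nat \<Rightarrow> (nat \<Rightarrow> real) set" where
  "lspan e j = {v. \<exists>c. \<forall>i. v i = (\<Sum>l<j. c l * e l i)}"

lemma lspan_cong: "(\<And>l. l < j \<Longrightarrow> e l = e' l) \<Longrightarrow> lspan e j = lspan e' j"
  by (auto simp: lspan_def intro!: sum.cong)

lemma lspan_add: "u \<in> lspan e j \<Longrightarrow> v \<in> lspan e j \<Longrightarrow> (\<lambda>i. u i + t * v i) \<in> lspan e j"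
proof -
  assume "u \<in> lspan e j" "v \<in> lspan e j"
  then obtain c d where "\<And>i. u i = (\<Sum>l<j. c l * e l i)" "\<And>i. v i = (\<Sum>l<j. d l * e l i)"
    by (auto simp: lspan_def)
  then have "\<forall>i. u i + t * v i = (\<Sum>l<j. (c l + t * d l) * e l i)"
    by (simp add: sum.distrib sum_distrib_left algebra_simps)
  then show ?thesis by (auto simp: lspan_def)
qed

lemma lspan_Suc: "v \<in> lspan e (Suc j) \<longleftrightarrow> (\<exists>u\<in>lspan e j. \<exists>t. v = (\<lambda>i. u i + t * e j i))"
proof
  assume "v \<in> lspan e (Suc j)"
  then obtain c where c: "\<And>i. v i = (\<Sum>l<Suc j. c l * e l i)" by (auto simp: lspan_def)
  then have "v = (\<lambda>i. (\<Sum>l<j. c l * e l i) + c j * e j i)" by auto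
  then show "\<exists>u\<in>lspan e j. \<exists>t. v = (\<lambda>i. u i + t * e j i)"
    by (intro bexI[of _ "\<lambda>i. \<Sum>l<j. c l * e l i"]) (auto simp: lspan_def)
next
  assume "\<exists>u\<in>lspan e j. \<exists>t. v = (\<lambda>i. u i + t * e j i)"
  then obtain c t where c: "\<And>i. v i = (\<Sum>l<j. c l * e l i) + t * e j i" by (auto simp: lspan_def)
  have "\<forall>i. v i = (\<Sum>l<Suc j. (c(j := t)) l * e l i)" unfolding c by simp
  then show "v \<in> lspan e (Suc j)" unfolding lspan_def by blast
qed

lemma colspan_eq_lspan: "colspan n X j = lspan (\<lambda>l i. if i < n then X i l else 0) j"
proof -
  have "(\<Sum>l<j. c l * (if i < n then X i l else 0)) = (if i < n then \<Sum>l<j. c l * X i l else 0)" for c i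
    by (cases "i < n") auto
  then show ?thesis unfolding colspan_def lspan_def by auto
qed

definition orthonormal :: "nat \<Rightarrow> (nat \<Rightarrow> nat \<Rightarrow> real) \<Rightarrow> nat \<Rightarrow> bool" where
  "orthonormal n e p \<longleftrightarrow> (\<forall>l<p. \<forall>m<p. ip n (e l) (e m) = (if l = m then 1 else 0))"

lemma ip_sum_left: "ip n (\<lambda>i. \<Sum>l\<in>A. c l * e l i) v = (\<Sum>l\<in>A. c l * ip n (e l) v)"
proof -
  have "ip n (\<lambda>i. \<Sum>l\<in>A. c l * e l i) v = (\<Sum>i<n. \<Sum>l\<in>A. c l * (e l i * v i))"
    by (simp add: ip_def sum_distrib_right mult.assoc)
  also have "\<dots> = (\<Sum>l\<in>A. c l * ip n (e l) v)"
    by (subst sum.swap) (simp add: ip_def sum_distrib_left)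
  finally show ?thesis .
qed

lemma ip_diff_left: "ip n (\<lambda>i. u i - v i) w = ip n u w - ip n v w"
  by (simp add: ip_def left_diff_distrib sum_subtractf)

lemma ip_commute: "ip n u v = ip n v u"
  by (simp add: ip_def mult.commute)

lemma sq_eq_ip: "sq n v = ip n v v"
  by (simp add: sq_def ip_def power2_eq_square)

lemma sq_nonneg: "0 \<le> sq n v"
  by (simp add: sq_def sum_nonneg)

lemma sq_eq_0: "sq n v = 0 \<Longrightarrow> i < n \<Longrightarrow> v i = 0"
  by (auto simp: sq_def sum_nonneg_eq_0_iff)

text \<open>Induction over the columns, so that one basis serves all the nested spans at once. Full
  rank makes the residual \<open>r\<close> of the next column nonzero, hence normalisable.\<close>

lemma gram_schmidt:
  assumes rank: "\<And>c. (\<forall>i<n. (\<Sum>l<p. c l * X i l) = 0) \<Longrightarrow> (\<forall>l<p. c l = 0)"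
    and "q \<le> p"
  shows "\<exists>e. (\<forall>l<q. \<forall>i\<ge>n. e l i = 0) \<and> orthonormal n e q \<and> (\<forall>j\<le>q. colspan n X j = lspan e j)"
  using assms(2)
proof (induction q)
  case 0
  have "colspan n X 0 = lspan (\<lambda>_ _. 0) 0" unfolding colspan_eq_lspan by (rule lspan_cong) simp
  then show ?case by (intro exI[of _ "\<lambda>_ _. 0"]) (simp add: orthonormal_def)
next
  case (Suc q)
  then obtain e where z: "\<And>l i. l < q \<Longrightarrow> n \<le> i \<Longrightarrow> e l i = 0" and on: "orthonormal n e q"
    and sp: "\<And>j. j \<le> q \<Longrightarrow> colspan n X j = lspan e j" by (auto dest: Suc_leD)
  define x where "x i = (if i < n then X i q else 0)" for i
  define s where "s i = (\<Sum>l<q. ip n x (e l) * e l i)" for i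
  define r where "r i = x i - s i" for i
  define e' where "e' = e(q := (\<lambda>i. r i / sqrt (sq n r)))"
  have s: "s \<in> lspan e q" by (auto simp: lspan_def s_def)
  have r0: "sq n r \<noteq> 0"
  proof
    assume "sq n r = 0"
    then have "x i = s i" if "i < n" for i using sq_eq_0[of n r i] that by (simp add: r_def)
    moreover have "s \<in> colspan n X q" using s sp by simp
    then obtain c where c: "\<And>i. i < n \<Longrightarrow> s i = (\<Sum>l<q. c l * X i l)" by (auto simp: colspan_def)
    ultimately have e0: "X i q = (\<Sum>l<q. c l * X i l)" if "i < n" for i
      using that by (simp add: x_def)
    \<comment> \<open>If the residual vanished, column q would be a combination of the earlier ones;
      the coefficient -1 at q makes this a relation that contradicts full rank.\<close>
    define d where "d l = (if l < q then c l else if l = q then -1 else 0)" for l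
    have "(\<Sum>l<p. d l * X i l) = 0" if "i < n" for i
    proof -
      have "(\<Sum>l<p. d l * X i l) = (\<Sum>l<Suc q. d l * X i l)"
        using Suc.prems by (intro sum.mono_neutral_right) (auto simp: d_def)
      also have "\<dots> = (\<Sum>l<q. c l * X i l) - X i q" by (simp add: d_def)
      finally show ?thesis using e0[OF that] by simp
    qed
    then have "d q = 0" using rank[of d] Suc.prems by simp
    then show False by (simp add: d_def)
  qed
  then have sr: "sqrt (sq n r) > 0" "(sqrt (sq n r))\<^sup>2 = sq n r" using sq_nonneg[of n r] by auto
  have rz: "r i = 0" if "n \<le> i" for i using that z by (auto simp: r_def x_def s_def intro!: sum.neutral)
  have orth: "ip n r (e m) = 0" if "m < q" for m
  proof -
    have "ip n s (e m) = (\<Sum>l<q. ip n x (e l) * ip n (e l) (e m))"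
      unfolding s_def by (rule ip_sum_left)
    also have "\<dots> = (\<Sum>l<q. if l = m then ip n x (e l) else 0)"
      using on that by (intro sum.cong) (auto simp: orthonormal_def)
    also have "\<dots> = ip n x (e m)" using that by simp
    finally show ?thesis unfolding r_def by (simp add: ip_diff_left)
  qed
  have ipdiv: "ip n (\<lambda>i. u i / t) v = ip n u v / t" for u v t
    by (simp add: ip_def sum_divide_distrib)
  have on': "orthonormal n e' (Suc q)"
    unfolding orthonormal_def
  proof (intro allI impI)
    fix l m assume lm: "l < Suc q" "m < Suc q"
    consider "l < q" "m < q" | "l = q" "m < q" | "l < q" "m = q" | "l = q" "m = q" using lm by linarith
    then show "ip n (e' l) (e' m) = (if l = m then 1 else 0)"
    proof cases
      case 1 then show ?thesis using on by (simp add: e'_def orthonormal_def)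
    next
      case 2 then show ?thesis using orth by (simp add: e'_def ipdiv)
    next
      case 3 then show ?thesis using orth by (simp add: e'_def ipdiv ip_commute[of n "e l"])
    next
      case 4
      have "ip n (e' q) (e' q) = sq n r / (sqrt (sq n r))\<^sup>2"
        by (simp add: e'_def sq_def[of n r] ip_def sum_divide_distrib power2_eq_square)
      then show ?thesis using 4 r0 sr by simp
    qed
  qed
  have lsp: "lspan e' j = lspan e j" if "j \<le> q" for j
    using that by (intro lspan_cong) (auto simp: e'_def)
  have "colspan n X (Suc q) = lspan e' (Suc q)"
  proof (intro set_eqI iffI)
    fix v assume "v \<in> colspan n X (Suc q)"
    then obtain u t where u: "u \<in> lspan e q" "v = (\<lambda>i. u i + t * x i)"
      unfolding colspan_eq_lspan lspan_Suc using sp[of q] by (auto simp: colspan_eq_lspan x_def fun_eq_iff)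
    have "v = (\<lambda>i. (u i + t * s i) + (t * sqrt (sq n r)) * e' q i)"
    proof
      fix i
      have "(t * sqrt (sq n r)) * e' q i = t * (x i - s i)"
        using sr(1) by (simp add: e'_def r_def[of i])
      then show "v i = (u i + t * s i) + (t * sqrt (sq n r)) * e' q i"
        unfolding u(2) by (simp add: right_diff_distrib)
    qed
    then show "v \<in> lspan e' (Suc q)"
      unfolding lspan_Suc lsp[OF order_refl]
      by (intro bexI[of _ "\<lambda>i. u i + t * s i"] exI[of _ "t * sqrt (sq n r)"] lspan_add u(1) s)
  next
    fix v assume "v \<in> lspan e' (Suc q)"
    then obtain u t where u: "u \<in> lspan e q" "v = (\<lambda>i. u i + t * e' q i)"
      unfolding lspan_Suc lsp[OF order_refl] by blast
    have "v = (\<lambda>i. (u i + (- (t / sqrt (sq n r))) * s i) + (t / sqrt (sq n r)) * x i)"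
      unfolding u(2) e'_def r_def by (simp add: fun_eq_iff diff_divide_distrib right_diff_distrib)
    moreover have "(\<lambda>i. u i + (- (t / sqrt (sq n r))) * s i) \<in> colspan n X q"
      unfolding sp[OF order_refl] by (intro lspan_add u(1) s)
    ultimately show "v \<in> colspan n X (Suc q)"
      unfolding colspan_eq_lspan lspan_Suc
      by (intro bexI[of _ "\<lambda>i. u i + (- (t / sqrt (sq n r))) * s i"] exI[of _ "t / sqrt (sq n r)"])
         (simp_all add: x_def)
  qed
  then have "\<forall>j\<le>Suc q. colspan n X j = lspan e' j"
    using sp lsp by (metis le_Suc_eq)
  moreover have "\<forall>l<Suc q. \<forall>i\<ge>n. e' l i = 0"
    using z rz by (auto simp: e'_def less_Suc_eq)
  ultimately show ?case using on' by blast
qed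

locale ortho_design =
  fixes n p :: nat and X :: "nat \<Rightarrow> nat \<Rightarrow> real" and e :: "nat \<Rightarrow> nat \<Rightarrow> real"
  assumes e_0: "\<And>l i. l < p \<Longrightarrow> n \<le> i \<Longrightarrow> e l i = 0"
    and on: "orthonormal n e p"
    and span: "\<And>j. j \<le> p \<Longrightarrow> colspan n X j = lspan e j"
begin

lemma ip_e: "l < p \<Longrightarrow> m < p \<Longrightarrow> ip n (e l) (e m) = (if l = m then 1 else 0)"
  using on by (simp add: orthonormal_def)

lemma ip_comb_e:
  assumes "m < p" "j \<le> p"
  shows "ip n (\<lambda>i. \<Sum>l<j. c l * e l i) (e m) = (if m < j then c m else 0)"
proof -
  have "ip n (\<lambda>i. \<Sum>l<j. c l * e l i) (e m) = (\<Sum>l<j. if l = m then c l else 0)"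
    unfolding ip_sum_left using assms ip_e by (intro sum.cong) auto
  then show ?thesis by simp
qed

lemma sq_comb: "sq n (\<lambda>i. \<Sum>l<p. c l * e l i) = (\<Sum>l<p. (c l)\<^sup>2)"
proof -
  have "sq n (\<lambda>i. \<Sum>l<p. c l * e l i) = (\<Sum>l<p. c l * ip n (e l) (\<lambda>i. \<Sum>l<p. c l * e l i))"
    unfolding sq_eq_ip by (rule ip_sum_left)
  also have "\<dots> = (\<Sum>l<p. (c l)\<^sup>2)"
    by (intro sum.cong refl) (simp add: ip_commute[of n "e _"] ip_comb_e power2_eq_square)
  finally show ?thesis .
qed

lemma sq_diff_comb:
  "sq n (\<lambda>i. y i - (\<Sum>l<p. c l * e l i)) = sq n y - 2 * (\<Sum>l<p. c l * ip n y (e l)) + (\<Sum>l<p. (c l)\<^sup>2)"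
proof -
  have "sq n (\<lambda>i. y i - v i) = sq n y - 2 * ip n v y + sq n v" for v
    by (simp add: sq_def ip_def sum_subtractf[symmetric] sum.distrib[symmetric] sum_distrib_left power2_eq_square algebra_simps)
  then show ?thesis by (simp add: sq_comb ip_sum_left ip_commute[of n y])
qed

lemma proj_eq:
  assumes j: "j \<le> p"
  shows "proj n (colspan n X j) y = (\<lambda>i. \<Sum>l<j. ip n y (e l) * e l i)"
  unfolding proj_def span[OF j]
proof (rule the_equality)
  let ?v = "\<lambda>i. \<Sum>l<j. ip n y (e l) * e l i"
  have "ip n (\<lambda>i. y i - ?v i) u = 0" if u: "u \<in> lspan e j" for u
  proof -
    obtain c where c: "u = (\<lambda>i. \<Sum>l<j. c l * e l i)" using u by (auto simp: lspan_def)
    have "ip n (\<lambda>i. y i - ?v i) u = (\<Sum>l<j. c l * ip n (e l) (\<lambda>i. y i - ?v i))"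
      unfolding c by (subst ip_commute) (rule ip_sum_left)
    also have "\<dots> = 0"
      using j by (intro sum.neutral) (auto simp: ip_commute[of n "e _"] ip_diff_left ip_comb_e)
    finally show ?thesis .
  qed
  then show "?v \<in> lspan e j \<and> (\<forall>u\<in>lspan e j. ip n (\<lambda>i. y i - ?v i) u = 0)"
    by (auto simp: lspan_def)
  fix v assume v: "v \<in> lspan e j \<and> (\<forall>u\<in>lspan e j. ip n (\<lambda>i. y i - v i) u = 0)"
  then obtain c where c: "v = (\<lambda>i. \<Sum>l<j. c l * e l i)" by (auto simp: lspan_def)
  have "c m = ip n y (e m)" if m: "m < j" for m
  proof -
    have "\<forall>i. e m i = (\<Sum>l<j. (if l = m then 1 else 0) * e l i)"
      using m by (simp add: if_distrib[of "\<lambda>x. x * _"] cong: if_cong)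
    then have "e m \<in> lspan e j" by (auto simp: lspan_def)
    then have "ip n (\<lambda>i. y i - v i) (e m) = 0" using v by blast
    then show ?thesis using m j by (simp add: ip_diff_left c ip_comb_e)
  qed
  then show "v = ?v" unfolding c by auto
qed

lemma projmat_eq:
  assumes "j \<le> p" shows "projmat n X j a b = (\<Sum>l<j. e l a * e l b)"
proof -
  have "ip n (\<lambda>i. if i = b then 1 else 0) (e l) = e l b" if "l < p" for l
    using e_0[OF that, of b] by (cases "b < n") (auto simp: ip_def if_distrib[of "\<lambda>x. x * _"] cong: if_cong)
  then show ?thesis unfolding projmat_def proj_eq[OF assms] using assms
    by (intro sum.cong) auto
qed

text \<open>\<open>phi\<close> is a choice of unit vector, fixed only up to sign; the rank-one
  matrix that it shares with the basis vector determines the squared coefficient. Basis vectors are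
  counted from 0, \<open>theta\<close> from 1.\<close>

lemma theta_square:
  assumes l: "l < p"
  shows "(theta n X f (Suc l))\<^sup>2 = (ip n (e l) f)\<^sup>2 / real n"
proof -
  define \<phi> where "\<phi> = phi n X (Suc l)"
  have dm: "projmat n X (Suc l) a b - projmat n X l a b = e l a * e l b" for a b
    using l by (simp add: projmat_eq)
  have "(\<forall>i. n \<le> i \<longrightarrow> \<phi> i = 0) \<and>
      (\<forall>a<n. \<forall>b<n. projmat n X (Suc l) a b - projmat n X (Suc l - 1) a b = \<phi> a * \<phi> b)"
    unfolding \<phi>_def phi_def
    by (rule someI[of _ "e l"]) (use l e_0 dm in auto)
  then have \<phi>: "\<phi> a * \<phi> b = e l a * e l b" if "a < n" "b < n" for a b
    using that dm by simp
  have "(ip n \<phi> f)\<^sup>2 = (\<Sum>a<n. \<Sum>b<n. (\<phi> a * \<phi> b) * (f a * f b))"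
    by (simp add: ip_def power2_eq_square sum_product mult_ac)
  also have "\<dots> = (\<Sum>a<n. \<Sum>b<n. (e l a * e l b) * (f a * f b))"
    using \<phi> by (intro sum.cong refl) auto
  also have "\<dots> = (ip n (e l) f)\<^sup>2"
    by (simp add: ip_def power2_eq_square sum_product mult_ac)
  finally show ?thesis by (simp add: theta_def \<phi>_def power_divide)
qed

text \<open>Averaging nested projections is a diagonal shrinkage in the basis \<open>e\<close>; this
  is the shrinkage factor of coordinate \<open>l\<close>.\<close>

definition cumweight :: "(nat \<Rightarrow> nat) \<Rightarrow> nat \<Rightarrow> (nat \<Rightarrow> real) \<Rightarrow> nat \<Rightarrow> real" where
  "cumweight k M w l = (\<Sum>m=1..M. if l < k m then w m else 0)"

lemma sum_weighted_prefix:
  assumes k: "\<And>m. m \<in> {1..M} \<Longrightarrow> k m \<le> p"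
  shows "(\<Sum>m=1..M. w m * (\<Sum>l<k m. x l)) = (\<Sum>l<p. cumweight k M w l * x l)"
proof -
  have "(\<Sum>m=1..M. w m * (\<Sum>l<k m. x l)) = (\<Sum>m=1..M. \<Sum>l<p. (if l < k m then w m else 0) * x l)"
  proof (intro sum.cong refl)
    fix m assume m: "m \<in> {1..M}"
    have "(\<Sum>l<p. (if l < k m then w m else 0) * x l) = (\<Sum>l<k m. (if l < k m then w m else 0) * x l)"
      using k[OF m] by (intro sum.mono_neutral_right) auto
    also have "\<dots> = w m * (\<Sum>l<k m. x l)" unfolding sum_distrib_left by (intro sum.cong) auto
    finally show "w m * (\<Sum>l<k m. x l) = (\<Sum>l<p. (if l < k m then w m else 0) * x l)" by simp
  qed
  also have "\<dots> = (\<Sum>l<p. \<Sum>m=1..M. (if l < k m then w m else 0) * x l)" by (rule sum.swap)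
  finally show ?thesis by (simp add: cumweight_def sum_distrib_right)
qed

lemma maest_eq:
  assumes k: "\<And>m. m \<in> {1..M} \<Longrightarrow> k m \<le> p"
  shows "maest n X k M w y = (\<lambda>i. \<Sum>l<p. (cumweight k M w l * ip n y (e l)) * e l i)"
proof
  fix i
  have "maest n X k M w y i = (\<Sum>m=1..M. w m * (\<Sum>l<k m. ip n y (e l) * e l i))"
    unfolding maest_def using k by (intro sum.cong refl) (simp add: proj_eq)
  also have "\<dots> = (\<Sum>l<p. cumweight k M w l * (ip n y (e l) * e l i))"
    by (rule sum_weighted_prefix[OF k])
  finally show "maest n X k M w y i = (\<Sum>l<p. (cumweight k M w l * ip n y (e l)) * e l i)"
    by (simp add: mult.assoc)
qed

text \<open>The left side is the trace in the variance part of Q. It is a squared Frobenius norm,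
  which the orthonormal basis turns into the sum of the squared shrinkage factors.\<close>

lemma mamat_square_sum:
  assumes k: "\<And>m. m \<in> {1..M} \<Longrightarrow> k m \<le> p"
  shows "(\<Sum>a<n. \<Sum>b<n. (mamat n X k M w a b)\<^sup>2) = (\<Sum>l<p. (cumweight k M w l)\<^sup>2)"
proof -
  let ?g = "cumweight k M w"
  have eq: "mamat n X k M w a b = (\<Sum>l<p. (?g l * e l a) * e l b)" for a b
  proof -
    have "mamat n X k M w a b = (\<Sum>m=1..M. w m * (\<Sum>l<k m. e l a * e l b))"
      unfolding mamat_def using k by (intro sum.cong refl) (simp add: projmat_eq)
    also have "\<dots> = (\<Sum>l<p. ?g l * (e l a * e l b))" by (rule sum_weighted_prefix[OF k])
    finally show ?thesis by (simp add: mult.assoc)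
  qed
  have "(\<Sum>b<n. (mamat n X k M w a b)\<^sup>2) = (\<Sum>l<p. (?g l * e l a)\<^sup>2)" for a
    unfolding eq using sq_comb[of "\<lambda>l. ?g l * e l a"] by (simp add: sq_def)
  then have "(\<Sum>a<n. \<Sum>b<n. (mamat n X k M w a b)\<^sup>2) = (\<Sum>a<n. \<Sum>l<p. (?g l * e l a)\<^sup>2)" by simp
  also have "\<dots> = (\<Sum>l<p. (?g l)\<^sup>2 * ip n (e l) (e l))"
    by (subst sum.swap) (simp add: ip_def sum_distrib_left power2_eq_square mult_ac)
  finally show ?thesis by (simp add: ip_e)
qed

text \<open>The mean lies in the full column space, so its expansion has no remainder and the bias
  is visible entirely in the \<open>p\<close> coefficients.\<close>

lemma fvec_eq: "fvec n X \<beta> p = (\<lambda>i. \<Sum>l<p. ip n (fvec n X \<beta> p) (e l) * e l i)"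
proof -
  have "fvec n X \<beta> p \<in> colspan n X p"
    unfolding colspan_def fvec_def by (auto intro!: exI[of _ \<beta>] sum.cong)
  then obtain c where c: "fvec n X \<beta> p = (\<lambda>i. \<Sum>l<p. c l * e l i)"
    using span[of p] unfolding lspan_def fun_eq_iff by blast
  show ?thesis unfolding c by (rule ext, rule sum.cong) (auto simp: ip_comb_e)
qed

end

section \<open>Mallows model averaging over nested models\<close>

text \<open>With blocks counted from 0 and models from 1, block j is contained in exactly the models
  from j + 1 on; this is the common shrinkage factor of that block.\<close>

definition tailweight :: "nat \<Rightarrow> (nat \<Rightarrow> real) \<Rightarrow> nat \<Rightarrow> real" where
  "tailweight M w j = (\<Sum>m=Suc j..M. w m)"

lemma tailweight_Suc: "j < M \<Longrightarrow> tailweight M w j = w (Suc j) + tailweight M w (Suc j)"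
  unfolding tailweight_def by (rule sum.atLeast_Suc_atMost) simp

lemma wsimplex_tailweight:
  assumes w: "w \<in> wsimplex M"
  shows tailweight_0: "tailweight M w 0 = 1"
    and tailweight_dec: "\<And>j. j < M \<Longrightarrow> tailweight M w (Suc j) \<le> tailweight M w j"
    and tailweight_nonneg: "\<And>j. 0 \<le> tailweight M w j"
    and tailweight_le_1: "\<And>j. tailweight M w j \<le> 1"
proof -
  have pos: "\<And>m. m \<in> {1..M} \<Longrightarrow> 0 \<le> w m" and s1: "(\<Sum>m=1..M. w m) = 1"
    using w by (auto simp: wsimplex_def)
  show "tailweight M w 0 = 1" using s1 by (simp add: tailweight_def)
  show "tailweight M w (Suc j) \<le> tailweight M w j" if "j < M" for j
    using tailweight_Suc[OF that] pos[of "Suc j"] that by simp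
  show "0 \<le> tailweight M w j" for j unfolding tailweight_def using pos by (intro sum_nonneg) auto
  have "tailweight M w j \<le> (\<Sum>m=1..M. w m)" for j
    unfolding tailweight_def using pos by (intro sum_mono2) auto
  then show "tailweight M w j \<le> 1" for j using s1 by simp
qed

locale nested_regression = iid_subgaussian P eps s2 c + ortho_design n p X e + nested_blocks k M
  for P :: "'a measure" and eps :: "nat \<Rightarrow> 'a \<Rightarrow> real" and s2 c :: real and n p :: nat
    and X e :: "nat \<Rightarrow> nat \<Rightarrow> real" and k :: "nat \<Rightarrow> nat" and M :: nat +
  fixes \<beta> :: "nat \<Rightarrow> real"
  assumes n_pos: "0 < n" and k_M: "k M = p"
begin

abbreviation blk :: "nat \<Rightarrow> nat set" where "blk j \<equiv> {k j..<k (Suc j)}"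

definition mean :: "nat \<Rightarrow> real" where "mean = fvec n X \<beta> p"
definition a :: "nat \<Rightarrow> real" where "a l = ip n mean (e l)"
definition z :: "nat \<Rightarrow> 'a \<Rightarrow> real" where "z l \<omega> = (\<Sum>i<n. e l i * eps i \<omega>)"
abbreviation obs :: "'a \<Rightarrow> nat \<Rightarrow> real" where "obs \<equiv> yvec n mean eps"

lemma k_le_p: "m \<le> M \<Longrightarrow> k m \<le> p"
  using k_mono[of m M] k_M by simp

lemma k_le_p': "m \<in> {1..M} \<Longrightarrow> k m \<le> p"
  using k_le_p by simp

lemma z_measurable [measurable]: "z l \<in> borel_measurable P"
  unfolding z_def by measurable

lemma mean_eq: "mean i = (\<Sum>l<p. a l * e l i)"
  unfolding a_def mean_def by (subst fvec_eq) simp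

lemma ip_obs: "ip n (obs \<omega>) (e l) = a l + z l \<omega>"
  unfolding ip_def a_def z_def yvec_def by (simp add: algebra_simps sum.distrib[symmetric])

lemma loss_eq:
  assumes k': "\<And>m. m \<in> {1..M'} \<Longrightarrow> k' m \<le> p"
  shows "sq n (\<lambda>i. maest n X k' M' w (obs \<omega>) i - mean i)
    = (\<Sum>l<p. (cumweight k' M' w l * (a l + z l \<omega>) - a l)\<^sup>2)"
proof -
  have me: "maest n X k' M' w y = (\<lambda>i. \<Sum>l<p. (cumweight k' M' w l * ip n y (e l)) * e l i)" for y
    by (rule maest_eq) (rule k')
  have "maest n X k' M' w (obs \<omega>) i - mean i = (\<Sum>l<p. (cumweight k' M' w l * (a l + z l \<omega>) - a l) * e l i)" for i
    unfolding me ip_obs mean_eq[of i] by (simp add: left_diff_distrib sum_subtractf)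
  then show ?thesis by (simp add: sq_comb)
qed

lemma bias_eq:
  assumes k': "\<And>m. m \<in> {1..M'} \<Longrightarrow> k' m \<le> p"
  shows "sq n (\<lambda>i. mean i - maest n X k' M' w mean i) = (\<Sum>l<p. (1 - cumweight k' M' w l)\<^sup>2 * (a l)\<^sup>2)"
proof -
  have me: "maest n X k' M' w y = (\<lambda>i. \<Sum>l<p. (cumweight k' M' w l * ip n y (e l)) * e l i)" for y
    by (rule maest_eq) (rule k')
  have "mean i - maest n X k' M' w mean i = (\<Sum>l<p. ((1 - cumweight k' M' w l) * a l) * e l i)" for i
    unfolding me a_def[symmetric]
    by (subst mean_eq[of i]) (simp add: left_diff_distrib sum_subtractf)
  then show ?thesis by (simp add: sq_comb power_mult_distrib)
qed

lemma crit_eq: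
  "real n * Cn n X k M s w (obs \<omega>)
    = sq n (obs \<omega>) + (\<Sum>l<p. ((cumweight k M w l)\<^sup>2 - 2 * cumweight k M w l) * (a l + z l \<omega>)\<^sup>2 + 2 * s * cumweight k M w l)"
proof -
  let ?g = "cumweight k M w"
  have dof: "(\<Sum>m=1..M. real (k m) * w m) = (\<Sum>l<p. ?g l)"
    using sum_weighted_prefix[of M k w "\<lambda>_. 1", OF k_le_p'] by (simp add: mult.commute)
  have me: "maest n X k M w y = (\<lambda>i. \<Sum>l<p. (cumweight k M w l * ip n y (e l)) * e l i)" for y
    by (rule maest_eq) (rule k_le_p')
  have "sq n (\<lambda>i. obs \<omega> i - maest n X k M w (obs \<omega>) i) = sq n (obs \<omega>)
      - 2 * (\<Sum>l<p. (?g l * (a l + z l \<omega>)) * (a l + z l \<omega>)) + (\<Sum>l<p. (?g l * (a l + z l \<omega>))\<^sup>2)"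
    unfolding me sq_diff_comb ip_obs by simp
  then have "real n * Cn n X k M s w (obs \<omega>) = sq n (obs \<omega>)
      - 2 * (\<Sum>l<p. (?g l * (a l + z l \<omega>)) * (a l + z l \<omega>)) + (\<Sum>l<p. (?g l * (a l + z l \<omega>))\<^sup>2) + 2 * s * (\<Sum>l<p. ?g l)"
  proof -
    assume eq: "sq n (\<lambda>i. obs \<omega> i - maest n X k M w (obs \<omega>) i) = sq n (obs \<omega>)
      - 2 * (\<Sum>l<p. (?g l * (a l + z l \<omega>)) * (a l + z l \<omega>)) + (\<Sum>l<p. (?g l * (a l + z l \<omega>))\<^sup>2)"
    have "real n * Cn n X k M s w (obs \<omega>)
        = sq n (\<lambda>i. obs \<omega> i - maest n X k M w (obs \<omega>) i) + 2 * s * (\<Sum>l<p. ?g l)"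
      unfolding Cn_def dof using n_pos by (simp add: distrib_left)
    then show ?thesis unfolding eq .
  qed
  also have "\<dots> = sq n (obs \<omega>) + (\<Sum>l<p. ((?g l)\<^sup>2 - 2 * ?g l) * (a l + z l \<omega>)\<^sup>2 + 2 * s * ?g l)"
  proof -
    have "(\<Sum>l<p. (?g l * (a l + z l \<omega>))\<^sup>2) - 2 * (\<Sum>l<p. (?g l * (a l + z l \<omega>)) * (a l + z l \<omega>)) + 2 * s * (\<Sum>l<p. ?g l)
      = (\<Sum>l<p. ((?g l)\<^sup>2 - 2 * ?g l) * (a l + z l \<omega>)\<^sup>2 + 2 * s * ?g l)"
      unfolding sum_distrib_left sum_subtractf[symmetric] sum.distrib[symmetric]
      by (intro sum.cong refl) (simp add: power2_eq_square algebra_simps)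
    then show ?thesis by linarith
  qed
  finally show ?thesis .
qed

section \<open>Noise coordinates and the risk of fixed weights\<close>

lemma integrable_z_square: "integrable P (\<lambda>\<omega>. (z l \<omega>)\<^sup>2)"
  unfolding z_def power2_eq_square sum_product
  by (intro Bochner_Integration.integrable_sum)
     (use integrable_mult_right[OF integrable_eps_mult] in \<open>simp add: mult_ac\<close>)

lemma integrable_z: "integrable P (z l)"
  unfolding z_def by (intro Bochner_Integration.integrable_sum integrable_mult_right integrable_eps)

lemma expectation_z: "expectation (z l) = 0"
  unfolding z_def using integrable_eps
  by (subst Bochner_Integration.integral_sum) (auto simp: expectation_eps)

lemma expectation_z_square:
  assumes "l < p" shows "expectation (\<lambda>\<omega>. (z l \<omega>)\<^sup>2) = s2"
proof -
  have "(z l \<omega>)\<^sup>2 = (\<Sum>i<n. \<Sum>j<n. (e l i * e l j) * (eps i \<omega> * eps j \<omega>))" for \<omega>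
    unfolding z_def power2_eq_square sum_product by (simp add: mult_ac)
  then have "expectation (\<lambda>\<omega>. (z l \<omega>)\<^sup>2) = (\<Sum>i<n. \<Sum>j<n. (e l i * e l j) * expectation (\<lambda>\<omega>. eps i \<omega> * eps j \<omega>))"
    using integrable_eps_mult by (simp add: Bochner_Integration.integral_sum Bochner_Integration.integrable_sum)
  also have "\<dots> = s2 * ip n (e l) (e l)"
    unfolding expectation_eps_mult
    by (simp add: if_distrib[of "\<lambda>x. _ * x"] ip_def sum_distrib_left mult_ac cong: if_cong)
  finally show ?thesis using ip_e[OF assms assms] by simp
qed

text \<open>The mixed term is linear in the centred noise coordinates and drops out. The candidate
  family is left general because the formula is evaluated for the family of all nested
  models.\<close>

lemma riskMA_eq:
  assumes k': "\<And>m. m \<in> {1..M'} \<Longrightarrow> k' m \<le> p"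
  shows "real n * riskMA P eps n X mean k' M' w
    = (\<Sum>l<p. (1 - cumweight k' M' w l)\<^sup>2 * (a l)\<^sup>2 + s2 * (cumweight k' M' w l)\<^sup>2)"
proof -
  let ?g = "cumweight k' M' w"
  have le: "sq n (\<lambda>i. maest n X k' M' w (obs \<omega>) i - mean i) = (\<Sum>l<p. (?g l * (a l + z l \<omega>) - a l)\<^sup>2)" for \<omega>
    by (rule loss_eq) (rule k')
  have "real n * riskMA P eps n X mean k' M' w = expectation (\<lambda>\<omega>. \<Sum>l<p. (?g l * (a l + z l \<omega>) - a l)\<^sup>2)"
    unfolding riskMA_def le using n_pos by simp
  also have "(\<lambda>\<omega>. \<Sum>l<p. (?g l * (a l + z l \<omega>) - a l)\<^sup>2)
     = (\<lambda>\<omega>. \<Sum>l<p. (1 - ?g l)\<^sup>2 * (a l)\<^sup>2 - 2 * (1 - ?g l) * a l * ?g l * z l \<omega> + (?g l)\<^sup>2 * (z l \<omega>)\<^sup>2)"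
    by (intro ext sum.cong refl) (simp add: power2_eq_square algebra_simps)
  also have "expectation \<dots> = (\<Sum>l<p. expectation (\<lambda>\<omega>. (1 - ?g l)\<^sup>2 * (a l)\<^sup>2 - 2 * (1 - ?g l) * a l * ?g l * z l \<omega> + (?g l)\<^sup>2 * (z l \<omega>)\<^sup>2))"
    using integrable_z integrable_z_square
    by (intro Bochner_Integration.integral_sum Bochner_Integration.integrable_add Bochner_Integration.integrable_diff
        integrable_mult_right) auto
  also have "\<dots> = (\<Sum>l<p. (1 - ?g l)\<^sup>2 * (a l)\<^sup>2 + s2 * (?g l)\<^sup>2)"
  proof (intro sum.cong refl)
    fix l assume "l \<in> {..<p}"
    then show "expectation (\<lambda>\<omega>. (1 - ?g l)\<^sup>2 * (a l)\<^sup>2 - 2 * (1 - ?g l) * a l * ?g l * z l \<omega> + (?g l)\<^sup>2 * (z l \<omega>)\<^sup>2)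
      = (1 - ?g l)\<^sup>2 * (a l)\<^sup>2 + s2 * (?g l)\<^sup>2"
      using integrable_z integrable_z_square expectation_z[of l] expectation_z_square[of l]
      by (simp add: Bochner_Integration.integral_add Bochner_Integration.integral_diff prob_space mult.commute)
  qed
  finally show ?thesis .
qed

lemma cumweight_blk:
  assumes "j < M" "l \<in> blk j" shows "cumweight k M w l = tailweight M w j"
proof -
  have "l < k m \<longleftrightarrow> Suc j \<le> m" if "m \<in> {1..M}" for m
    using that assms k_mono[of "Suc j" m] k_mono[of m j] by (cases "Suc j \<le> m") auto
  then have "cumweight k M w l = (\<Sum>m=1..M. if Suc j \<le> m then w m else 0)"
    unfolding cumweight_def by (intro sum.cong) auto
  also have "\<dots> = tailweight M w j"
    unfolding tailweight_def by (rule sum.mono_neutral_cong_right) auto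
  finally show ?thesis .
qed

lemma sum_over_blocks:
  fixes F :: "real \<Rightarrow> nat \<Rightarrow> real"
  shows "(\<Sum>l<p. F (cumweight k M w l) l) = (\<Sum>j<M. \<Sum>l\<in>blk j. F (tailweight M w j) l)"
proof -
  have "(\<Sum>l<p. F (cumweight k M w l) l) = (\<Sum>j<M. \<Sum>l\<in>blk j. F (cumweight k M w l) l)"
    using sum_blocks[of M "\<lambda>l. F (cumweight k M w l) l"] k_M by simp
  also have "\<dots> = (\<Sum>j<M. \<Sum>l\<in>blk j. F (tailweight M w j) l)"
    by (intro sum.cong refl) (simp add: cumweight_blk)
  finally show ?thesis .
qed

text \<open>The scale is that of the quadratic exponential bound, so that \<open>exp_const\<close>
  bounds the exponential moment.\<close>

definition chi :: "nat \<Rightarrow> 'a \<Rightarrow> real" where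
  "chi j \<omega> = (\<Sum>l<k j. (z l \<omega>)\<^sup>2 - s2) / (16 * c * sqrt (real (k j)))"

text \<open>Has value 0 when no signal is left from block \<open>j\<close> on, by division by
  zero.\<close>

definition cross :: "nat \<Rightarrow> 'a \<Rightarrow> real" where
  "cross j \<omega> = tail (\<lambda>l. a l * z l \<omega>) j / sqrt (c * tail (\<lambda>l. (a l)\<^sup>2) j)"

lemma chi_measurable [measurable]: "chi j \<in> borel_measurable P"
  unfolding chi_def by measurable

lemma cross_measurable [measurable]: "cross j \<in> borel_measurable P"
  unfolding cross_def tail_def by measurable

text \<open>The sum of the first \<open>k j\<close> squared noise coordinates is the quadratic form,
  in the original errors, of the orthogonal projection \<open>Q\<close> onto the first
  \<open>k j\<close> basis vectors.\<close>

lemma nn_integral_exp_chi: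
  assumes j: "1 \<le> j" "j \<le> M"
  shows "(\<integral>\<^sup>+\<omega>. ennreal (exp \<bar>chi j \<omega>\<bar>) \<partial>P) \<le> ennreal exp_const"
proof -
  define Q where "Q i m = (\<Sum>l<k j. e l i * e l m)" for i m
  have kp: "k j \<le> p" by (rule k_le_p[OF j(2)])
  have z2: "(\<Sum>l<k j. (z l \<omega>)\<^sup>2 - s2) = (\<Sum>i<n. \<Sum>m<n. Q i m * eps i \<omega> * eps m \<omega>) - s2 * real (k j)" for \<omega>
  proof -
    have "(\<Sum>l<k j. (z l \<omega>)\<^sup>2) = (\<Sum>l<k j. \<Sum>i<n. \<Sum>m<n. e l i * e l m * eps i \<omega> * eps m \<omega>)"
      unfolding z_def power2_eq_square sum_product by (simp add: mult_ac)
    also have "\<dots> = (\<Sum>i<n. \<Sum>m<n. \<Sum>l<k j. e l i * e l m * eps i \<omega> * eps m \<omega>)"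
      by (subst sum.swap, rule sum.cong[OF refl], rule sum.swap)
    also have "\<dots> = (\<Sum>i<n. \<Sum>m<n. Q i m * eps i \<omega> * eps m \<omega>)"
      unfolding Q_def sum_distrib_right ..
    finally show ?thesis by (simp add: sum_subtractf mult.commute)
  qed
  have row: "(\<Sum>m<n. (Q i m)\<^sup>2) = Q i i" for i
  proof -
    have "(\<Sum>m<n. (Q i m)\<^sup>2) = sq n (\<lambda>m. \<Sum>l<p. (if l < k j then e l i else 0) * e l m)"
      unfolding sq_def Q_def
    proof (rule sum.cong[OF refl], rule arg_cong[where f="\<lambda>x. x\<^sup>2"])
      fix m show "(\<Sum>l<k j. e l i * e l m) = (\<Sum>l<p. (if l < k j then e l i else 0) * e l m)"
        using kp by (intro sum.mono_neutral_cong_left) auto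
    qed
    also have "\<dots> = (\<Sum>l<p. (if l < k j then e l i else 0)\<^sup>2)" by (rule sq_comb)
    also have "\<dots> = (\<Sum>l<k j. e l i * e l i)"
      using kp by (intro sum.mono_neutral_cong_right) (auto simp: power2_eq_square)
    finally show ?thesis unfolding Q_def .
  qed
  have tr: "(\<Sum>i<n. Q i i) = real (k j)"
  proof -
    have "(\<Sum>i<n. Q i i) = (\<Sum>l<k j. ip n (e l) (e l))"
      unfolding Q_def ip_def by (rule sum.swap)
    also have "\<dots> = (\<Sum>l<k j. 1)" using kp by (intro sum.cong refl) (simp add: ip_e)
    finally show ?thesis by simp
  qed
  have sym: "Q i m = Q m i" for i m by (simp add: Q_def mult.commute)
  have "1 \<le> real (k j)" using k_pos[OF j] by simp
  from nn_integral_exp_abs_quadratic_le[OF sym row tr this] show ?thesis unfolding chi_def z2 .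
qed

lemma nn_integral_exp_cross:
  assumes j: "j < M"
  shows "(\<integral>\<^sup>+\<omega>. ennreal (exp \<bar>cross j \<omega>\<bar>) \<partial>P) \<le> ennreal exp_const"
proof (cases "tail (\<lambda>l. (a l)\<^sup>2) j = 0")
  case True
  have "1 \<le> ennreal exp_const" using exp_const_ge by (simp add: ennreal_1[symmetric] ennreal_leI del: ennreal_1)
  then show ?thesis using True by (simp add: cross_def emeasure_space_1)
next
  case False
  \<comment> \<open>The part of the mean carried by the coordinates from \<open>k j\<close> on; its
    squared norm is the tail of the signal, the scale used in \<open>cross\<close>.\<close>
  define v where "v i = (\<Sum>l<p. (if k j \<le> l then a l else 0) * e l i)" for i
  have "(\<Sum>i<n. (v i)\<^sup>2) = (\<Sum>l<p. (if k j \<le> l then a l else 0)\<^sup>2)"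
    using sq_comb[of "\<lambda>l. if k j \<le> l then a l else 0"] by (simp add: sq_def v_def)
  also have "\<dots> = tail (\<lambda>l. (a l)\<^sup>2) j"
    unfolding tail_def k_M by (intro sum.mono_neutral_cong_right) auto
  finally have vv: "(\<Sum>i<n. (v i)\<^sup>2) \<le> tail (\<lambda>l. (a l)\<^sup>2) j" by simp
  have "(\<Sum>i<n. v i * eps i \<omega>) = tail (\<lambda>l. a l * z l \<omega>) j" for \<omega>
  proof -
    have "(\<Sum>i<n. v i * eps i \<omega>) = (\<Sum>l<p. \<Sum>i<n. (if k j \<le> l then a l else 0) * e l i * eps i \<omega>)"
      unfolding v_def sum_distrib_right by (rule sum.swap)
    also have "\<dots> = (\<Sum>l<p. (if k j \<le> l then a l else 0) * z l \<omega>)"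
      by (simp add: z_def sum_distrib_left mult.assoc)
    also have "\<dots> = tail (\<lambda>l. a l * z l \<omega>) j"
      unfolding tail_def k_M by (intro sum.mono_neutral_cong_right) auto
    finally show ?thesis .
  qed
  then show ?thesis
    using nn_integral_exp_abs_linear_le[OF vv] False tail_nonneg[of "\<lambda>l. (a l)\<^sup>2" j]
    by (simp add: cross_def less_le)
qed

text \<open>A smooth substitute for the maximum of the squares of all \<open>chi j\<close> and
  \<open>cross j\<close>: \<open>square_le_ln_square_plus_exp\<close> with
  \<open>b = exp_const * M\<close>, where the single exponential is enlarged to the sum of all 2 M
  of them so that one expression serves every index.\<close>

definition envelope :: "'a \<Rightarrow> real" where
  "envelope \<omega> = 2 * (ln (exp_const * real M))\<^sup>2
     + 4 / (exp_const * real M) * ((\<Sum>j=1..M. exp \<bar>chi j \<omega>\<bar>) + (\<Sum>j<M. exp \<bar>cross j \<omega>\<bar>))"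

lemma envelope_measurable [measurable]: "envelope \<in> borel_measurable P"
  unfolding envelope_def by measurable

lemma
  shows chi_le_envelope: "1 \<le> j \<Longrightarrow> j \<le> M \<Longrightarrow> (chi j \<omega>)\<^sup>2 \<le> envelope \<omega>"
    and cross_le_envelope: "i < M \<Longrightarrow> (cross i \<omega>)\<^sup>2 \<le> envelope \<omega>"
    and envelope_nonneg: "0 \<le> envelope \<omega>"
proof -
  let ?b = "exp_const * real M"
  let ?S = "(\<Sum>j=1..M. exp \<bar>chi j \<omega>\<bar>)" and ?T = "(\<Sum>j<M. exp \<bar>cross j \<omega>\<bar>)"
  have "1 * 1 \<le> ?b" using exp_const_ge M_pos by (intro mult_mono) auto
  then have b: "1 \<le> ?b" by simp
  have nn: "0 \<le> ?S" "0 \<le> ?T" by (auto intro!: sum_nonneg)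
  have main: "x\<^sup>2 \<le> envelope \<omega>" if "exp \<bar>x\<bar> \<le> ?S + ?T" for x
  proof -
    have "\<bar>x\<bar>\<^sup>2 \<le> 2 * (ln ?b)\<^sup>2 + 4 * exp \<bar>x\<bar> / ?b"
      by (rule square_le_ln_square_plus_exp[OF b]) simp
    also have "4 * exp \<bar>x\<bar> / ?b = 4 / ?b * exp \<bar>x\<bar>" by simp
    also have "\<dots> \<le> 4 / ?b * (?S + ?T)" using that b by (intro mult_left_mono) auto
    finally show ?thesis by (simp add: envelope_def)
  qed
  show "(chi j \<omega>)\<^sup>2 \<le> envelope \<omega>" if "1 \<le> j" "j \<le> M"
  proof (rule main)
    have "exp \<bar>chi j \<omega>\<bar> \<le> ?S" using that by (intro member_le_sum) auto
    then show "exp \<bar>chi j \<omega>\<bar> \<le> ?S + ?T" using nn by linarith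
  qed
  show "(cross i \<omega>)\<^sup>2 \<le> envelope \<omega>" if "i < M"
  proof (rule main)
    have "exp \<bar>cross i \<omega>\<bar> \<le> ?T" using that by (intro member_le_sum) auto
    then show "exp \<bar>cross i \<omega>\<bar> \<le> ?S + ?T" using nn by linarith
  qed
  show "0 \<le> envelope \<omega>" unfolding envelope_def using nn b by (intro add_nonneg_nonneg mult_nonneg_nonneg) auto
qed

lemma nn_integral_envelope_le:
  "(\<integral>\<^sup>+\<omega>. ennreal (envelope \<omega>) \<partial>P) \<le> ennreal ((2 * (1 + ln exp_const)\<^sup>2 + 8) * (1 + ln (real M))\<^sup>2)"
proof -
  let ?b = "exp_const * real M"
  have b: "0 < ?b" "0 < exp_const" "1 \<le> exp_const" using exp_const_ge M_pos by auto
  have lM: "0 \<le> ln (real M)" "0 \<le> ln exp_const" using M_pos b by auto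
  have "(\<integral>\<^sup>+\<omega>. ennreal (envelope \<omega>) \<partial>P)
      = (\<integral>\<^sup>+\<omega>. ennreal (2 * (ln ?b)\<^sup>2) + ennreal (4 / ?b) *
          ((\<Sum>j=1..M. ennreal (exp \<bar>chi j \<omega>\<bar>)) + (\<Sum>j<M. ennreal (exp \<bar>cross j \<omega>\<bar>))) \<partial>P)"
  proof (intro nn_integral_cong)
    fix \<omega>
    have S: "(\<Sum>j=1..M. ennreal (exp \<bar>chi j \<omega>\<bar>)) = ennreal (\<Sum>j=1..M. exp \<bar>chi j \<omega>\<bar>)"
      "(\<Sum>j<M. ennreal (exp \<bar>cross j \<omega>\<bar>)) = ennreal (\<Sum>j<M. exp \<bar>cross j \<omega>\<bar>)"
      by (auto intro!: sum_ennreal)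
    have nn: "0 \<le> (\<Sum>j=1..M. exp \<bar>chi j \<omega>\<bar>)" "0 \<le> (\<Sum>j<M. exp \<bar>cross j \<omega>\<bar>)" by (auto intro!: sum_nonneg)
    show "ennreal (envelope \<omega>) = ennreal (2 * (ln ?b)\<^sup>2) + ennreal (4 / ?b) *
          ((\<Sum>j=1..M. ennreal (exp \<bar>chi j \<omega>\<bar>)) + (\<Sum>j<M. ennreal (exp \<bar>cross j \<omega>\<bar>)))"
      unfolding S ennreal_plus[OF nn, symmetric] envelope_def
      using nn b by (subst ennreal_mult[symmetric]) (auto simp: ennreal_plus[symmetric] simp del: ennreal_plus)
  qed
  also have "\<dots> = ennreal (2 * (ln ?b)\<^sup>2) + ennreal (4 / ?b) *
          ((\<Sum>j=1..M. \<integral>\<^sup>+\<omega>. ennreal (exp \<bar>chi j \<omega>\<bar>) \<partial>P) + (\<Sum>j<M. \<integral>\<^sup>+\<omega>. ennreal (exp \<bar>cross j \<omega>\<bar>) \<partial>P))"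
    by (simp add: nn_integral_add nn_integral_cmult nn_integral_sum emeasure_space_1 del: sum_ennreal)
  also have "\<dots> \<le> ennreal (2 * (ln ?b)\<^sup>2) + ennreal (4 / ?b) *
          ((\<Sum>j=1..M. ennreal exp_const) + (\<Sum>j<M. ennreal exp_const))"
    by (intro add_mono mult_left_mono sum_mono order_refl nn_integral_exp_chi nn_integral_exp_cross) auto
  also have "(\<Sum>j=1..M. ennreal exp_const) + (\<Sum>j<M. ennreal exp_const) = ennreal (2 * ?b)"
    using b by (simp add: ennreal_mult[symmetric] ennreal_plus[symmetric] ennreal_of_nat_eq_real_of_nat mult_ac del: ennreal_plus)
  \<comment> \<open>The 2 M exponentials have total expectation at most twice \<open>?b\<close>, so
    the union over all partial sums costs the constant 8, whatever \<open>M\<close> is.\<close>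
  also have "ennreal (2 * (ln ?b)\<^sup>2) + ennreal (4 / ?b) * ennreal (2 * ?b) = ennreal (2 * (ln ?b)\<^sup>2 + 8)"
  proof -
    have "ennreal (4 / ?b) * ennreal (2 * ?b) = ennreal (4 / ?b * (2 * ?b))"
      using b by (intro ennreal_mult[symmetric]) auto
    also have "4 / ?b * (2 * ?b) = 8" using b M_pos by simp
    finally have "ennreal (4 / ?b) * ennreal (2 * ?b) = ennreal 8" .
    moreover have "ennreal (2 * (ln ?b)\<^sup>2) + ennreal 8 = ennreal (2 * (ln ?b)\<^sup>2 + 8)"
      by (intro ennreal_plus[symmetric]) auto
    ultimately show ?thesis by (simp only:)
  qed
  also have "\<dots> \<le> ennreal ((2 * (1 + ln exp_const)\<^sup>2 + 8) * (1 + ln (real M))\<^sup>2)"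
  proof (rule ennreal_leI)
    have "ln ?b = ln exp_const + ln (real M)" using b M_pos by (simp add: ln_mult)
    also have "\<dots> \<le> (1 + ln exp_const) * (1 + ln (real M))" using lM by (simp add: algebra_simps)
    finally have "(ln ?b)\<^sup>2 \<le> ((1 + ln exp_const) * (1 + ln (real M)))\<^sup>2"
      using lM b M_pos by (intro power_mono) (auto simp: ln_mult)
    moreover have "1 \<le> (1 + ln (real M))\<^sup>2" using lM by (simp add: one_le_power)
    ultimately show "2 * (ln ?b)\<^sup>2 + 8 \<le> (2 * (1 + ln exp_const)\<^sup>2 + 8) * (1 + ln (real M))\<^sup>2"
      unfolding power_mult_distrib distrib_right[of "2 * (1 + ln exp_const)\<^sup>2"] mult.assoc by linarith
  qed
  finally show ?thesis .
qed

end

text \<open>Depends on the error law alone; it is defined outside the regression locale so that the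
  same constant serves all sample sizes.\<close>

definition (in iid_subgaussian) slack_const :: real where
  "slack_const = (16 * c + sqrt c)\<^sup>2 * (1 + 1 / s2) * (2 * (1 + ln exp_const)\<^sup>2 + 8)"

lemma (in iid_subgaussian) slack_const_nonneg: "0 \<le> slack_const"
  unfolding slack_const_def using s2_pos by simp

section \<open>Block quantities and the oracle inequality for one outcome\<close>

context nested_regression
begin

definition \<Psi> :: real where "\<Psi> = complexity k (tail (\<lambda>l. (a l)\<^sup>2)) M"

definition alpha :: "nat \<Rightarrow> real" where "alpha j = (\<Sum>l\<in>blk j. (a l)\<^sup>2)"
definition cov :: "'a \<Rightarrow> nat \<Rightarrow> real" where "cov \<omega> j = (\<Sum>l\<in>blk j. a l * z l \<omega>)"
definition noise_dev :: "'a \<Rightarrow> nat \<Rightarrow> real" where "noise_dev \<omega> j = (\<Sum>l\<in>blk j. (z l \<omega>)\<^sup>2 - s2)"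
definition size :: "nat \<Rightarrow> real" where "size j = real (k (Suc j)) - real (k j)"
text \<open>The root of \<open>envelope\<close> bounds the normalised sums; 16 c and sqrt c are the
  scales of \<open>chi\<close> and \<open>cross\<close>, and their sum covers both.\<close>

definition amp :: "'a \<Rightarrow> real" where "amp \<omega> = (16 * c + sqrt c) * sqrt (envelope \<omega>) * sqrt \<Psi>"
text \<open>The role of \<open>H\<close>: the factor 1 + 1 / s2 secures both comparisons with the
  squared amplitude, and the last term absorbs the variance estimation error over the total
  dimension \<open>p\<close>.\<close>

definition slack :: "real \<Rightarrow> 'a \<Rightarrow> real" where
  "slack s \<omega> = (amp \<omega>)\<^sup>2 * (1 + 1 / s2) + real p * (s - s2)\<^sup>2 / s2"

lemma \<Psi>_bounds:
  shows ratio_k_le_\<Psi>: "(\<Sum>i<M. sqrt_increment_ratio (\<lambda>j. real (k j)) i) \<le> \<Psi>"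
    and ratio_tail_le_\<Psi>: "(\<Sum>i<M. sqrt_increment_ratio (\<lambda>j. tail (\<lambda>l. (a l)\<^sup>2) (M - j)) i) \<le> \<Psi>"
    and \<Psi>_nonneg: "0 \<le> \<Psi>"
proof -
  show 1: "(\<Sum>i<M. sqrt_increment_ratio (\<lambda>j. real (k j)) i) \<le> \<Psi>"
    unfolding \<Psi>_def by (rule sum_ratio_k_le_complexity) simp
  show "(\<Sum>i<M. sqrt_increment_ratio (\<lambda>j. tail (\<lambda>l. (a l)\<^sup>2) (M - j)) i) \<le> \<Psi>"
    unfolding \<Psi>_def by (rule sum_ratio_tail_le_complexity) simp
  have "0 \<le> (\<Sum>i<M. sqrt_increment_ratio (\<lambda>j. real (k j)) i)"
    using k_less by (intro sum_nonneg) (auto simp: sqrt_increment_ratio_def less_imp_le)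
  with 1 show "0 \<le> \<Psi>" by linarith
qed

lemma size_sum: "(\<Sum>j<M. size j) = real p"
  unfolding size_def using sum_lessThan_telescope[of "\<lambda>j. real (k j)" M] by (simp add: k_0 k_M)

lemma abs_le_of_square_le: "(x / d)\<^sup>2 \<le> y \<Longrightarrow> 0 < d \<Longrightarrow> \<bar>x\<bar> \<le> d * sqrt (y::real)"
proof -
  assume "(x / d)\<^sup>2 \<le> y" and d: "0 < d"
  then have "\<bar>x / d\<bar> \<le> sqrt y" using real_sqrt_le_mono[of "(x / d)\<^sup>2" y] by (simp only: real_sqrt_abs)
  then show ?thesis using d by (simp add: abs_divide field_simps)
qed

text \<open>The outcome and the plug-in value \<open>s\<close> remain parameters, so that the
  deterministic inequality can be used at each outcome with the variance estimate observed
  there.\<close>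

sublocale blocks: mallows_blocks M alpha "cov \<omega>" "noise_dev \<omega>" size s2 "amp \<omega>" "slack s \<omega>" for \<omega> s
proof
  show "0 \<le> alpha j" for j unfolding alpha_def by (intro sum_nonneg) auto
  show "0 \<le> size j" if "j < M" for j using k_less[OF that] by (simp add: size_def)
  show "0 < s2" by (rule s2_pos)
  show amp0: "0 \<le> amp \<omega>"
    unfolding amp_def using c_pos \<Psi>_nonneg envelope_nonneg by (intro mult_nonneg_nonneg) auto
  have q: "0 \<le> real p * (s - s2)\<^sup>2 / s2" using s2_pos by simp
  then show "(amp \<omega>)\<^sup>2 \<le> slack s \<omega>"
    using s2_pos by (simp add: slack_def distrib_left add_increasing2)
  have "s2 * slack s \<omega> = (amp \<omega>)\<^sup>2 + s2 * (amp \<omega>)\<^sup>2 + s2 * (real p * (s - s2)\<^sup>2 / s2)"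
    using s2_pos by (simp add: slack_def algebra_simps)
  moreover have "0 \<le> s2 * (amp \<omega>)\<^sup>2" "0 \<le> s2 * (real p * (s - s2)\<^sup>2 / s2)" using s2_pos q by auto
  ultimately show "(amp \<omega>)\<^sup>2 \<le> s2 * slack s \<omega>" by linarith
  define W where "W = (16 * c + sqrt c) * sqrt (envelope \<omega>)"
  have W: "0 \<le> W" unfolding W_def using c_pos envelope_nonneg by (intro mult_nonneg_nonneg) auto
  have env0: "0 \<le> sqrt (envelope \<omega>)" using envelope_nonneg by simp
  have amp: "amp \<omega> = W * sqrt \<Psi>" by (simp add: amp_def W_def)
  fix h :: "nat \<Rightarrow> real"
  show "\<bar>\<Sum>j<M. h j * noise_dev \<omega> j\<bar> \<le> amp \<omega> * sqrt (\<Sum>j<M. (h j)\<^sup>2 * size j)"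
    if h: "\<And>i. Suc i < M \<Longrightarrow> h (Suc i) \<le> h i" "\<And>i. i < M \<Longrightarrow> 0 \<le> h i"
    unfolding noise_dev_def size_def amp
  proof (rule noise_sum_bound)
    fix j assume j: "1 \<le> j" "j \<le> M"
    have kj: "0 < sqrt (real (k j))" using k_pos[OF j] by simp
    have "\<bar>\<Sum>l<k j. (z l \<omega>)\<^sup>2 - s2\<bar> \<le> (16 * c * sqrt (real (k j))) * sqrt (envelope \<omega>)"
      using chi_le_envelope[OF j, of \<omega>] c_pos kj unfolding chi_def by (intro abs_le_of_square_le) auto
    also have "\<dots> = (16 * c) * (sqrt (envelope \<omega>) * sqrt (real (k j)))" by simp
    also have "\<dots> \<le> (16 * c + sqrt c) * (sqrt (envelope \<omega>) * sqrt (real (k j)))"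
      using c_pos env0 by (intro mult_right_mono) auto
    finally show "\<bar>\<Sum>l<k j. (z l \<omega>)\<^sup>2 - s2\<bar> \<le> W * sqrt (real (k j))"
      by (simp add: W_def mult.assoc)
  qed (use h W ratio_k_le_\<Psi> in auto)
  show "\<bar>\<Sum>j<M. h j * cov \<omega> j\<bar> \<le> amp \<omega> * sqrt (\<Sum>j<M. (h j)\<^sup>2 * alpha j)"
    if h: "\<And>i. Suc i < M \<Longrightarrow> h i \<le> h (Suc i)" "\<And>i. i < M \<Longrightarrow> 0 \<le> h i"
    unfolding cov_def alpha_def amp
  proof (rule bias_sum_bound)
    fix j assume j: "j < M"
    let ?T = "tail (\<lambda>l. (a l)\<^sup>2) j"
    show "\<bar>tail (\<lambda>l. a l * z l \<omega>) j\<bar> \<le> W * sqrt ?T"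
    \<comment> \<open>With no signal left \<open>cross\<close> is 0 by convention and carries no
      information; the tail sum then vanishes because its coefficients do.\<close>
    proof (cases "?T = 0")
      case True
      then have "a l = 0" if "l \<in> {k j..<k M}" for l
        using that unfolding tail_def by (subst (asm) sum_nonneg_eq_0_iff) auto
      then show ?thesis using True by (simp add: tail_def)
    next
      case False
      then have T: "0 < ?T" using tail_nonneg[of "\<lambda>l. (a l)\<^sup>2" j] by (simp add: less_le)
      have "\<bar>tail (\<lambda>l. a l * z l \<omega>) j\<bar> \<le> sqrt (c * ?T) * sqrt (envelope \<omega>)"
        using cross_le_envelope[OF j, of \<omega>] c_pos T unfolding cross_def by (intro abs_le_of_square_le) auto
      also have "\<dots> = sqrt c * (sqrt (envelope \<omega>) * sqrt ?T)" by (simp add: real_sqrt_mult)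
      also have "\<dots> \<le> (16 * c + sqrt c) * (sqrt (envelope \<omega>) * sqrt ?T)"
        using c_pos env0 T by (intro mult_right_mono) auto
      finally show ?thesis by (simp add: W_def mult.assoc)
    qed
  qed (use h W ratio_tail_le_\<Psi> in auto)
qed

lemma card_blk: "j < M \<Longrightarrow> real (card (blk j)) = size j"
  using k_less[of j] by (simp add: size_def)

lemma energy_eq: "j < M \<Longrightarrow> blocks.energy \<omega> j = (\<Sum>l\<in>blk j. (a l + z l \<omega>)\<^sup>2)"
proof -
  assume j: "j < M"
  have "(\<Sum>l\<in>blk j. (a l + z l \<omega>)\<^sup>2) = (\<Sum>l\<in>blk j. (a l)\<^sup>2 + 2 * (a l * z l \<omega>) + ((z l \<omega>)\<^sup>2 - s2) + s2)"
    by (intro sum.cong refl) (simp add: power2_eq_square algebra_simps)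
  also have "\<dots> = alpha j + 2 * cov \<omega> j + noise_dev \<omega> j + s2 * size j"
    by (simp only: sum.distrib sum_distrib_left[symmetric] alpha_def cov_def noise_dev_def sum_constant card_blk[OF j] mult.commute)
  finally show ?thesis by (simp add: blocks.energy_def)
qed

lemma risk_blocks:
  "(\<Sum>l<p. (1 - cumweight k M w l)\<^sup>2 * (a l)\<^sup>2 + s2 * (cumweight k M w l)\<^sup>2) = blocks.risk (tailweight M w)"
proof -
  have "(\<Sum>l<p. (1 - cumweight k M w l)\<^sup>2 * (a l)\<^sup>2 + s2 * (cumweight k M w l)\<^sup>2)
    = (\<Sum>j<M. \<Sum>l\<in>blk j. (1 - tailweight M w j)\<^sup>2 * (a l)\<^sup>2 + s2 * (tailweight M w j)\<^sup>2)"
    by (rule sum_over_blocks[where F="\<lambda>g l. (1 - g)\<^sup>2 * (a l)\<^sup>2 + s2 * g\<^sup>2"])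
  also have "\<dots> = blocks.risk (tailweight M w)"
    unfolding blocks.risk_def
    by (intro sum.cong refl)
       (simp only: sum.distrib sum_distrib_left[symmetric] alpha_def sum_constant card_blk lessThan_iff, simp)
  finally show ?thesis .
qed

lemma loss_blocks:
  "(\<Sum>l<p. (cumweight k M w l * (a l + z l \<omega>) - a l)\<^sup>2) = blocks.loss \<omega> (tailweight M w)"
proof -
  have "(\<Sum>l<p. (cumweight k M w l * (a l + z l \<omega>) - a l)\<^sup>2)
    = (\<Sum>j<M. \<Sum>l\<in>blk j. (tailweight M w j * (a l + z l \<omega>) - a l)\<^sup>2)"
    by (rule sum_over_blocks[where F="\<lambda>g l. (g * (a l + z l \<omega>) - a l)\<^sup>2"])
  also have "\<dots> = blocks.loss \<omega> (tailweight M w)"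
    unfolding blocks.loss_def
  proof (intro sum.cong refl)
    fix j assume "j \<in> {..<M}"
    then have j: "j < M" by simp
    let ?g = "tailweight M w j"
    have "(\<Sum>l\<in>blk j. (?g * (a l + z l \<omega>) - a l)\<^sup>2)
      = (\<Sum>l\<in>blk j. ?g\<^sup>2 * (a l + z l \<omega>)\<^sup>2 - 2 * ?g * ((a l)\<^sup>2 + a l * z l \<omega>) + (a l)\<^sup>2)"
      by (rule sum.cong[OF refl]) (simp add: power2_eq_square algebra_simps)
    also have "\<dots> = ?g\<^sup>2 * blocks.energy \<omega> j - 2 * ?g * (alpha j + cov \<omega> j) + alpha j"
      by (simp only: sum.distrib sum_subtractf sum_distrib_left[symmetric] alpha_def cov_def energy_eq[OF j])
    finally show "(\<Sum>l\<in>blk j. (?g * (a l + z l \<omega>) - a l)\<^sup>2)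
      = ?g\<^sup>2 * blocks.energy \<omega> j - 2 * ?g * (alpha j + cov \<omega> j) + alpha j" .
  qed
  finally show ?thesis .
qed

lemma crit_blocks: "real n * Cn n X k M s w (obs \<omega>) = sq n (obs \<omega>) + blocks.crit \<omega> s (tailweight M w)"
proof -
  have "(\<Sum>l<p. ((cumweight k M w l)\<^sup>2 - 2 * cumweight k M w l) * (a l + z l \<omega>)\<^sup>2 + 2 * s * cumweight k M w l)
    = (\<Sum>j<M. \<Sum>l\<in>blk j. ((tailweight M w j)\<^sup>2 - 2 * tailweight M w j) * (a l + z l \<omega>)\<^sup>2 + 2 * s * tailweight M w j)"
    by (rule sum_over_blocks[where F="\<lambda>g l. (g\<^sup>2 - 2 * g) * (a l + z l \<omega>)\<^sup>2 + 2 * s * g"])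
  also have "\<dots> = blocks.crit \<omega> s (tailweight M w)"
    unfolding blocks.crit_def
  proof (intro sum.cong refl)
    fix j assume "j \<in> {..<M}"
    then have j: "j < M" by simp
    let ?g = "tailweight M w j"
    show "(\<Sum>l\<in>blk j. (?g\<^sup>2 - 2 * ?g) * (a l + z l \<omega>)\<^sup>2 + 2 * s * ?g)
      = (?g\<^sup>2 - 2 * ?g) * blocks.energy \<omega> j + 2 * s * (?g * size j)"
      using card_blk[OF j] by (simp add: sum.distrib sum_distrib_left[symmetric] energy_eq[OF j])
  qed
  finally show ?thesis unfolding crit_eq by simp
qed

lemma admissible_tailweight: "w \<in> wsimplex M \<Longrightarrow> blocks.admissible (tailweight M w)"
  unfolding blocks.admissible_def
  using tailweight_dec tailweight_nonneg tailweight_le_1 by (metis Suc_lessD)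

text \<open>One right-hand side for both readings of Q: the actual loss of the selected weights, and
  the risk formula evaluated at them. The comparison weights \<open>w0\<close> are free, so
  deterministic ones can be inserted before integrating.\<close>

lemma oracle_pointwise:
  assumes w: "w \<in> wsimplex M" and w0: "w0 \<in> wsimplex M"
    and min: "Cn n X k M s w (obs \<omega>) \<le> Cn n X k M s w0 (obs \<omega>)"
    and \<eta>: "0 < \<eta>" "\<eta> \<le> 1/2"
  shows "sq n (\<lambda>i. maest n X k M w (obs \<omega>) i - mean i)
      \<le> (1 + 7 * \<eta>) * blocks.risk (tailweight M w0) + 200 * slack s \<omega> / \<eta>"
    and "sq n (\<lambda>i. mean i - maest n X k M w mean i) + s2 * (\<Sum>i<n. \<Sum>j<n. (mamat n X k M w i j)\<^sup>2)
      \<le> (1 + 7 * \<eta>) * blocks.risk (tailweight M w0) + 200 * slack s \<omega> / \<eta>"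
proof -
  have "real n * Cn n X k M s w (obs \<omega>) \<le> real n * Cn n X k M s w0 (obs \<omega>)"
    using min by (intro mult_left_mono) auto
  then have crit: "blocks.crit \<omega> s (tailweight M w) \<le> blocks.crit \<omega> s (tailweight M w0)"
    unfolding crit_blocks by simp
  have s: "(s - s2)\<^sup>2 * (\<Sum>j<M. size j) \<le> s2 * slack s \<omega>"
  proof -
    have "s2 * slack s \<omega> = s2 * ((amp \<omega>)\<^sup>2 * (1 + 1 / s2)) + (s - s2)\<^sup>2 * real p"
      using s2_pos by (simp add: slack_def distrib_left)
    moreover have "0 \<le> s2 * ((amp \<omega>)\<^sup>2 * (1 + 1 / s2))" using s2_pos by simp
    ultimately show ?thesis unfolding size_sum by linarith
  qed
  note oi = blocks.oracle_inequality[OF admissible_tailweight[OF w] admissible_tailweight[OF w0] crit s \<eta>]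
  have "sq n (\<lambda>i. maest n X k M w (obs \<omega>) i - mean i) = blocks.loss \<omega> (tailweight M w)"
    unfolding loss_blocks[symmetric] by (rule loss_eq) (rule k_le_p')
  then show "sq n (\<lambda>i. maest n X k M w (obs \<omega>) i - mean i)
      \<le> (1 + 7 * \<eta>) * blocks.risk (tailweight M w0) + 200 * slack s \<omega> / \<eta>"
    using oi(2) by simp
  have "sq n (\<lambda>i. mean i - maest n X k M w mean i) = (\<Sum>l<p. (1 - cumweight k M w l)\<^sup>2 * (a l)\<^sup>2)"
    by (rule bias_eq) (rule k_le_p')
  moreover have "(\<Sum>i<n. \<Sum>j<n. (mamat n X k M w i j)\<^sup>2) = (\<Sum>l<p. (cumweight k M w l)\<^sup>2)"
    by (rule mamat_square_sum) (rule k_le_p')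
  ultimately have "sq n (\<lambda>i. mean i - maest n X k M w mean i) + s2 * (\<Sum>i<n. \<Sum>j<n. (mamat n X k M w i j)\<^sup>2)
      = blocks.risk (tailweight M w)"
    unfolding risk_blocks[symmetric] by (simp add: sum.distrib sum_distrib_left)
  then show "sq n (\<lambda>i. mean i - maest n X k M w mean i) + s2 * (\<Sum>i<n. \<Sum>j<n. (mamat n X k M w i j)\<^sup>2)
      \<le> (1 + 7 * \<eta>) * blocks.risk (tailweight M w0) + 200 * slack s \<omega> / \<eta>"
    using oi(1) by simp
qed

section \<open>Comparison weights built from weights on all nested models\<close>

lemma grouped_weight_exists:
  assumes w: "w \<in> wsimplex p" and \<zeta>: "0 \<le> \<zeta>"
    and ratio: "\<And>j. 1 \<le> j \<Longrightarrow> j < M \<Longrightarrow> real (k (Suc j)) - real (k j) \<le> (1 + \<zeta>) * (real (k j) - real (k (j - 1)))"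
  shows "\<exists>w0\<in>wsimplex M. blocks.risk (tailweight M w0) \<le> (1 + \<zeta>) * (real n * riskMA P eps n X mean id p w) + s2 * real (k 1)"
proof -
  define g where "g = tailweight p w"
  have cg: "cumweight id p w l = g l" for l
    unfolding cumweight_def g_def tailweight_def by (rule sum.mono_neutral_cong_right) auto
  have g: "g l \<le> g i" if "i \<le> l" "l < p" for i l
    using that
  proof (induction l)
    case (Suc l)
    then show ?case using tailweight_dec[OF w, of l] by (cases "i = Suc l") (auto simp: g_def)
  qed simp
  have g01: "0 \<le> g l" "g l \<le> 1" for l using tailweight_nonneg[OF w] tailweight_le_1[OF w] by (auto simp: g_def)
  have g0: "g 0 = 1" using tailweight_0[OF w] by (simp add: g_def)
  \<comment> \<open>The prescribed cumulative weights of the blocks. The value 0 at M lets the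
    differences \<open>w0\<close> sum back to \<gamma>, and the value 1 at 0 gives them total mass
    1.\<close>
  define \<gamma> where "\<gamma> j = (if j < M then g (k j) else 0)" for j
  define w0 where "w0 m = \<gamma> (m - 1) - \<gamma> m" for m
  have klt: "k j < p" if "j < M" for j using k_less[OF that] k_le_p[of "Suc j"] that by simp
  have dec: "\<gamma> (Suc j) \<le> \<gamma> j" for j
    using g[of "k j" "k (Suc j)"] k_less[of j] klt[of "Suc j"] g01 by (auto simp: \<gamma>_def)
  have tw: "tailweight M w0 j = \<gamma> j" if "j \<le> M" for j
    using that
  proof (induction j rule: inc_induct)
    case base
    then show ?case by (simp add: tailweight_def \<gamma>_def)
  next
    case (step j)
    then show ?case by (simp add: tailweight_Suc w0_def)
  qed
  have nonneg: "0 \<le> w0 m" if "1 \<le> m" for m using dec[of "m - 1"] that by (simp add: w0_def)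
  have le1: "w0 m \<le> 1" for m
  proof -
    have "\<gamma> (m - 1) \<le> 1" "0 \<le> \<gamma> m" using g01 by (auto simp: \<gamma>_def)
    then show ?thesis by (simp add: w0_def)
  qed
  have "(\<Sum>m=1..M. w0 m) = 1" using tw[of 0] g0 M_pos k_0 by (simp add: tailweight_def \<gamma>_def)
  then have "w0 \<in> wsimplex M" using nonneg le1 by (auto simp: wsimplex_def)
  moreover have "blocks.risk (tailweight M w0) \<le> (1 + \<zeta>) * (real n * riskMA P eps n X mean id p w) + s2 * real (k 1)"
  proof -
    have "blocks.risk (tailweight M w0) = (\<Sum>j<M. (1 - g (k j))\<^sup>2 * (\<Sum>l\<in>blk j. (a l)\<^sup>2) + s2 * ((g (k j))\<^sup>2 * (real (k (Suc j)) - real (k j))))"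
      unfolding blocks.risk_def alpha_def size_def by (intro sum.cong refl) (simp add: tw \<gamma>_def)
    also have "\<dots> \<le> (1 + \<zeta>) * (\<Sum>l<k M. (1 - g l)\<^sup>2 * (a l)\<^sup>2 + s2 * (g l)\<^sup>2) + s2 * real (k 1)"
    proof (rule grouped_risk_le)
      show "0 \<le> s2" using s2_pos by simp
    qed (use g g01 \<zeta> ratio k_M in auto)
    also have "(\<Sum>l<k M. (1 - g l)\<^sup>2 * (a l)\<^sup>2 + s2 * (g l)\<^sup>2) = real n * riskMA P eps n X mean id p w"
      unfolding k_M cg[symmetric] by (rule riskMA_eq[symmetric]) simp
    finally show ?thesis .
  qed
  ultimately show ?thesis by blast
qed

section \<open>Expected slack, optimal risk and the bound for fixed sample size\<close>

lemma nn_integral_slack_le: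
  assumes [measurable]: "S \<in> borel_measurable P" and int: "integrable P (\<lambda>\<omega>. (S \<omega> - s2)\<^sup>2)"
  shows "(\<integral>\<^sup>+\<omega>. ennreal (slack (S \<omega>) \<omega>) \<partial>P)
    \<le> ennreal (slack_const * (\<Psi> * (1 + ln (real M))\<^sup>2) + real p * expectation (\<lambda>\<omega>. (S \<omega> - s2)\<^sup>2) / s2)"
proof -
  let ?A = "(16 * c + sqrt c)\<^sup>2 * (1 + 1 / s2) * \<Psi>" and ?B = "real p / s2"
  let ?C = "(2 * (1 + ln exp_const)\<^sup>2 + 8) * (1 + ln (real M))\<^sup>2"
  have A: "0 \<le> ?A" using \<Psi>_nonneg s2_pos by simp
  have B: "0 \<le> ?B" using s2_pos by simp
  have eq: "slack (S \<omega>) \<omega> = ?A * envelope \<omega> + ?B * (S \<omega> - s2)\<^sup>2" for \<omega>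
    using envelope_nonneg[of \<omega>] \<Psi>_nonneg by (simp add: slack_def amp_def power_mult_distrib)
  have "(\<integral>\<^sup>+\<omega>. ennreal (slack (S \<omega>) \<omega>) \<partial>P)
     = (\<integral>\<^sup>+\<omega>. ennreal ?A * ennreal (envelope \<omega>) + ennreal ?B * ennreal ((S \<omega> - s2)\<^sup>2) \<partial>P)"
  proof (rule nn_integral_cong)
    fix \<omega>
    have "ennreal (slack (S \<omega>) \<omega>) = ennreal (?A * envelope \<omega>) + ennreal (?B * (S \<omega> - s2)\<^sup>2)"
      unfolding eq by (rule ennreal_plus) (rule mult_nonneg_nonneg A B envelope_nonneg zero_le_power2)+
    then show "ennreal (slack (S \<omega>) \<omega>) = ennreal ?A * ennreal (envelope \<omega>) + ennreal ?B * ennreal ((S \<omega> - s2)\<^sup>2)"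
      unfolding ennreal_mult[OF A envelope_nonneg] ennreal_mult[OF B zero_le_power2] .
  qed
  also have "\<dots> = ennreal ?A * (\<integral>\<^sup>+\<omega>. ennreal (envelope \<omega>) \<partial>P) + ennreal ?B * (\<integral>\<^sup>+\<omega>. ennreal ((S \<omega> - s2)\<^sup>2) \<partial>P)"
  proof -
    have "(\<integral>\<^sup>+\<omega>. x * ennreal (envelope \<omega>) + y * ennreal ((S \<omega> - s2)\<^sup>2) \<partial>P)
      = x * (\<integral>\<^sup>+\<omega>. ennreal (envelope \<omega>) \<partial>P) + y * (\<integral>\<^sup>+\<omega>. ennreal ((S \<omega> - s2)\<^sup>2) \<partial>P)" for x y
      by (simp add: nn_integral_add nn_integral_cmult)
    then show ?thesis .
  qed
  also have "(\<integral>\<^sup>+\<omega>. ennreal ((S \<omega> - s2)\<^sup>2) \<partial>P) = ennreal (expectation (\<lambda>\<omega>. (S \<omega> - s2)\<^sup>2))"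
    by (rule nn_integral_eq_integral[OF int]) simp
  also have "ennreal ?A * (\<integral>\<^sup>+\<omega>. ennreal (envelope \<omega>) \<partial>P) + ennreal ?B * ennreal (expectation (\<lambda>\<omega>. (S \<omega> - s2)\<^sup>2))
      \<le> ennreal ?A * ennreal ?C + ennreal ?B * ennreal (expectation (\<lambda>\<omega>. (S \<omega> - s2)\<^sup>2))"
    by (intro add_mono mult_left_mono nn_integral_envelope_le) auto
  also have "\<dots> = ennreal (?A * ?C + ?B * expectation (\<lambda>\<omega>. (S \<omega> - s2)\<^sup>2))"
  proof -
    have C: "0 \<le> ?C" by simp
    have E: "0 \<le> expectation (\<lambda>\<omega>. (S \<omega> - s2)\<^sup>2)" by (intro Bochner_Integration.integral_nonneg) auto
    show ?thesis
      unfolding ennreal_mult[OF A C, symmetric] ennreal_mult[OF B E, symmetric]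
      by (rule ennreal_plus[symmetric]) (intro mult_nonneg_nonneg A B C E)+
  qed
  finally show ?thesis by (simp add: slack_const_def mult_ac)
qed

lemma wsimplex_nonempty: "wsimplex p \<noteq> {}"
proof -
  have p0: "0 < p" using k_pos[of M] M_pos k_M by simp
  have "(\<lambda>m. if m = 1 then 1 else 0) \<in> wsimplex p"
    using p0 by (auto simp: wsimplex_def)
  then show ?thesis by blast
qed

lemma riskMA_nonneg: "0 \<le> riskMA P eps n X f k' M' w"
  unfolding riskMA_def by (intro mult_nonneg_nonneg Bochner_Integration.integral_nonneg) (auto simp: sq_nonneg)

lemma Rstar_nonneg: "0 \<le> Rstar P eps n X f p"
  unfolding Rstar_def using wsimplex_nonempty by (intro cINF_greatest riskMA_nonneg) auto

text \<open>\<open>Rstar\<close> is an infimum. Instead of inserting a minimiser, the bound is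
  solved for the risk of an arbitrary \<open>w\<close> and passed to the infimum; one weight vector
  suffices to see that \<open>L\<close> is finite.\<close>

lemma Rstar_bound:
  assumes L: "\<And>w. w \<in> wsimplex p \<Longrightarrow> L \<le> ennreal (b + \<kappa> * riskMA P eps n X mean id p w)" and \<kappa>: "0 < \<kappa>" and b: "0 \<le> b"
  shows "L \<le> ennreal (b + \<kappa> * Rstar P eps n X mean p)"
proof -
  obtain w1 where w1: "w1 \<in> wsimplex p" using wsimplex_nonempty by blast
  have "L < top" using L[OF w1] by (rule le_less_trans) simp
  then obtain x where x: "L = ennreal x" "0 \<le> x" by (cases L) auto
  have "(x - b) / \<kappa> \<le> riskMA P eps n X mean id p w" if "w \<in> wsimplex p" for w
    using L[OF that] \<kappa> b riskMA_nonneg[of mean id p w] unfolding x(1) by (subst (asm) ennreal_le_iff) (auto simp: field_simps)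
  then have "(x - b) / \<kappa> \<le> Rstar P eps n X mean p"
    unfolding Rstar_def using wsimplex_nonempty by (intro cINF_greatest) auto
  then have "x \<le> b + \<kappa> * Rstar P eps n X mean p" using \<kappa> by (simp add: field_simps)
  then show ?thesis unfolding x(1) by (rule ennreal_leI)
qed

text \<open>\<open>G\<close> is abstract so that it covers the actual loss as well as the risk
  formula at the selected weights. The grouped weights are chosen before integrating, so only
  \<open>slack\<close> remains random on the right.\<close>

lemma expected_bound:
  assumes S: "S \<in> borel_measurable P" and int: "integrable P (\<lambda>\<omega>. (S \<omega> - s2)\<^sup>2)"
    and \<zeta>: "0 \<le> \<zeta>"
    and ratio: "\<And>j. 1 \<le> j \<Longrightarrow> j < M \<Longrightarrow> real (k (Suc j)) - real (k j) \<le> (1 + \<zeta>) * (real (k j) - real (k (j - 1)))"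
    and \<eta>: "0 < \<eta>" "\<eta> \<le> 1/2"
    and G: "\<And>\<omega> w0. w0 \<in> wsimplex M \<Longrightarrow> G \<omega> \<le> (1 + 7 * \<eta>) * blocks.risk (tailweight M w0) + 200 * slack (S \<omega>) \<omega> / \<eta>"
  shows "(\<integral>\<^sup>+\<omega>. ennreal (G \<omega>) \<partial>P) \<le> ennreal
     ((1 + 7 * \<eta>) * ((1 + \<zeta>) * (real n * Rstar P eps n X mean p) + s2 * real (k 1))
      + 200 / \<eta> * (slack_const * (\<Psi> * (1 + ln (real M))\<^sup>2) + real p * expectation (\<lambda>\<omega>. (S \<omega> - s2)\<^sup>2) / s2))"
proof -
  let ?D = "slack_const * (\<Psi> * (1 + ln (real M))\<^sup>2) + real p * expectation (\<lambda>\<omega>. (S \<omega> - s2)\<^sup>2) / s2"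
  have D0: "0 \<le> ?D" using slack_const_nonneg \<Psi>_nonneg s2_pos by (intro add_nonneg_nonneg mult_nonneg_nonneg divide_nonneg_pos) auto
  have [measurable]: "(\<lambda>\<omega>. slack (S \<omega>) \<omega>) \<in> borel_measurable P"
    using S unfolding slack_def amp_def by measurable
  have slack0: "0 \<le> slack s \<omega>" for s \<omega> using blocks.H_nonneg by simp
  let ?b = "(1 + 7 * \<eta>) * (s2 * real (k 1)) + 200 / \<eta> * ?D" and ?\<kappa> = "(1 + 7 * \<eta>) * (1 + \<zeta>) * real n"
  have "(\<integral>\<^sup>+\<omega>. ennreal (G \<omega>) \<partial>P) \<le> ennreal (?b + ?\<kappa> * riskMA P eps n X mean id p w)" if w: "w \<in> wsimplex p" for w
  proof -
    obtain w0 where w0: "w0 \<in> wsimplex M"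
      "blocks.risk (tailweight M w0) \<le> (1 + \<zeta>) * (real n * riskMA P eps n X mean id p w) + s2 * real (k 1)"
      using grouped_weight_exists[OF w \<zeta> ratio] by blast
    let ?r = "(1 + 7 * \<eta>) * blocks.risk (tailweight M w0)"
    have r0: "0 \<le> ?r" using \<eta> blocks.risk_nonneg by simp
    have "(\<integral>\<^sup>+\<omega>. ennreal (G \<omega>) \<partial>P) \<le> (\<integral>\<^sup>+\<omega>. ennreal ?r + ennreal (200 / \<eta>) * ennreal (slack (S \<omega>) \<omega>) \<partial>P)"
    proof (rule nn_integral_mono)
      fix \<omega>
      have "ennreal (G \<omega>) \<le> ennreal (?r + 200 / \<eta> * slack (S \<omega>) \<omega>)"
        using G[OF w0(1), of \<omega>] by (intro ennreal_leI) simp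
      also have "\<dots> = ennreal ?r + ennreal (200 / \<eta>) * ennreal (slack (S \<omega>) \<omega>)"
        using r0 \<eta> slack0[of "S \<omega>" \<omega>]
        by (subst ennreal_mult[symmetric]) (auto simp: ennreal_plus[symmetric] simp del: ennreal_plus)
      finally show "ennreal (G \<omega>) \<le> ennreal ?r + ennreal (200 / \<eta>) * ennreal (slack (S \<omega>) \<omega>)" .
    qed
    also have "\<dots> = ennreal ?r + ennreal (200 / \<eta>) * (\<integral>\<^sup>+\<omega>. ennreal (slack (S \<omega>) \<omega>) \<partial>P)"
      by (simp add: nn_integral_add nn_integral_cmult emeasure_space_1)
    also have "\<dots> \<le> ennreal ?r + ennreal (200 / \<eta>) * ennreal ?D"
      by (intro add_left_mono mult_left_mono nn_integral_slack_le S int) simp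
    also have "\<dots> = ennreal (?r + 200 / \<eta> * ?D)"
      using r0 \<eta> D0 by (subst ennreal_mult[symmetric]) (auto simp: ennreal_plus[symmetric] simp del: ennreal_plus)
    also have "\<dots> \<le> ennreal (?b + ?\<kappa> * riskMA P eps n X mean id p w)"
    proof (rule ennreal_leI)
      have "?r \<le> (1 + 7 * \<eta>) * ((1 + \<zeta>) * (real n * riskMA P eps n X mean id p w) + s2 * real (k 1))"
        using w0(2) \<eta> by (intro mult_left_mono) auto
      also have "\<dots> = (1 + 7 * \<eta>) * (s2 * real (k 1)) + ?\<kappa> * riskMA P eps n X mean id p w"
        by (subst distrib_left[of "1 + 7 * \<eta>" "(1 + \<zeta>) * (real n * riskMA P eps n X mean id p w)"]) (simp only: mult.assoc add.commute)
      finally show "?r + 200 / \<eta> * ?D \<le> ?b + ?\<kappa> * riskMA P eps n X mean id p w" by linarith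
    qed
    finally show ?thesis .
  qed
  then have "(\<integral>\<^sup>+\<omega>. ennreal (G \<omega>) \<partial>P) \<le> ennreal (?b + ?\<kappa> * Rstar P eps n X mean p)"
  proof (rule Rstar_bound)
    show "0 < ?\<kappa>" using \<eta> \<zeta> n_pos by (intro mult_pos_pos) auto
    have "0 \<le> (1 + 7 * \<eta>) * (s2 * real (k 1))" using \<eta> s2_pos by simp
    moreover have "0 \<le> 200 / \<eta> * ?D" by (rule mult_nonneg_nonneg[OF _ D0]) (use \<eta> in simp)
    ultimately show "0 \<le> ?b" by (rule add_nonneg_nonneg)
  qed
  also have "?b + ?\<kappa> * Rstar P eps n X mean p = (1 + 7 * \<eta>) * ((1 + \<zeta>) * (real n * Rstar P eps n X mean p) + s2 * real (k 1))
      + 200 / \<eta> * ?D"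
    by (subst distrib_left[of "1 + 7 * \<eta>" "(1 + \<zeta>) * (real n * Rstar P eps n X mean p)"]) (simp only: mult.assoc add_ac)
  finally show ?thesis .
qed

text \<open>\<open>Ssum\<close> is the tail of the squared coefficients divided by n; neither the
  place where it vanishes nor any quotient is affected by that factor.\<close>

lemma psi_eq: "psi n X mean k M = \<Psi> * (1 + ln (real M))\<^sup>2"
proof -
  have S: "Ssum n X mean k M j = tail (\<lambda>l. (a l)\<^sup>2) j / real n" if "j \<le> M" for j
  proof -
    have "Ssum n X mean k M j = (\<Sum>l\<in>{k j..<k M}. (theta n X mean (Suc l))\<^sup>2)"
      unfolding Ssum_def by (rule sum.reindex_bij_witness[of _ Suc "\<lambda>l. l - 1"]) auto
    also have "\<dots> = (\<Sum>l\<in>{k j..<k M}. (a l)\<^sup>2 / real n)"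
      by (intro sum.cong refl) (simp add: k_M theta_square a_def ip_commute[of n mean])
    finally show ?thesis by (simp add: tail_def sum_divide_distrib)
  qed
  have M': "Mprime n X mean k M = (LEAST j. 1 \<le> j \<and> j \<le> M \<and> tail (\<lambda>l. (a l)\<^sup>2) j = 0)"
    unfolding Mprime_def using S n_pos by (intro arg_cong[where f=Least] ext) auto
  have "(LEAST j. 1 \<le> j \<and> j \<le> M \<and> tail (\<lambda>l. (a l)\<^sup>2) j = 0) \<le> M"
    using M_pos tail_M by (intro Least_le) auto
  then have "(\<Sum>j=1..Mprime n X mean k M - 1. (Ssum n X mean k M (j-1) - Ssum n X mean k M j) / (4 * Ssum n X mean k M j))
    = (\<Sum>j=1..(LEAST j. 1 \<le> j \<and> j \<le> M \<and> tail (\<lambda>l. (a l)\<^sup>2) j = 0) - 1.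
        (tail (\<lambda>l. (a l)\<^sup>2) (j-1) - tail (\<lambda>l. (a l)\<^sup>2) j) / (4 * tail (\<lambda>l. (a l)\<^sup>2) j))"
    unfolding M'
  proof (intro sum.cong refl)
    fix j assume "j \<in> {1..(LEAST j. 1 \<le> j \<and> j \<le> M \<and> tail (\<lambda>l. (a l)\<^sup>2) j = 0) - 1}"
      "(LEAST j. 1 \<le> j \<and> j \<le> M \<and> tail (\<lambda>l. (a l)\<^sup>2) j = 0) \<le> M"
    then have "j \<le> M" "j - 1 \<le> M" by auto
    then show "(Ssum n X mean k M (j-1) - Ssum n X mean k M j) / (4 * Ssum n X mean k M j)
      = (tail (\<lambda>l. (a l)\<^sup>2) (j-1) - tail (\<lambda>l. (a l)\<^sup>2) j) / (4 * tail (\<lambda>l. (a l)\<^sup>2) j)"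
      using n_pos by (simp add: S diff_divide_distrib[symmetric])
  qed
  then show ?thesis unfolding psi_def \<Psi>_def complexity_def by simp
qed

end

section \<open>The asymptotic statement\<close>

theorem theorem3:
  fixes P :: "'a measure"
    and eps :: "nat \<Rightarrow> 'a \<Rightarrow> real"
    and sigma2 :: real
    and X :: "nat \<Rightarrow> nat \<Rightarrow> nat \<Rightarrow> real"
    and beta :: "nat \<Rightarrow> nat \<Rightarrow> real"
    and p :: "nat \<Rightarrow> nat"
    and Mn :: "nat \<Rightarrow> nat"
    and k :: "nat \<Rightarrow> nat \<Rightarrow> nat"
    and zeta :: "nat \<Rightarrow> real"
    and sighat :: "nat \<Rightarrow> (nat \<Rightarrow> real) \<Rightarrow> real"
    and what :: "nat \<Rightarrow> (nat \<Rightarrow> real) \<Rightarrow> nat \<Rightarrow> real"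
    and f :: "nat \<Rightarrow> nat \<Rightarrow> real"
    and y :: "nat \<Rightarrow> 'a \<Rightarrow> nat \<Rightarrow> real"
  defines "f \<equiv> (\<lambda>n. fvec n (X n) (beta n) (p n))"
    and "y \<equiv> (\<lambda>n \<omega>. yvec n (f n) eps \<omega>)"
  assumes prob: "prob_space P"
    \<comment> \<open>errors: i.i.d., sub-Gaussian, mean 0, variance sigma2 > 0\<close>
    and eps_meas: "\<And>i. eps i \<in> borel_measurable P"
    and eps_indep: "prob_space.indep_vars P (\<lambda>_. borel) eps UNIV"
    and eps_ident: "\<And>i. distr P borel (eps i) = distr P borel (eps 0)"
    and eps_subg: "\<exists>c. \<forall>t. integrable P (\<lambda>\<omega>. exp (t * eps 0 \<omega>)) \<and>
                     (\<integral>\<omega>. exp (t * eps 0 \<omega>) \<partial>P) \<le> exp (c * t^2 / 2)"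
    and eps_mean: "(\<integral>\<omega>. eps 0 \<omega> \<partial>P) = 0"
    and eps_var: "(\<integral>\<omega>. (eps 0 \<omega>)^2 \<partial>P) = sigma2"
    and sigma_pos: "sigma2 > 0"
    \<comment> \<open>design: n x p_n, p_n <= n, full column rank\<close>
    and p_le: "\<And>n. n \<ge> 1 \<Longrightarrow> p n \<le> n"
    and X_rank: "\<And>n c. n \<ge> 1 \<Longrightarrow> (\<forall>i<n. (\<Sum>l<p n. c l * X n i l) = 0) \<Longrightarrow> (\<forall>l<p n. c l = 0)"
    \<comment> \<open>Assumption 1\<close>
    and assm1: "limsup (\<lambda>n. ereal (sq n (f n) / real n)) < \<infinity>"
    \<comment> \<open>the candidate set M_G\<close>
    and Mn_pos: "\<And>n. n \<ge> 1 \<Longrightarrow> Mn n \<ge> 1"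
    and k0: "\<And>n. n \<ge> 1 \<Longrightarrow> k n 0 = 0"
    and k1: "\<And>n. n \<ge> 1 \<Longrightarrow> 1 \<le> k n 1"
    and k_mono: "\<And>n j. n \<ge> 1 \<Longrightarrow> 1 \<le> j \<Longrightarrow> j < Mn n \<Longrightarrow> k n j < k n (j + 1)"
    and k_last: "\<And>n. n \<ge> 1 \<Longrightarrow> k n (Mn n) = p n"
    and zeta_nonneg: "\<And>n. zeta n \<ge> 0"
    and ratio: "\<And>n j. n \<ge> 1 \<Longrightarrow> 1 \<le> j \<Longrightarrow> j \<le> Mn n - 1 \<Longrightarrow>
        (real (k n (j + 1)) - real (k n j)) / (real (k n j) - real (k n (j - 1))) \<le> 1 + zeta n"
    \<comment> \<open>the variance estimator and MMA weights\<close>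
    and sighat_meas: "\<And>n. (\<lambda>\<omega>. sighat n (y n \<omega>)) \<in> borel_measurable P"
    and what_min: "\<And>n v. n \<ge> 1 \<Longrightarrow> what n v \<in> wsimplex (Mn n) \<and>
        (\<forall>w\<in>wsimplex (Mn n). Cn n (X n) (k n) (Mn n) (sighat n v) (what n v) v
                            \<le> Cn n (X n) (k n) (Mn n) (sighat n v) w v)"
    and what_meas: "\<And>n m. (\<lambda>\<omega>. what n (y n \<omega>) m) \<in> borel_measurable P"
    \<comment> \<open>rate conditions\<close>
    and zeta_lim: "zeta \<longlonglongrightarrow> 0"
    and cond_psi: "(\<lambda>n. max (real (k n 1)) (psi n (X n) (f n) (k n) (Mn n)))
                     \<in> o(\<lambda>n. real n * Rstar P eps n (X n) (f n) (p n))"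
    and sighat_int: "eventually (\<lambda>n. integrable P (\<lambda>\<omega>. (sighat n (y n \<omega>) - sigma2)^2)) sequentially"
    and cond_sighat: "(\<lambda>n. real (p n) * (\<integral>\<omega>. (sighat n (y n \<omega>) - sigma2)^2 \<partial>P))
                     \<in> o(\<lambda>n. real n * Rstar P eps n (X n) (f n) (p n))"
  shows "\<exists>\<delta>. \<delta> \<longlonglongrightarrow> 0 \<and>
    eventually (\<lambda>n.
      ennreal (1 / real n) *
        (\<integral>\<^sup>+\<omega>. ennreal (sq n (\<lambda>i. maest n (X n) (k n) (Mn n) (what n (y n \<omega>)) (y n \<omega>) i - f n i)) \<partial>P)
        \<le> ennreal ((1 + \<delta> n) * Rstar P eps n (X n) (f n) (p n))
      \<and>
      ennreal (1 / real n) *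
        (\<integral>\<^sup>+\<omega>. ennreal (sq n (\<lambda>i. f n i - maest n (X n) (k n) (Mn n) (what n (y n \<omega>)) (f n) i)) \<partial>P)
      + ennreal (sigma2 / real n) *
        (\<integral>\<^sup>+\<omega>. ennreal (\<Sum>a<n. \<Sum>b<n. (mamat n (X n) (k n) (Mn n) (what n (y n \<omega>)) a b)^2) \<partial>P)
        \<le> ennreal ((1 + \<delta> n) * Rstar P eps n (X n) (f n) (p n))) sequentially"
proof -
  interpret prob_space P by (rule prob)
  obtain c0 where c0: "\<And>t. integrable P (\<lambda>\<omega>. exp (t * eps 0 \<omega>))"
    "\<And>t. (\<integral>\<omega>. exp (t * eps 0 \<omega>) \<partial>P) \<le> exp (c0 * t\<^sup>2 / 2)" using eps_subg by auto
  \<comment> \<open>Sub-Gaussianity supplies some real constant; enlarging it keeps the bound and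
    makes it positive.\<close>
  define c where "c = max c0 1"
  interpret E: iid_subgaussian P eps sigma2 c
  proof
    fix t :: real
    have "c0 * t\<^sup>2 / 2 \<le> c * t\<^sup>2 / 2" by (intro divide_right_mono mult_right_mono) (auto simp: c_def)
    then show "(\<integral>\<omega>. exp (t * eps 0 \<omega>) \<partial>P) \<le> exp (c * t\<^sup>2 / 2)"
      using c0(2)[of t] by (meson exp_le_cancel_iff order_trans)
  qed (use eps_meas eps_indep eps_ident c0 eps_mean eps_var sigma_pos in \<open>auto simp: c_def\<close>)
  define R where "R n = real n * Rstar P eps n (X n) (f n) (p n)" for n
  define A where "A n = max (real (k n 1)) (psi n (X n) (f n) (k n) (Mn n))" for n
  define V where "V n = real (p n) * (\<integral>\<omega>. (sighat n (y n \<omega>) - sigma2)\<^sup>2 \<partial>P)" for n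
  \<comment> \<open>One null sequence carrying both rate conditions.\<close>
  define B where "B n = A n / R n + V n / R n" for n
  \<comment> \<open>The root balances \<eta> against B / \<eta>; the added null sequence makes
    positivity immediate.\<close>
  define \<eta> where "\<eta> n = sqrt (B n) + inverse (real (Suc n))" for n
  \<comment> \<open>Read off from \<open>total\<close> below: the product collects the relative
    errors multiplying the optimal risk, the last term the slack divided by \<eta>.\<close>
  define \<delta> where "\<delta> n = (1 + 7 * \<eta> n) * (1 + zeta n + sigma2 * B n)
      + 200 * (E.slack_const + 1 / sigma2) * sqrt (B n) - 1" for n
  have A_o: "A \<in> o(R)" and V_o: "V \<in> o(R)"
    using cond_psi cond_sighat unfolding A_def[abs_def] V_def[abs_def] R_def[abs_def] by simp_all
  have B_lim: "B \<longlonglongrightarrow> 0"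
    unfolding B_def[abs_def] using tendsto_add[OF smalloD_tendsto[OF A_o] smalloD_tendsto[OF V_o]] by simp
  have \<eta>_lim: "\<eta> \<longlonglongrightarrow> 0"
    unfolding \<eta>_def[abs_def]
    using tendsto_add[OF tendsto_real_sqrt[OF B_lim] LIMSEQ_inverse_real_of_nat] by simp
  have \<delta>_lim: "\<delta> \<longlonglongrightarrow> 0"
  proof -
    have "\<delta> \<longlonglongrightarrow> (1 + 7 * 0) * (1 + 0 + sigma2 * 0) + 200 * (E.slack_const + 1 / sigma2) * sqrt 0 - 1"
      unfolding \<delta>_def[abs_def] by (intro tendsto_intros \<eta>_lim B_lim zeta_lim)
    then show ?thesis by simp
  qed
  \<comment> \<open>Since \<open>A n\<close> is at least \<open>k n 1\<close>, hence at least 1,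
    this yields \<open>R n \<ge> 1\<close>, which justifies the divisions by
    \<open>R n\<close>.\<close>
  have ev1: "eventually (\<lambda>n. A n \<le> \<bar>R n\<bar>) sequentially"
    using landau_o.smallD[OF A_o, of 1] by (simp add: eventually_mono)
  have ev2: "eventually (\<lambda>n. \<eta> n < 1/2) sequentially"
    using order_tendstoD(2)[OF \<eta>_lim, of "1/2"] by simp
  have "eventually (\<lambda>n.
      ennreal (1 / real n) *
        (\<integral>\<^sup>+\<omega>. ennreal (sq n (\<lambda>i. maest n (X n) (k n) (Mn n) (what n (y n \<omega>)) (y n \<omega>) i - f n i)) \<partial>P)
        \<le> ennreal ((1 + \<delta> n) * Rstar P eps n (X n) (f n) (p n))
      \<and>
      ennreal (1 / real n) *
        (\<integral>\<^sup>+\<omega>. ennreal (sq n (\<lambda>i. f n i - maest n (X n) (k n) (Mn n) (what n (y n \<omega>)) (f n) i)) \<partial>P)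
      + ennreal (sigma2 / real n) *
        (\<integral>\<^sup>+\<omega>. ennreal (\<Sum>a<n. \<Sum>b<n. (mamat n (X n) (k n) (Mn n) (what n (y n \<omega>)) a b)\<^sup>2) \<partial>P)
        \<le> ennreal ((1 + \<delta> n) * Rstar P eps n (X n) (f n) (p n))) sequentially"
    using ev1 ev2 sighat_int eventually_ge_at_top[of 1]
  proof eventually_elim
    fix n assume AR: "A n \<le> \<bar>R n\<bar>" and \<eta>2: "\<eta> n < 1/2"
      and int: "integrable P (\<lambda>\<omega>. (sighat n (y n \<omega>) - sigma2)\<^sup>2)" and n: "1 \<le> n"
    obtain e where e: "\<forall>l<p n. \<forall>i\<ge>n. e l i = 0" "orthonormal n e (p n)" "\<forall>j\<le>p n. colspan n (X n) j = lspan e j"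
      using gram_schmidt[where n=n and p="p n" and X="X n" and q="p n"] X_rank[OF n] by blast
    have k_less: "k n j < k n (Suc j)" if "j < Mn n" for j
      using k_mono[OF n, of j] k0[OF n] k1[OF n] that by (cases "j = 0") auto
    interpret N: nested_regression P eps sigma2 c n "p n" "X n" e "k n" "Mn n" "beta n"
      using e Mn_pos[OF n] k0[OF n] k_less n k_last[OF n] by unfold_locales auto
    have mean: "N.mean = f n" by (simp add: N.mean_def f_def)
    have y: "y n \<omega> = N.obs \<omega>" for \<omega> by (simp add: y_def mean)
    have R0: "0 \<le> R n" unfolding R_def using N.Rstar_nonneg by simp
    have "1 \<le> A n" using k1[OF n] by (simp add: A_def)
    with AR R0 have R1: "1 \<le> R n" by simp
    have V0: "0 \<le> V n" unfolding V_def by (intro mult_nonneg_nonneg Bochner_Integration.integral_nonneg) auto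
    have BR: "B n * R n = A n + V n" using R1 by (simp add: B_def field_simps)
    have B0: "0 \<le> B n" unfolding B_def using R1 V0 \<open>1 \<le> A n\<close> by simp
    have \<eta>0: "0 < \<eta> n" unfolding \<eta>_def using B0 by (simp add: add_nonneg_pos)
    have \<eta>_half: "\<eta> n \<le> 1/2" using \<eta>2 by simp
    have ratio': "real (k n (Suc j)) - real (k n j) \<le> (1 + zeta n) * (real (k n j) - real (k n (j - 1)))"
      if "1 \<le> j" "j < Mn n" for j
    proof -
      have "k n (j - 1) < k n j" using k_less[of "j - 1"] that by simp
      then show ?thesis using ratio[OF n, of j] that by (simp add: pos_divide_le_eq)
    qed
    let ?D = "E.slack_const * (N.\<Psi> * (1 + ln (real (Mn n)))\<^sup>2) + real (p n) * expectation (\<lambda>\<omega>. (sighat n (y n \<omega>) - sigma2)\<^sup>2) / sigma2"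
    have D_le: "?D \<le> (E.slack_const + 1 / sigma2) * (B n * R n)"
    proof -
      have "N.\<Psi> * (1 + ln (real (Mn n)))\<^sup>2 \<le> A n" using N.psi_eq by (simp add: A_def mean)
      then have "N.\<Psi> * (1 + ln (real (Mn n)))\<^sup>2 \<le> B n * R n" using V0 by (simp add: BR)
      then have "E.slack_const * (N.\<Psi> * (1 + ln (real (Mn n)))\<^sup>2) \<le> E.slack_const * (B n * R n)"
        by (rule mult_left_mono[OF _ E.slack_const_nonneg])
      moreover have "V n \<le> B n * R n" using \<open>1 \<le> A n\<close> by (simp add: BR)
      then have "V n / sigma2 \<le> B n * R n / sigma2" using sigma_pos by (intro divide_right_mono) auto
      ultimately show ?thesis by (simp add: V_def distrib_right)
    qed
    have total: "(1 + 7 * \<eta> n) * ((1 + zeta n) * R n + sigma2 * real (k n 1)) + 200 / \<eta> n * ?D \<le> (1 + \<delta> n) * R n"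
    proof -
      have "real (k n 1) \<le> B n * R n" unfolding BR using V0 by (simp add: A_def)
      then have "(1 + 7 * \<eta> n) * ((1 + zeta n) * R n + sigma2 * real (k n 1))
          \<le> (1 + 7 * \<eta> n) * ((1 + zeta n) * R n + sigma2 * (B n * R n))"
        using \<eta>0 sigma_pos by (intro mult_left_mono add_left_mono) auto
      also have "\<dots> = (1 + 7 * \<eta> n) * (1 + zeta n + sigma2 * B n) * R n"
        by (simp add: algebra_simps)
      finally have 1: "(1 + 7 * \<eta> n) * ((1 + zeta n) * R n + sigma2 * real (k n 1))
          \<le> (1 + 7 * \<eta> n) * (1 + zeta n + sigma2 * B n) * R n" .
      \<comment> \<open>The choice of \<eta> at work: relative to the optimal risk, the slack
        divided by \<eta> is again of order sqrt B.\<close>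
      have "B n / \<eta> n \<le> sqrt (B n)"
      proof -
        have "sqrt (B n) * sqrt (B n) \<le> sqrt (B n) * \<eta> n"
          unfolding \<eta>_def using B0 by (intro mult_left_mono) auto
        then show ?thesis using B0 \<eta>0 by (simp add: pos_divide_le_eq)
      qed
      then have "200 * (E.slack_const + 1 / sigma2) * (B n / \<eta> n) * R n \<le> 200 * (E.slack_const + 1 / sigma2) * sqrt (B n) * R n"
        using E.slack_const_nonneg sigma_pos R0 by (intro mult_right_mono mult_left_mono) auto
      moreover have "200 / \<eta> n * ?D \<le> 200 / \<eta> n * ((E.slack_const + 1 / sigma2) * (B n * R n))"
        using \<eta>0 by (intro mult_left_mono D_le) auto
      moreover have "200 / \<eta> n * ((E.slack_const + 1 / sigma2) * (B n * R n)) = 200 * (E.slack_const + 1 / sigma2) * (B n / \<eta> n) * R n"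
        by simp
      ultimately have 2: "200 / \<eta> n * ?D \<le> 200 * (E.slack_const + 1 / sigma2) * sqrt (B n) * R n" by linarith
      have "(1 + \<delta> n) * R n = (1 + 7 * \<eta> n) * (1 + zeta n + sigma2 * B n) * R n + 200 * (E.slack_const + 1 / sigma2) * sqrt (B n) * R n"
        unfolding \<delta>_def by (simp add: distrib_right)
      then show ?thesis using 1 2 by linarith
    qed
    have scale: "ennreal (1 / real n) * L \<le> ennreal ((1 + \<delta> n) * Rstar P eps n (X n) (f n) (p n))"
      if "L \<le> ennreal ((1 + 7 * \<eta> n) * ((1 + zeta n) * R n + sigma2 * real (k n 1)) + 200 / \<eta> n * ?D)" for L
    proof -
      have "ennreal (1 / real n) * L \<le> ennreal (1 / real n) * ennreal ((1 + \<delta> n) * R n)"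
        using that total by (intro mult_left_mono) (auto intro: order_trans ennreal_leI)
      also have "\<dots> = ennreal (1 / real n * ((1 + \<delta> n) * R n))" by (rule ennreal_mult'[symmetric]) simp
      also have "1 / real n * ((1 + \<delta> n) * R n) = (1 + \<delta> n) * Rstar P eps n (X n) (f n) (p n)"
        using n by (simp add: R_def)
      finally show ?thesis .
    qed
    have what: "what n (y n \<omega>) \<in> wsimplex (Mn n)" for \<omega> using what_min[OF n] by blast
    have min: "Cn n (X n) (k n) (Mn n) (sighat n (y n \<omega>)) (what n (y n \<omega>)) (N.obs \<omega>)
        \<le> Cn n (X n) (k n) (Mn n) (sighat n (y n \<omega>)) w (N.obs \<omega>)" if "w \<in> wsimplex (Mn n)" for \<omega> w
      using what_min[OF n, of "y n \<omega>"] that unfolding y by blast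
    note bound = N.expected_bound[OF sighat_meas int zeta_nonneg ratio' \<eta>0 \<eta>_half, unfolded mean, folded R_def]
    note pointwise = N.oracle_pointwise[OF what _ min \<eta>0 \<eta>_half, unfolded mean]
    have 1: "ennreal (1 / real n) *
        (\<integral>\<^sup>+\<omega>. ennreal (sq n (\<lambda>i. maest n (X n) (k n) (Mn n) (what n (y n \<omega>)) (y n \<omega>) i - f n i)) \<partial>P)
        \<le> ennreal ((1 + \<delta> n) * Rstar P eps n (X n) (f n) (p n))"
    proof (rule scale, rule bound)
      fix \<omega> w0 assume w0: "w0 \<in> wsimplex (Mn n)"
      show "sq n (\<lambda>i. maest n (X n) (k n) (Mn n) (what n (y n \<omega>)) (y n \<omega>) i - f n i)
        \<le> (1 + 7 * \<eta> n) * N.blocks.risk (tailweight (Mn n) w0) + 200 * N.slack (sighat n (y n \<omega>)) \<omega> / \<eta> n"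
        using pointwise(1)[OF w0 w0, of \<omega>] by (simp add: y mean)
    qed
    let ?b = "\<lambda>\<omega>. sq n (\<lambda>i. f n i - maest n (X n) (k n) (Mn n) (what n (y n \<omega>)) (f n) i)"
    let ?v = "\<lambda>\<omega>. \<Sum>a<n. \<Sum>b<n. (mamat n (X n) (k n) (Mn n) (what n (y n \<omega>)) a b)\<^sup>2"
    have meas: "?b \<in> borel_measurable P" "?v \<in> borel_measurable P"
      using what_meas unfolding sq_def maest_def mamat_def by measurable
    \<comment> \<open>The pointwise inequality bounds the sum of squared bias and variance, so the
      two integrals are merged before it is applied.\<close>
    have "ennreal (1 / real n) * (\<integral>\<^sup>+\<omega>. ennreal (?b \<omega>) \<partial>P) + ennreal (sigma2 / real n) * (\<integral>\<^sup>+\<omega>. ennreal (?v \<omega>) \<partial>P)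
      = ennreal (1 / real n) * (\<integral>\<^sup>+\<omega>. ennreal (?b \<omega> + sigma2 * ?v \<omega>) \<partial>P)"
    proof -
      have v0: "0 \<le> ?v \<omega>" for \<omega> by (intro sum_nonneg) auto
      have "(\<integral>\<^sup>+\<omega>. ennreal (?b \<omega> + sigma2 * ?v \<omega>) \<partial>P) = (\<integral>\<^sup>+\<omega>. ennreal (?b \<omega>) + ennreal sigma2 * ennreal (?v \<omega>) \<partial>P)"
        using v0 sq_nonneg sigma_pos by (intro nn_integral_cong) (simp add: ennreal_plus ennreal_mult)
      also have "\<dots> = (\<integral>\<^sup>+\<omega>. ennreal (?b \<omega>) \<partial>P) + ennreal sigma2 * (\<integral>\<^sup>+\<omega>. ennreal (?v \<omega>) \<partial>P)"
      proof -
        have "(\<integral>\<^sup>+\<omega>. ennreal (F \<omega>) + x * ennreal (G \<omega>) \<partial>P)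
          = (\<integral>\<^sup>+\<omega>. ennreal (F \<omega>) \<partial>P) + x * (\<integral>\<^sup>+\<omega>. ennreal (G \<omega>) \<partial>P)"
          if [measurable]: "F \<in> borel_measurable P" "G \<in> borel_measurable P" for F G x
          by (simp add: nn_integral_add nn_integral_cmult)
        from this[OF meas] show ?thesis .
      qed
      finally show ?thesis
        using sigma_pos by (simp add: distrib_left mult.assoc[symmetric] ennreal_mult[symmetric])
    qed
    also have "\<dots> \<le> ennreal ((1 + \<delta> n) * Rstar P eps n (X n) (f n) (p n))"
    proof (rule scale, rule bound)
      fix \<omega> w0 assume w0: "w0 \<in> wsimplex (Mn n)"
      show "?b \<omega> + sigma2 * ?v \<omega>
        \<le> (1 + 7 * \<eta> n) * N.blocks.risk (tailweight (Mn n) w0) + 200 * N.slack (sighat n (y n \<omega>)) \<omega> / \<eta> n"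
        using pointwise(2)[OF w0 w0, of \<omega>] by (simp add: y mean)
    qed
    finally show "ennreal (1 / real n) *
        (\<integral>\<^sup>+\<omega>. ennreal (sq n (\<lambda>i. maest n (X n) (k n) (Mn n) (what n (y n \<omega>)) (y n \<omega>) i - f n i)) \<partial>P)
        \<le> ennreal ((1 + \<delta> n) * Rstar P eps n (X n) (f n) (p n))
      \<and>
      ennreal (1 / real n) * (\<integral>\<^sup>+\<omega>. ennreal (?b \<omega>) \<partial>P) + ennreal (sigma2 / real n) * (\<integral>\<^sup>+\<omega>. ennreal (?v \<omega>) \<partial>P)
        \<le> ennreal ((1 + \<delta> n) * Rstar P eps n (X n) (f n) (p n))"
      using 1 by blast
  qed
  with \<delta>_lim show ?thesis by blast
qed

end
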